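(* Let $L(y,t)=\mathbf 1_{\{y\neq t\}}$ be the classification loss and let $\mathrm P$ have noise exponent $\alpha\in[0,\infty]$ with constant $c_\alpha>0$, i.e. $\mathrm P_X(\{x\in\mathcal X:|2\eta(x)-1|\le h\})\le c_\alpha h^\alpha$ for all $h\ge 0$. Put $\vartheta=\alpha/(1+\alpha)$. Then there exist a constant $V$ depending only on $\alpha$ (and $c_\alpha$) and, for every $\delta\in(0,1)$, a constant $C$ depending only on $d,\delta,\vartheta$ (and $c_\alpha$) such that for all $n\ge 1$, $k\in\mathbb N$ with $k\ge1$, $\tau>0$, $\lambda>0$, and conditionally on any fixed splitting policies $Z_t=(Z_{1t},\dots,Z_{kt})\in\mathcal Z^k$, the best-scored random tree $(g_{Z_t},p_{Z_t})$ with regularization parameter $\lambda$ satisfies, with probability (with respect to the sample $D_n\sim\mathrm P^n$) at least $1-3e^{-\tau}$, $$\lambda p_{Z_t}^2+\mathcal R_{L,\mathrm P}(g_{Z_t})-\mathcal R^*_{L,\mathrm P}\le 9\bigl(\lambda p_{Z_t}^{*2}+\mathcal R_{L,\mathrm P}(g^*_{Z_t})-\mathcal R^*_{L,\mathrm P}\bigr)+C\Bigl(\frac1{\lambda n^2}\Bigr)^{\frac1{3-2(1-\delta)\vartheta}}+3\Bigl(\frac{72V\tau}{n}\Bigr)^{\frac1{2-\vartheta}}+\frac{15\tau}{n}.$$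
   Context: Setting: $d\ge 1$, $\mathcal X=[0,1]^d$, $\mathcal Y=\{-1,1\}$; $\mathrm P$ is a probability distribution on $\mathcal X\times\mathcal Y$ with marginal $\mathrm P_X$ on $\mathcal X$ and posterior $\eta(x)=\mathrm P(Y=1\mid X=x)$. $D_n=((x_1,y_1),\dots,(x_n,y_n))$ is an i.i.d. sample from $\mathrm P$ and $D$ its empirical measure. $\mathcal R_{L,\mathrm P}(f)=\mathrm P(f(X)\ne Y)$, $\mathcal R_{L,D}(f)=\frac1n\sum_{i=1}^n\mathbf 1_{\{f(x_i)\neq y_i\}}$, and $\mathcal R^*_{L,\mathrm P}=\inf\{\mathcal R_{L,\mathrm P}(f): f:\mathcal X\to\mathcal Y \text{ measurable}\}$. For $\alpha=\infty$ put $\vartheta=1$. Purely random partitions: a splitting policy $Z=(Q_0,Q_1,\dots)\in\mathcal Z$ describes a recursive axis-parallel partition of $\mathcal X$. Start with the single cell $\mathcal X$ (0 splits). At each step choose one of the current cells (leaves), a coordinate in $\{1,\dots,d\}$ and a ratio $S\in(0,1)$, and cut the chosen box orthogonally to that coordinate into two boxes, the proportion of the side length given to one of them being $S$. (The common face is assigned to one of the two boxes so that cells are disjoint.) $\mathcal A_{Z,p}$ is the resulting partition of $\mathcal X$ into $p+1$ boxes after $p$ splits. Best-scored tree: for $p\in\mathbb N=\{0,1,2,\dots\}$ let $\mathcal T_{Z,p}=\{\sum_{j=0}^p c_j\mathbf 1_{A_j}: c_j\in\{-1,1\},\ \{A_0,\dots,A_p\}=\mathcal A_{Z,p}\}$.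 Only $p\le\lambda^{-1/2}$ is considered. Given policies $Z_t=(Z_{1t},\dots,Z_{kt})$ and $\lambda>0$, $(g_{Z_t},p_{Z_t})$ is a (measurably chosen) minimizer of $\lambda p^2+\mathcal R_{L,D}(g)$ over all $\ell\in\{1,\dots,k\}$, $p\in\mathbb N$ with $p\le\lambda^{-1/2}$, $g\in\mathcal T_{Z_{\ell t},p}$ (where $g_{Z_t}$ is the function and $p_{Z_t}$ its number of splits), and $(g^*_{Z_t},p^*_{Z_t})$ is a minimizer of $\lambda p^2+\mathcal R_{L,\mathrm P}(g)$ over the same set. *)

theory Defs
  imports "HOL-Probability.Probability"
begin

(* The dimension d is a natural number rather than a type, so that a constant can be chosen
   independently of d.  A point of [0,1]^d is an extensional function on {..<d}. *)

definition cube :: "nat \<Rightarrow> (nat \<Rightarrow> real) measure" where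
  "cube d = (\<Pi>\<^sub>M i\<in>{..<d}. restrict_space borel {0..1})"

definition labels :: "int measure" where
  "labels = count_space {-1, 1}"

definition marginal :: "nat \<Rightarrow> ((nat \<Rightarrow> real) \<times> int) measure \<Rightarrow> (nat \<Rightarrow> real) measure" where
  "marginal d P = distr P (cube d) fst"

(* eta is a version of x |-> P(Y = 1 | X = x). *)
definition is_posterior ::
    "nat \<Rightarrow> ((nat \<Rightarrow> real) \<times> int) measure \<Rightarrow> ((nat \<Rightarrow> real) \<Rightarrow> real) \<Rightarrow> bool" where
  "is_posterior d P \<eta> \<longleftrightarrow>
     \<eta> \<in> borel_measurable (cube d) \<and>
     (\<forall>x\<in>space (cube d). 0 \<le> \<eta> x \<and> \<eta> x \<le> 1) \<and>
     (\<forall>A\<in>sets (cube d). measure P (A \<times> {1}) = (LINT x:A|marginal d P. \<eta> x))"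

(* h^alpha for h >= 0 and alpha in [0,oo]; in contrast to powr, 0^0 = 1.  For alpha = oo it is
   0, 1 or oo according to h < 1, h = 1 or h > 1. *)
definition epow :: "real \<Rightarrow> ennreal \<Rightarrow> ennreal" where
  "epow h \<alpha> =
     (if \<alpha> = \<infinity> then (if h < 1 then 0 else if h = 1 then 1 else \<infinity>)
      else if \<alpha> = 0 then 1
      else ennreal (h powr enn2real \<alpha>))"

definition noise_exponent ::
    "nat \<Rightarrow> ((nat \<Rightarrow> real) \<times> int) measure \<Rightarrow> ((nat \<Rightarrow> real) \<Rightarrow> real) \<Rightarrow> ennreal \<Rightarrow> real \<Rightarrow> bool" where
  "noise_exponent d P \<eta> \<alpha> c \<longleftrightarrow>
     (\<forall>h\<ge>0. emeasure (marginal d P) {x \<in> space (cube d). \<bar>2 * \<eta> x - 1\<bar> \<le> h}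
              \<le> ennreal c * epow h \<alpha>)"

definition vartheta :: "ennreal \<Rightarrow> real" where
  "vartheta \<alpha> = (if \<alpha> = \<infinity> then 1 else enn2real \<alpha> / (1 + enn2real \<alpha>))"

definition risk :: "((nat \<Rightarrow> real) \<times> int) measure \<Rightarrow> ((nat \<Rightarrow> real) \<Rightarrow> int) \<Rightarrow> real" where
  "risk P f = measure P {z \<in> space P. f (fst z) \<noteq> snd z}"

definition emp_risk ::
    "nat \<Rightarrow> (nat \<Rightarrow> (nat \<Rightarrow> real) \<times> int) \<Rightarrow> ((nat \<Rightarrow> real) \<Rightarrow> int) \<Rightarrow> real" where
  "emp_risk n D f = (1 / real n) * (\<Sum>i<n. of_bool (f (fst (D i)) \<noteq> snd (D i)))"

definition bayes_risk :: "nat \<Rightarrow> ((nat \<Rightarrow> real) \<times> int) measure \<Rightarrow> real" where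
  "bayes_risk d P = (INF f \<in> cube d \<rightarrow>\<^sub>M labels. risk P f)"

(* A split names the cell to be cut, the coordinate, the ratio, and whether the common face
   belongs to the lower of the two resulting boxes.  The ratio is that of the lower box. *)
record split_rule =
  leaf :: "(nat \<Rightarrow> real) set"
  coord :: nat
  ratio :: real
  face_low :: bool

definition cut_point :: "split_rule \<Rightarrow> real" where
  "cut_point q =
     (let a = (INF x \<in> leaf q. x (coord q)); b = (SUP x \<in> leaf q. x (coord q))
      in a + ratio q * (b - a))"

definition lower_piece :: "split_rule \<Rightarrow> (nat \<Rightarrow> real) set" where
  "lower_piece q =
     {x \<in> leaf q. if face_low q then x (coord q) \<le> cut_point q else x (coord q) < cut_point q}"

definition upper_piece :: "split_rule \<Rightarrow> (nat \<Rightarrow> real) set" where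
  "upper_piece q = leaf q - lower_piece q"

(* cells d Z p is the partition after the first p splits Z 0, ..., Z (p - 1). *)
primrec cells :: "nat \<Rightarrow> (nat \<Rightarrow> split_rule) \<Rightarrow> nat \<Rightarrow> (nat \<Rightarrow> real) set set" where
  "cells d Z 0 = {space (cube d)}"
| "cells d Z (Suc p) =
     (cells d Z p - {leaf (Z p)}) \<union> {lower_piece (Z p), upper_piece (Z p)}"

definition policies :: "nat \<Rightarrow> (nat \<Rightarrow> split_rule) set" where
  "policies d =
     {Z. \<forall>p. leaf (Z p) \<in> cells d Z p \<and> coord (Z p) < d \<and> 0 < ratio (Z p) \<and> ratio (Z p) < 1}"

definition trees :: "nat \<Rightarrow> (nat \<Rightarrow> split_rule) \<Rightarrow> nat \<Rightarrow> ((nat \<Rightarrow> real) \<Rightarrow> int) set" where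
  "trees d Z p =
     {g. \<exists>c. (\<forall>A\<in>cells d Z p. c A \<in> {-1, 1}) \<and>
             g = (\<lambda>x. \<Sum>A\<in>cells d Z p. c A * indicator A x)}"

definition candidates ::
    "nat \<Rightarrow> nat \<Rightarrow> (nat \<Rightarrow> nat \<Rightarrow> split_rule) \<Rightarrow> real \<Rightarrow> (((nat \<Rightarrow> real) \<Rightarrow> int) \<times> nat) set" where
  "candidates d k Z lam =
     {(g, p). real p \<le> lam powr (-1/2) \<and> (\<exists>l\<in>{1..k}. g \<in> trees d (Z l) p)}"

definition best_scored ::
    "nat \<Rightarrow> nat \<Rightarrow> (nat \<Rightarrow> nat \<Rightarrow> split_rule) \<Rightarrow> real \<Rightarrow> (((nat \<Rightarrow> real) \<Rightarrow> int) \<Rightarrow> real) \<Rightarrow>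
     ((nat \<Rightarrow> real) \<Rightarrow> int) \<times> nat \<Rightarrow> bool" where
  "best_scored d k Z lam R =
     is_arg_min (\<lambda>(g, p). lam * (real p)\<^sup>2 + R g) (\<lambda>gp. gp \<in> candidates d k Z lam)"

(* A measurable selection, for every sample, of an empirical minimizer.  For lam > 0 there are only
   finitely many candidates, so they carry the discrete sigma-algebra. *)
definition best_scored_selection ::
    "nat \<Rightarrow> ((nat \<Rightarrow> real) \<times> int) measure \<Rightarrow> nat \<Rightarrow> nat \<Rightarrow> (nat \<Rightarrow> nat \<Rightarrow> split_rule) \<Rightarrow> real \<Rightarrow>
     ((nat \<Rightarrow> (nat \<Rightarrow> real) \<times> int) \<Rightarrow> ((nat \<Rightarrow> real) \<Rightarrow> int) \<times> nat) \<Rightarrow> bool" where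
  "best_scored_selection d P n k Z lam sel \<longleftrightarrow>
     sel \<in> (\<Pi>\<^sub>M i\<in>{..<n}. P) \<rightarrow>\<^sub>M count_space (candidates d k Z lam) \<and>
     (\<forall>D\<in>space (\<Pi>\<^sub>M i\<in>{..<n}. P). best_scored d k Z lam (emp_risk n D) (sel D))"

end

(*
  Read top-down, a p-split partition is a binary tree of axis-parallel cuts, so the number S_p(m) of
  dichotomies that p-split trees induce on m points satisfies
    S_p(m) <= d * (sum over i + j = p - 1 and r + s = m of S_i(r) S_j(s)),
  because the cuts along one coordinate form a chain.  This convolution solves to
  S_p(m) <= K_p * binom(p + m, p) with K_p of Catalan type.  The entropy of p-split trees is therefore
  linear in p, without a factor ln p and uniformly in the policies, whose number k is arbitrary.

  Covering numbers in L1(P) follow from growth by the probabilistic method.  For theta > 0, Bernstein's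
  inequality on one net, with the scale chosen by the noise exponent, costs a logarithm ln (n / p) that
  the slack delta absorbs.  For theta = 0 there is no slack, and chaining over dyadic nets avoids the
  logarithm.  In both cases the distance to the finest net is controlled by symmetrization.  Young's
  inequality with p / n = sqrt (lam p^2) * sqrt (1 / (lam n^2)) trades the entropy for the penalty.
*)
theory Submission
  imports Defs
begin

section \<open>Dichotomies induced by recursive axis-parallel partitions\<close>

text \<open>The order of the constants shapes the proof. \<open>V\<close> is fixed before d and
  \<delta>, so the dimension may enter only through the entropy term: the coefficient of
  (\<tau>/n)^\<kappa>, with \<kappa> = 1/(2 - \<theta>), has to stay free of the growth constant b =
  1 + ln (8 d), which is left for C. The levels p are united at the price of a failure probability
  exp (-(p + \<tau>)) for each. C may depend on neither n nor p, so a factor ln p in the entropy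
  would survive the trade against the penalty. The exponent that can be given away is \<beta> =
  \<delta> \<theta>/2; at \<theta> = 0 the required exponent 1/3 is met with equality, which forces
  a bound of exact order sqrt (p/n) there. For \<tau> \<le> 1 the probability bound is vacuous; for
  \<tau> > n or lam n^2 < 1 the right-hand side is at least 2, which no penalised excess risk of a
  candidate exceeds. The remaining case has p \<le> n, by p \<le> lam^(-1/2), and 1/(lam n^2) \<le>
  1, so that lowering an exponent of this quantity only weakens the bound.\<close>

inductive tree_set :: "nat \<Rightarrow> nat \<Rightarrow> (nat \<Rightarrow> real) set \<Rightarrow> (nat \<Rightarrow> real) set \<Rightarrow> bool" for d where
  empty_leaf: "tree_set d 0 Y {}"
| full_leaf: "tree_set d 0 Y Y"
| node: "\<lbrakk>j < d; Y1 = {x\<in>Y. x j \<le> t} \<or> Y1 = {x\<in>Y. x j < t};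
    tree_set d p Y1 A; tree_set d q (Y - Y1) B\<rbrakk> \<Longrightarrow> tree_set d (Suc (p + q)) Y (A \<union> B)"

lemma tree_set_subset: "tree_set d p Y A \<Longrightarrow> A \<subseteq> Y"
  by (induction rule: tree_set.induct) auto

text \<open>A cut of Y restricted to F is a cut of Y \<inter> F at the same threshold, possibly with
  an empty side. This is why the root set is arbitrary in \<open>tree_set\<close>: trees on the cube
  become trees on a finite sample, where they can be counted.\<close>

lemma tree_set_restrict: "tree_set d p Y A \<Longrightarrow> tree_set d p (Y \<inter> F) (A \<inter> F)"
proof (induction rule: tree_set.induct)
  case (node j Y1 Y t p A q B)
  have "Y1 \<inter> F = {x\<in>Y \<inter> F. x j \<le> t} \<or> Y1 \<inter> F = {x\<in>Y \<inter> F. x j < t}"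
    using node.hyps(2) by auto
  moreover have "Y \<inter> F - Y1 \<inter> F = (Y - Y1) \<inter> F" by auto
  ultimately show ?case
    using tree_set.node[OF node.hyps(1), of "Y1 \<inter> F" "Y \<inter> F" t p "A \<inter> F" q "B \<inter> F"] node.IH
    by (simp add: Int_Un_distrib2)
qed (auto intro: tree_set.intros)

text \<open>Records the whole partition instead of one labelled region, since \<open>cells\<close>
  replaces a leaf at each step while the counting recursion splits at the root. The index p counts
  splits, not cells: as a set, the partition merges empty pieces.\<close>

inductive partition_of :: "nat \<Rightarrow> nat \<Rightarrow> (nat \<Rightarrow> real) set \<Rightarrow> (nat \<Rightarrow> real) set set \<Rightarrow> bool" for d where
  single: "partition_of d 0 Y {Y}"
| branch: "\<lbrakk>j < d; Y1 = {x\<in>Y. x j \<le> t} \<or> Y1 = {x\<in>Y. x j < t};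
    partition_of d p Y1 Q; partition_of d q (Y - Y1) R\<rbrakk>
    \<Longrightarrow> partition_of d (Suc (p + q)) Y (Q \<union> R)"

lemma partition_of_subset: "partition_of d p Y Q \<Longrightarrow> A \<in> Q \<Longrightarrow> A \<subseteq> Y"
  by (induction arbitrary: A rule: partition_of.induct) auto

lemma partition_of_Union: "partition_of d p Y Q \<Longrightarrow> \<Union>Q = Y"
  by (induction rule: partition_of.induct) auto

lemma partition_of_disjoint:
  "partition_of d p Y Q \<Longrightarrow> A \<in> Q \<Longrightarrow> B \<in> Q \<Longrightarrow> A \<noteq> B \<Longrightarrow> A \<inter> B = {}"
proof (induction arbitrary: A B rule: partition_of.induct)
  case (branch j Y1 Y t p Q q R)
  have "A \<inter> B = {}" if "A \<in> Q" "B \<in> R" for A B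
    using partition_of_subset[OF branch.hyps(3) that(1)] partition_of_subset[OF branch.hyps(4) that(2)]
    by auto
  then show ?case using branch.IH branch.prems by (metis Int_commute Un_iff)
qed auto

lemma partition_of_finite: "partition_of d p Y Q \<Longrightarrow> finite Q"
  by (induction rule: partition_of.induct) auto

lemma partition_of_refine:
  assumes "partition_of d p Y Q" "C \<in> Q" "j < d" "C1 = {x\<in>C. x j \<le> t} \<or> C1 = {x\<in>C. x j < t}"
  shows "partition_of d (Suc p) Y ((Q - {C}) \<union> {C1, C - C1})"
  using assms
proof (induction rule: partition_of.induct)
  case (single Y)
  have "partition_of d (Suc (0 + 0)) Y ({C1} \<union> {Y - C1})"
    using single by (intro partition_of.branch[of j d C1 Y t]) (auto intro: partition_of.single)
  then show ?case using single by (simp add: insert_commute)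
next
  case (branch i Y1 Y s p Q q R)
  let ?S = "{C1, C - C1}"
  \<comment> \<open>C can lie on both sides of the root cut only if it is empty; then
    \<open>C1\<close> is empty too, and removing C and adding its pieces changes nothing.\<close>
  have disj: "C = {}" if "C \<in> Q" "C \<in> R"
    using partition_of_subset[OF branch.hyps(3) that(1)] partition_of_subset[OF branch.hyps(4) that(2)]
    by auto
  have C1: "C1 = {}" if "C = {}" using branch.prems(3) that by auto
  show ?case
  proof (cases "C \<in> Q")
    case True
    have "partition_of d (Suc (Suc p + q)) Y ((Q - {C} \<union> ?S) \<union> R)"
      using branch True by (intro partition_of.branch[of i d Y1 Y s]) auto
    moreover have "(Q - {C} \<union> ?S) \<union> R = (Q \<union> R - {C}) \<union> ?S"
      using disj[OF True] C1 True by auto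
    ultimately show ?thesis by simp
  next
    case False
    then have R: "C \<in> R" using branch.prems by auto
    have "partition_of d (Suc (p + Suc q)) Y (Q \<union> (R - {C} \<union> ?S))"
      using branch R by (intro partition_of.branch[of i d Y1 Y s]) auto
    moreover have "Q \<union> (R - {C} \<union> ?S) = (Q \<union> R - {C}) \<union> ?S"
      using False by auto
    ultimately show ?thesis by simp
  qed
qed

lemma partition_of_labelling:
  "partition_of d p Y Q \<Longrightarrow> tree_set d p Y (\<Union>{A\<in>Q. c A = (1::int)})"
proof (induction rule: partition_of.induct)
  case (single Y)
  show ?case by (cases "c Y = 1") (auto intro: tree_set.intros simp: Collect_conv_if conj_commute)
next
  case (branch j Y1 Y t p Q q R)
  have "\<Union>{A \<in> Q \<union> R. c A = 1} = \<Union>{A \<in> Q. c A = 1} \<union> \<Union>{A \<in> R. c A = 1}" by auto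
  then show ?case using tree_set.node[OF branch.hyps(1,2) branch.IH] by simp
qed

text \<open>Passage from growth at the leaves to recursion at the root. \<open>cut_point\<close>
  becomes some threshold t, and \<open>partition_of\<close> admits every threshold, so that a single
  family of regions covers all policies.\<close>

lemma cells_partition_of:
  assumes "Z \<in> policies d"
  shows "partition_of d p (space (cube d)) (cells d Z p)"
proof (induction p)
  case (Suc p)
  have Z: "leaf (Z p) \<in> cells d Z p" "coord (Z p) < d" using assms by (auto simp: policies_def)
  have "lower_piece (Z p) = {x \<in> leaf (Z p). x (coord (Z p)) \<le> cut_point (Z p)} \<or>
    lower_piece (Z p) = {x \<in> leaf (Z p). x (coord (Z p)) < cut_point (Z p)}"
    unfolding lower_piece_def by (cases "face_low (Z p)") auto
  from partition_of_refine[OF Suc Z this] show ?case by (simp add: upper_piece_def)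
qed (auto intro: partition_of.single)

lemma trees_tree_set:
  assumes Z: "Z \<in> policies d" and g: "g \<in> trees d Z p"
  shows "tree_set d p (space (cube d)) {x\<in>space (cube d). g x = 1}"
    and "\<And>x. x \<in> space (cube d) \<Longrightarrow> g x \<in> {-1, 1}"
proof -
  note part = cells_partition_of[OF Z, of p]
  from g obtain c where c: "\<And>A. A \<in> cells d Z p \<Longrightarrow> c A \<in> {-1, 1}"
    and g: "g = (\<lambda>x. \<Sum>A\<in>cells d Z p. c A * indicator A x)" unfolding trees_def by auto
  have val: "g x = c A" if "A \<in> cells d Z p" "x \<in> A" for x A
  proof -
    have "g x = (\<Sum>B\<in>cells d Z p. if B = A then c A else 0)"
      unfolding g using partition_of_disjoint[OF part that(1)] that
      by (intro sum.cong) (auto simp: indicator_def)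
    then show ?thesis using that partition_of_finite[OF part] by simp
  qed
  have cover: "\<exists>A\<in>cells d Z p. x \<in> A" if "x \<in> space (cube d)" for x
    using partition_of_Union[OF part] that by auto
  show "g x \<in> {-1, 1}" if "x \<in> space (cube d)" for x
    using cover[OF that] val c by metis
  have "{x\<in>space (cube d). g x = 1} = \<Union>{A\<in>cells d Z p. c A = 1}"
  proof (intro set_eqI iffI)
    fix x assume "x \<in> {x\<in>space (cube d). g x = 1}"
    then obtain A where "A \<in> cells d Z p" "x \<in> A" "g x = 1" using cover by auto
    then show "x \<in> \<Union>{A\<in>cells d Z p. c A = 1}" using val[of A x] by auto
  next
    fix x assume "x \<in> \<Union>{A\<in>cells d Z p. c A = 1}"
    then obtain A where A: "A \<in> cells d Z p" "x \<in> A" "c A = 1" by auto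
    then show "x \<in> {x\<in>space (cube d). g x = 1}"
      using val[OF A(1,2)] partition_of_subset[OF part A(1)] by auto
  qed
  then show "tree_set d p (space (cube d)) {x\<in>space (cube d). g x = 1}"
    using partition_of_labelling[OF part, of c] by simp
qed

text \<open>Up to sign these are binomial coefficients with negative upper index: (p + k choose k)
  is the coefficient of x^k in (1 - x)^(-(p + 1)). A product of two such series adds the exponents,
  and the result p + q + 1 is the number of splits after joining two subtrees at a root.\<close>

lemma sum_choose_convolution:
  "(\<Sum>k\<le>m. ((p + k) choose k) * ((q + (m - k)) choose (m - k))) = (p + q + 1 + m) choose m"
proof -
  have neg: "(- (real a + 1) gchoose k) = (-1)^k * real ((a + k) choose k)" for a k
    using gbinomial_minus[of "real a + 1" k] by (simp add: binomial_gbinomial)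
  have "(\<Sum>k\<in>{0..m}. (- (real p + 1) gchoose k) * (- (real q + 1) gchoose (m - k)))
      = (- (real (p + q + 1) + 1) gchoose m)"
  proof -
    have "- (real p + 1) + - (real q + 1) = - (real (p + q + 1) + 1)" by simp
    then show ?thesis
      using gbinomial_Vandermonde[of "- (real p + 1)" "- (real q + 1)" m] by metis
  qed
  then have "(\<Sum>k\<in>{0..m}. (-1)^m * (real ((p + k) choose k) * real ((q + (m - k)) choose (m - k))))
      = (-1)^m * real ((p + q + 1 + m) choose m)"
    unfolding neg
    by (subst sum.cong[OF refl, of _ _ "\<lambda>k. (-1)^k * real ((p + k) choose k) *
          ((-1)^(m-k) * real ((q + (m - k)) choose (m - k)))"])
       (auto simp: power_add[symmetric] algebra_simps)
  then have "real (\<Sum>k\<in>{0..m}. ((p + k) choose k) * ((q + (m - k)) choose (m - k)))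
     = real ((p + q + 1 + m) choose m)"
    by (simp add: sum_distrib_left[symmetric])
  then show ?thesis by (simp only: of_nat_eq_iff atMost_atLeast0)
qed

(* Two to the number of leaves, summed over the tree shapes with a coordinate at every node. The guard
   i <= p is only there for the termination proof. *)
fun shapes :: "nat \<Rightarrow> nat \<Rightarrow> nat" where
  "shapes d 0 = 2"
| "shapes d (Suc p) = d * (\<Sum>i\<in>{..p}. if i \<le> p then shapes d i * shapes d (p - i) else 0)"

lemma shapes_Suc: "shapes d (Suc p) = d * (\<Sum>i\<le>p. shapes d i * shapes d (p - i))"
  by simp

declare shapes.simps(2) [simp del]

(* Evaluating the truncated generating function F of the Catalan-type recursion F = 2 + d x F^2 at x = 1/(8d)
   keeps it below 4. *)
lemma shapes_le:
  assumes "d \<ge> 1"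
  shows "real (shapes d p) \<le> 4 * (8 * real d) ^ p"
proof -
  define r where "r = 1 / (8 * real d)"
  have r: "r > 0" "d * r = 1/8" using assms by (auto simp: r_def)
  define a where "a = (\<lambda>i. real (shapes d i) * r ^ i)"
  have a0: "a i \<ge> 0" for i using r by (simp add: a_def)
  have a_Suc: "a (Suc p) = 1/8 * (\<Sum>i\<le>p. a i * a (p - i))" for p
  proof -
    have "a (Suc p) = (d * r) * (\<Sum>i\<le>p. real (shapes d i) * real (shapes d (p - i)) * r ^ p)"
      by (simp add: a_def shapes_Suc sum_distrib_left sum_distrib_right algebra_simps)
    also have "(\<Sum>i\<le>p. real (shapes d i) * real (shapes d (p - i)) * r ^ p) = (\<Sum>i\<le>p. a i * a (p - i))"
      by (intro sum.cong) (auto simp: a_def power_add[symmetric])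
    finally show ?thesis using r by simp
  qed
  \<comment> \<open>4 is the double root of F = 2 + F^2/8, so 1/(8 d) is the critical point of the
    recursion and the bound reproduces itself under truncation.\<close>
  have "(\<Sum>i\<le>p. a i) \<le> 4" for p
  proof (induction p)
    case (Suc p)
    have "(\<Sum>i\<le>Suc p. a i) = a 0 + (\<Sum>k\<le>p. a (Suc k))" by (simp only: sum.atMost_Suc_shift)
    also have "(\<Sum>k\<le>p. a (Suc k)) = 1/8 * (\<Sum>k\<le>p. \<Sum>i\<le>k. a i * a (k - i))"
      by (simp add: a_Suc sum_distrib_left)
    also have "(\<Sum>k\<le>p. \<Sum>i\<le>k. a i * a (k - i)) = (\<Sum>(i,j)\<in>{(i,j). i + j \<le> p}. a i * a j)"
      by (rule sum.triangle_reindex_eq[symmetric])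
    also have "\<dots> \<le> (\<Sum>(i,j)\<in>{..p} \<times> {..p}. a i * a j)"
      by (intro sum_mono2) (auto simp: a0)
    also have "\<dots> = (\<Sum>i\<le>p. a i) * (\<Sum>i\<le>p. a i)"
      by (simp add: sum_product sum.cartesian_product)
    also have "\<dots> \<le> 4 * 4" using Suc by (intro mult_mono sum_nonneg) (auto simp: a0)
    finally show ?case by (simp add: a_def)
  qed (simp add: a_def)
  moreover have "a p \<le> (\<Sum>i\<le>p. a i)" by (rule member_le_sum) (auto simp: a0)
  ultimately have "a p \<le> 4" by (meson order_trans)
  then have "real (shapes d p) * r ^ p * (8 * real d) ^ p \<le> 4 * (8 * real d) ^ p"
    unfolding a_def by (intro mult_right_mono) auto
  moreover have "r ^ p * (8 * real d) ^ p = 1"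
  proof -
    have "r * (8 * real d) = 1" using assms by (simp add: r_def)
    then show ?thesis by (metis power_mult_distrib power_one)
  qed
  ultimately show ?thesis by (metis mult.assoc mult_1_right)
qed

section \<open>Counting dichotomies through chains of cuts\<close>

definition cuts :: "nat \<Rightarrow> (nat \<Rightarrow> real) set \<Rightarrow> (nat \<Rightarrow> real) set set" where
  "cuts j Y = {Y1. \<exists>t. Y1 = {x\<in>Y. x j \<le> t} \<or> Y1 = {x\<in>Y. x j < t}}"

lemma cuts_linear: "Y1 \<in> cuts j Y \<Longrightarrow> Y2 \<in> cuts j Y \<Longrightarrow> Y1 \<subseteq> Y2 \<or> Y2 \<subseteq> Y1"
proof -
  assume "Y1 \<in> cuts j Y" "Y2 \<in> cuts j Y"
  then obtain s t where "Y1 = {x\<in>Y. x j \<le> s} \<or> Y1 = {x\<in>Y. x j < s}"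
    "Y2 = {x\<in>Y. x j \<le> t} \<or> Y2 = {x\<in>Y. x j < t}" unfolding cuts_def by blast
  then show ?thesis by (cases s t rule: linorder_cases) fastforce+
qed

lemma cuts_sub: "cuts j Y \<subseteq> Pow Y" by (auto simp: cuts_def)

(* The sets cut off along one coordinate form a chain, so they are told apart by their cardinality. *)
lemma sum_cuts_le:
  fixes f :: "nat \<Rightarrow> nat"
  assumes "finite Y"
  shows "(\<Sum>Y1\<in>cuts j Y. f (card Y1)) \<le> (\<Sum>k\<le>card Y. f k)"
proof -
  have inj: "inj_on card (cuts j Y)"
    using cuts_linear[of _ j Y] cuts_sub[of j Y] finite_subset[OF _ assms]
    by (intro inj_onI) (metis PowD card_subset_eq subsetD)
  have "(\<Sum>Y1\<in>cuts j Y. f (card Y1)) = (\<Sum>k\<in>card ` cuts j Y. f k)"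
    by (simp add: sum.reindex[OF inj])
  also have "\<dots> \<le> (\<Sum>k\<le>card Y. f k)"
    using cuts_sub[of j Y] assms by (intro sum_mono2) (auto intro: card_mono)
  finally show ?thesis .
qed

lemma tree_set_SucE:
  assumes "tree_set d (Suc p) Y A"
  obtains j Y1 i A1 A2 where "j < d" "Y1 \<in> cuts j Y" "i \<le> p" "tree_set d i Y1 A1"
    "tree_set d (p - i) (Y - Y1) A2" "A = A1 \<union> A2"
  using assms
proof (cases rule: tree_set.cases)
  case (node j Y1 t i A1 q A2)
  then show thesis by (intro that[of j Y1 i A1 A2]) (auto simp: cuts_def)
qed

text \<open>The product form is stable under the recursion. The root fixes a coordinate, the split
  number i of one side and a cut of k points; the sum over k is the Vandermonde convolution and
  returns the same binomial coefficient for every i, while the sum over i and the coordinates is the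
  recursion of \<open>shapes\<close>.\<close>

lemma card_tree_set_le:
  assumes "finite Y"
  shows "card {A. tree_set d p Y A} \<le> shapes d p * ((p + card Y) choose card Y)"
  using assms
proof (induction p arbitrary: Y rule: less_induct)
  case (less p)
  have fin: "finite {A. tree_set d q X A}" if "X \<subseteq> Y" for q X
    by (rule finite_subset[of _ "Pow X"])
      (use that less.prems in \<open>auto dest: tree_set_subset intro: finite_subset\<close>)
  show ?case
  proof (cases p)
    case 0
    have "{A. tree_set d 0 Y A} \<subseteq> {{}, Y}" by (auto elim: tree_set.cases)
    then have "card {A. tree_set d 0 Y A} \<le> card {{}, Y}" by (intro card_mono) auto
    also have "\<dots> \<le> 2" by (simp add: card_insert_if)
    finally show ?thesis using 0 by simp
  next
    case (Suc q)
    let ?T = "\<lambda>i X. {A. tree_set d i X A}"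
    let ?U = "\<lambda>i Y1. (\<lambda>(A1, A2). A1 \<union> A2) ` (?T i Y1 \<times> ?T (q - i) (Y - Y1))"
    let ?b = "\<lambda>i k. ((i + k) choose k)"
    let ?m = "card Y"
    have finc: "finite (cuts j Y)" for j using cuts_sub finite_subset less.prems by blast
    have finU: "finite (?U i Y1)" if "Y1 \<in> cuts j Y" for i j Y1
      using that cuts_sub by (intro finite_imageI finite_cartesian_product fin) auto
    have "?T p Y \<subseteq> (\<Union>j<d. \<Union>i\<le>q. \<Union>Y1\<in>cuts j Y. ?U i Y1)"
      unfolding Suc by (auto elim!: tree_set_SucE)
    then have "card (?T p Y) \<le> card (\<Union>j<d. \<Union>i\<le>q. \<Union>Y1\<in>cuts j Y. ?U i Y1)"
      using finU finc by (intro card_mono) auto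
    also have "\<dots> \<le> (\<Sum>j<d. \<Sum>i\<le>q. \<Sum>Y1\<in>cuts j Y. card (?U i Y1))"
      by (intro order.trans[OF card_UN_le] sum_mono order.trans[OF card_UN_le] finc order_refl) auto
    also have "\<dots> \<le> (\<Sum>j<d. \<Sum>i\<le>q. \<Sum>Y1\<in>cuts j Y.
        (shapes d i * shapes d (q - i)) * (?b i (card Y1) * ?b (q - i) (?m - card Y1)))"
    proof (intro sum_mono)
      fix j i Y1 assume *: "i \<in> {..q}" "Y1 \<in> cuts j Y"
      then have sub: "Y1 \<subseteq> Y" using cuts_sub by auto
      then have f1: "finite Y1" "finite (Y - Y1)" using less.prems finite_subset by auto
      have "card (?U i Y1) \<le> card (?T i Y1) * card (?T (q - i) (Y - Y1))"
        by (subst card_cartesian_product[symmetric], intro card_image_le finite_cartesian_product fin) (use sub in auto)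
      also have "\<dots> \<le> (shapes d i * ?b i (card Y1)) * (shapes d (q - i) * ?b (q - i) (card (Y - Y1)))"
        using less.IH[of i Y1] less.IH[of "q - i" "Y - Y1"] f1 * Suc by (intro mult_le_mono) auto
      also have "card (Y - Y1) = ?m - card Y1" using sub f1 by (simp add: card_Diff_subset)
      finally show "card (?U i Y1) \<le> (shapes d i * shapes d (q - i)) *
          (?b i (card Y1) * ?b (q - i) (?m - card Y1))" by (simp add: mult_ac)
    qed
    also have "\<dots> \<le> (\<Sum>j<d. \<Sum>i\<le>q. (shapes d i * shapes d (q - i)) * ?b (Suc q) ?m)"
    proof (intro sum_mono)
      fix j i assume *: "i \<in> {..q}"
      have "(\<Sum>Y1\<in>cuts j Y. ?b i (card Y1) * ?b (q - i) (?m - card Y1))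
        \<le> (\<Sum>k\<le>?m. ?b i k * ?b (q - i) (?m - k))"
        by (rule sum_cuts_le[OF less.prems])
      also have "\<dots> = ?b (Suc q) ?m"
        using * by (subst sum_choose_convolution) simp
      finally show "(\<Sum>Y1\<in>cuts j Y. (shapes d i * shapes d (q - i)) *
          (?b i (card Y1) * ?b (q - i) (?m - card Y1)))
          \<le> (shapes d i * shapes d (q - i)) * ?b (Suc q) ?m"
        unfolding sum_distrib_left[symmetric] by (rule mult_le_mono2)
    qed
    also have "\<dots> = shapes d p * ?b p ?m"
      by (simp add: Suc shapes_Suc sum_distrib_left sum_distrib_right mult_ac)
    finally show ?thesis .
  qed
qed

text \<open>A single term of (y + z)^(p + m) = 1 with y = m/(p + m) and z = p/(p + m) is at most 1.
  Here z^(-p) = (1 + m/p)^p, and y^(-m) = (1 + p/m)^m \<le> exp p.\<close>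

lemma binomial_entropy_bound:
  assumes "p > 0"
  shows "real ((p + m) choose m) \<le> exp (real p * (1 + ln (1 + real m / real p)))"
proof -
  let ?p = "real p" and ?m = "real m"
  define y where "y = ?m / (?p + ?m)"
  define z where "z = ?p / (?p + ?m)"
  have z: "z > 0" "y + z = 1" "y \<ge> 0" using assms by (auto simp: y_def z_def add_divide_distrib[symmetric])
  have "real ((p + m) choose m) * y ^ m * z ^ p \<le> (\<Sum>k\<le>p+m. real ((p + m) choose k) * y ^ k * z ^ (p + m - k))"
    using member_le_sum[of m "{..p+m}" "\<lambda>k. real ((p + m) choose k) * y ^ k * z ^ (p + m - k)"] z by auto
  also have "\<dots> = (y + z) ^ (p + m)" by (simp add: binomial_ring)
  finally have *: "real ((p + m) choose m) * y ^ m * z ^ p \<le> 1" using z by simp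
  have lnz: "- ln z = ln (1 + ?m / ?p)" using assms by (simp add: z_def ln_div field_simps add_pos_nonneg)
  have "exp (- ?p) \<le> y ^ m"
  proof (cases "m = 0")
    case False
    have ypos: "y > 0" using False assms by (simp add: y_def)
    have "- ln y = ln (1 + ?p / ?m)" using False by (simp add: y_def ln_div field_simps add_pos_nonneg)
    also have "\<dots> \<le> ?p / ?m" by (intro ln_add_one_self_le_self) auto
    finally have "- ?p \<le> ?m * ln y" using False by (simp add: field_simps)
    then have "exp (- ?p) \<le> exp (?m * ln y)" by simp
    also have "\<dots> = y ^ m" using ypos by (simp add: exp_of_nat_mult)
    finally show ?thesis .
  qed auto
  then have "real ((p + m) choose m) * exp (- ?p) * z ^ p \<le> 1"
    using * z by (meson mult_left_mono mult_right_mono of_nat_0_le_iff order_trans zero_le_power less_imp_le)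
  moreover have "z ^ p = exp (- ?p * ln (1 + ?m / ?p))"
    using z lnz by (metis exp_ln exp_of_nat_mult minus_minus mult_minus_left mult_minus_right)
  ultimately have "real ((p + m) choose m) * exp (- (?p * (1 + ln (1 + ?m / ?p)))) \<le> 1"
    by (simp add: exp_diff exp_minus field_simps)
  then show ?thesis by (subst (asm) exp_minus) (simp only: field_simps exp_gt_zero, simp)
qed

text \<open>This is 4 (exp b (1 + m/p))^p. All dependence on the dimension sits in \<open>b\<close>,
  for trees 1 + ln (8 d): the 1 comes from the binomial coefficient, ln (8 d) and the prefactor 4
  come from \<open>shapes\<close>. For p = 0 the value is 4 whatever m is.\<close>

definition growth_bound :: "real \<Rightarrow> nat \<Rightarrow> nat \<Rightarrow> real" where
  "growth_bound b p m = 4 * exp (real p * (b + ln (1 + real m / real p)))"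

lemma card_tree_set_growth:
  assumes "finite Y" "d \<ge> 1"
  shows "real (card {A. tree_set d p Y A}) \<le> growth_bound (1 + ln (8 * real d)) p (card Y)"
proof -
  have "real (card {A. tree_set d p Y A}) \<le> real (shapes d p) * real ((p + card Y) choose card Y)"
    using card_tree_set_le[OF assms(1), of d p] by (metis of_nat_le_iff of_nat_mult)
  also have "\<dots> \<le> growth_bound (1 + ln (8 * real d)) p (card Y)"
  proof (cases "p = 0")
    case False
    have "real (shapes d p) * real ((p + card Y) choose card Y)
      \<le> (4 * (8 * real d) ^ p) * exp (real p * (1 + ln (1 + real (card Y) / real p)))"
      using False by (intro mult_mono shapes_le binomial_entropy_bound assms) auto
    also have "(8 * real d) ^ p = exp (real p * ln (8 * real d))"
      using assms by (simp add: exp_of_nat_mult)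
    finally show ?thesis
      by (simp add: growth_bound_def exp_add[symmetric] algebra_simps)
  qed (simp add: growth_bound_def)
  finally show ?thesis .
qed

section \<open>Concentration and covering numbers\<close>

definition emp_mean :: "nat \<Rightarrow> ('a \<Rightarrow> real) \<Rightarrow> (nat \<Rightarrow> 'a) \<Rightarrow> real" where
  "emp_mean n f D = (\<Sum>i<n. f (D i)) / real n"

lemma emp_mean_measurable [measurable]:
  assumes [measurable]: "f \<in> borel_measurable M"
  shows "emp_mean n f \<in> borel_measurable (\<Pi>\<^sub>M i\<in>{..<n}. M)"
  unfolding emp_mean_def by measurable

lemma exp_le_quadratic:
  fixes x :: real
  assumes "x \<le> 1"
  shows "exp x \<le> 1 + x + x\<^sup>2"
proof (cases "x \<ge> 0")
  case False
  have "1 - x \<le> exp (- x)" using exp_ge_add_one_self[of "- x"] by simp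
  then have "exp x \<le> 1 / (1 - x)" using False by (simp add: exp_minus field_simps)
  also have "\<dots> \<le> 1 + x + x\<^sup>2"
  proof -
    have "x ^ 3 \<le> 0" using False by (simp add: power_le_zero_eq)
    then have "1 \<le> (1 + x + x\<^sup>2) * (1 - x)"
      by (simp add: power2_eq_square power3_eq_cube algebra_simps)
    then show ?thesis using False by (simp add: pos_divide_le_eq)
  qed
  finally show ?thesis .
qed (use exp_bound assms in auto)

context prob_space
begin

lemma prob_space_sample: "prob_space (\<Pi>\<^sub>M i\<in>I. M)"
  by (intro prob_space_PiM prob_space_axioms)

text \<open>The bounds |f| \<le> 1 and s \<le> 1/2 keep s (f - E f) below 1, the range of
  \<open>exp_le_quadratic\<close>. The linear term integrates to zero, and the variance is at most
  the second moment.\<close>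

lemma bernstein_mgf:
  fixes f :: "'a \<Rightarrow> real"
  assumes [measurable]: "f \<in> borel_measurable M" and bd: "\<And>x. x \<in> space M \<Longrightarrow> \<bar>f x\<bar> \<le> 1"
    and v: "expectation (\<lambda>x. (f x)\<^sup>2) \<le> v" and s: "0 \<le> s" "s \<le> 1/2"
  shows "expectation (\<lambda>x. exp (s * (f x - expectation f))) \<le> exp (s\<^sup>2 * v)"
proof -
  let ?\<mu> = "expectation f"
  have int: "integrable M f"
    by (rule integrable_const_bound[of _ 1]) (use bd in \<open>auto intro!: AE_I2\<close>)
  have sq: "(f x)\<^sup>2 \<le> 1" if "x \<in> space M" for x using bd[OF that] by (simp add: abs_square_le_1)
  have int2: "integrable M (\<lambda>x. (f x)\<^sup>2)"
    by (rule integrable_const_bound[of _ 1]) (auto intro!: AE_I2 simp: sq)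
  have \<mu>: "\<bar>?\<mu>\<bar> \<le> 1"
  proof -
    have "\<bar>?\<mu>\<bar> \<le> expectation (\<lambda>x. \<bar>f x\<bar>)" by simp
    also have "\<dots> \<le> expectation (\<lambda>x. 1)" using int by (intro integral_mono) (auto simp: bd)
    finally show ?thesis by (simp add: prob_space)
  qed
  have diff: "s * (f x - ?\<mu>) \<le> 1" if "x \<in> space M" for x
  proof -
    have "s * (f x - ?\<mu>) \<le> s * 2" using bd[OF that] \<mu> s by (intro mult_left_mono) auto
    then show ?thesis using s by simp
  qed
  have "expectation (\<lambda>x. exp (s * (f x - ?\<mu>)))
      \<le> expectation (\<lambda>x. 1 + s * (f x - ?\<mu>) + s\<^sup>2 * (f x - ?\<mu>)\<^sup>2)"
  proof (rule integral_mono)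
    show "integrable M (\<lambda>x. exp (s * (f x - ?\<mu>)))"
      by (rule integrable_const_bound[of _ "exp 1"]) (auto intro!: AE_I2 simp: diff)
    show "integrable M (\<lambda>x. 1 + s * (f x - ?\<mu>) + s\<^sup>2 * (f x - ?\<mu>)\<^sup>2)"
      using int int2 by (auto simp: power2_diff)
    show "exp (s * (f x - ?\<mu>)) \<le> 1 + s * (f x - ?\<mu>) + s\<^sup>2 * (f x - ?\<mu>)\<^sup>2" if "x \<in> space M" for x
      using exp_le_quadratic[OF diff[OF that]] by (simp add: power_mult_distrib)
  qed
  also have "\<dots> = 1 + s\<^sup>2 * (expectation (\<lambda>x. (f x)\<^sup>2) - ?\<mu>\<^sup>2)"
  proof -
    have i1: "integrable M (\<lambda>x. (f x - ?\<mu>)\<^sup>2)" using int int2 by (auto simp: power2_diff)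
    have "expectation (\<lambda>x. 1 + s * (f x - ?\<mu>) + s\<^sup>2 * (f x - ?\<mu>)\<^sup>2)
      = 1 + s * (expectation f - ?\<mu>) + s\<^sup>2 * expectation (\<lambda>x. (f x - ?\<mu>)\<^sup>2)"
      using int int2 i1 by (simp add: prob_space)
    then show ?thesis using variance_eq[OF int int2] by simp
  qed
  also have "\<dots> \<le> 1 + s\<^sup>2 * v" using v by (intro add_left_mono mult_left_mono) (auto intro: order_trans[rotated])
  also have "\<dots> \<le> exp (s\<^sup>2 * v)" by (rule exp_ge_add_one_self)
  finally show ?thesis .
qed

text \<open>The Chernoff bound is left unoptimised. With s free the threshold is linear in v, so
  that the localized argument can take s proportional to the margin level h, and chaining can take
  it proportional to r over the standard deviation of a link.\<close>

lemma bernstein_one_sided: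
  assumes [measurable]: "f \<in> borel_measurable M" and bd: "\<And>x. x \<in> space M \<Longrightarrow> \<bar>f x\<bar> \<le> 1"
    and v: "expectation (\<lambda>x. (f x)\<^sup>2) \<le> v" and s: "0 < s" "s \<le> 1/2" and n: "n > 0"
  shows "measure (\<Pi>\<^sub>M i\<in>{..<n}. M) {D \<in> space (\<Pi>\<^sub>M i\<in>{..<n}. M).
      emp_mean n f D - expectation f \<ge> s * v + L / (real n * s)} \<le> exp (- L)"
proof -
  let ?N = "\<Pi>\<^sub>M i\<in>{..<n}. M" and ?\<mu> = "expectation f"
  interpret N: prob_space ?N by (rule prob_space_sample)
  interpret P: product_sigma_finite "\<lambda>_. M" ..
  let ?g = "\<lambda>x. exp (s * (f x - ?\<mu>))"
  let ?u = "\<lambda>D. \<Prod>i<n. ?g (D i)"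
  have intg: "integrable M ?g"
    by (rule integrable_const_bound[of _ "exp (s * (1 - ?\<mu>))"])
       (use bd s in \<open>auto intro!: AE_I2 mult_left_mono simp: abs_le_iff\<close>)
  have u: "?u D = exp (s * real n * (emp_mean n f D - ?\<mu>))" for D
    using n by (simp add: exp_sum[symmetric] emp_mean_def sum_distrib_left[symmetric] sum_subtractf field_simps)
  have E: "N.expectation ?u = (expectation ?g) ^ n"
    using P.product_integral_prod[of "{..<n}" "\<lambda>_. ?g"] intg by simp
  have intu: "integrable ?N ?u"
    by (rule P.product_integrable_prod) (auto simp: intg)
  have "N.expectation ?u \<le> exp (s\<^sup>2 * v) ^ n"
    unfolding E using bernstein_mgf[OF assms(1) bd v, of s] s
    by (intro power_mono integral_nonneg_AE) auto
  also have "\<dots> = exp (real n * (s\<^sup>2 * v))" by (simp add: exp_of_nat_mult)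
  finally have E': "N.expectation ?u \<le> exp (real n * (s\<^sup>2 * v))" .
  have "{D \<in> space ?N. emp_mean n f D - ?\<mu> \<ge> s * v + L / (real n * s)}
      \<subseteq> {D \<in> space ?N. ?u D \<ge> exp (real n * (s\<^sup>2 * v) + L)}"
  proof safe
    fix D assume "emp_mean n f D - ?\<mu> \<ge> s * v + L / (real n * s)"
    then have "s * real n * (s * v + L / (real n * s)) \<le> s * real n * (emp_mean n f D - ?\<mu>)"
      using s by (intro mult_left_mono) auto
    moreover have "s * real n * (s * v + L / (real n * s)) = real n * (s\<^sup>2 * v) + L"
      using s n by (simp add: field_simps power2_eq_square)
    ultimately show "exp (real n * (s\<^sup>2 * v) + L) \<le> ?u D" by (simp add: u)
  qed
  then have "measure ?N {D \<in> space ?N. emp_mean n f D - ?\<mu> \<ge> s * v + L / (real n * s)}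
     \<le> measure ?N {D \<in> space ?N. ?u D \<ge> exp (real n * (s\<^sup>2 * v) + L)}"
    by (intro N.finite_measure_mono) auto
  also have "\<dots> \<le> N.expectation ?u / exp (real n * (s\<^sup>2 * v) + L)"
    using intu by (intro integral_Markov_inequality_measure[of _ _ "{}"]) (auto intro!: prod_nonneg)
  also have "\<dots> \<le> exp (real n * (s\<^sup>2 * v)) / exp (real n * (s\<^sup>2 * v) + L)"
    using E' by (intro divide_right_mono) auto
  also have "\<dots> = exp (- L)" by (simp add: exp_diff[symmetric])
  finally show ?thesis .
qed

lemma bernstein:
  assumes [measurable]: "f \<in> borel_measurable M" and bd: "\<And>x. x \<in> space M \<Longrightarrow> \<bar>f x\<bar> \<le> 1"
    and v: "expectation (\<lambda>x. (f x)\<^sup>2) \<le> v" and s: "0 < s" "s \<le> 1/2" and n: "n > 0"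
  shows "measure (\<Pi>\<^sub>M i\<in>{..<n}. M) {D \<in> space (\<Pi>\<^sub>M i\<in>{..<n}. M).
      \<bar>emp_mean n f D - expectation f\<bar> \<ge> s * v + L / (real n * s)} \<le> 2 * exp (- L)"
proof -
  let ?N = "\<Pi>\<^sub>M i\<in>{..<n}. M"
  interpret N: prob_space ?N by (rule prob_space_sample)
  let ?t = "s * v + L / (real n * s)"
  let ?A = "\<lambda>f. {D \<in> space ?N. emp_mean n f D - expectation f \<ge> ?t}"
  have neg: "emp_mean n (\<lambda>x. - f x) D = - emp_mean n f D" for D
    by (simp add: emp_mean_def sum_negf)
  have "{D \<in> space ?N. \<bar>emp_mean n f D - expectation f\<bar> \<ge> ?t} \<subseteq> ?A f \<union> ?A (\<lambda>x. - f x)"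
    by (auto simp: neg)
  then have "measure ?N {D \<in> space ?N. \<bar>emp_mean n f D - expectation f\<bar> \<ge> ?t}
      \<le> measure ?N (?A f \<union> ?A (\<lambda>x. - f x))"
    by (intro N.finite_measure_mono) auto
  also have "\<dots> \<le> measure ?N (?A f) + measure ?N (?A (\<lambda>x. - f x))"
    by (intro measure_Un_le) auto
  also have "\<dots> \<le> exp (- L) + exp (- L)"
    using v by (intro add_mono bernstein_one_sided bd s n) (auto simp: bd)
  finally show ?thesis by simp
qed

end

section \<open>Covering numbers from the growth of traces\<close>

lemma finite_separated_net:
  fixes dst :: "'a \<Rightarrow> 'a \<Rightarrow> real"
  assumes "finite \<E>" "\<And>A B. dst A B = dst B A" "\<And>A. dst A A \<le> \<epsilon>"
  shows "\<exists>\<C>\<subseteq>\<E>. (\<forall>A\<in>\<C>. \<forall>B\<in>\<C>. A \<noteq> B \<longrightarrow> dst A B > \<epsilon>) \<and> (\<forall>A\<in>\<E>. \<exists>B\<in>\<C>. dst A B \<le> \<epsilon>)"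
  using assms(1)
proof (induction rule: finite_induct)
  case (insert E \<E>)
  then obtain \<C> where C: "\<C> \<subseteq> \<E>" "\<forall>A\<in>\<C>. \<forall>B\<in>\<C>. A \<noteq> B \<longrightarrow> dst A B > \<epsilon>"
    "\<forall>A\<in>\<E>. \<exists>B\<in>\<C>. dst A B \<le> \<epsilon>" by blast
  show ?case
  proof (cases "\<exists>B\<in>\<C>. dst E B \<le> \<epsilon>")
    case True
    then show ?thesis using C by (intro exI[of _ \<C>]) auto
  next
    case False
    then show ?thesis using C assms(2,3) by (intro exI[of _ "insert E \<C>"]) (auto simp: not_le)
  qed
qed auto

text \<open>Here y is the logarithm of a packing number and m the size of a sample that separates
  the packing, so y occurs on both sides. On the right it sits under a logarithm, which costs at
  most z/2 plus terms free of z, where z = (y - ln 4)/p; moving z/2 to the left doubles the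
  remaining terms and leaves a bound linear in p.\<close>

lemma entropy_fixpoint:
  fixes y b \<epsilon> :: real and m p :: nat
  assumes "exp y \<le> growth_bound b p m" "real m \<le> 2 * y / \<epsilon> + 2" "0 < \<epsilon>" "\<epsilon> \<le> 1" "b \<ge> 1"
  shows "y \<le> ln 4 + real p * (2 * b + 4 + 2 * ln (1 / \<epsilon>))"
proof -
  have g: "growth_bound b p m > 0" by (simp add: growth_bound_def)
  have "y \<le> ln (growth_bound b p m)" using assms(1) g by (simp add: ln_ge_iff)
  also have "\<dots> = ln 4 + real p * (b + ln (1 + real m / real p))"
    by (simp add: growth_bound_def ln_mult)
  finally have y: "y \<le> ln 4 + real p * (b + ln (1 + real m / real p))" .
  have lne: "ln (1 / \<epsilon>) \<ge> 0" using assms by simp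
  show ?thesis
  proof (cases "p = 0 \<or> y \<le> ln 4")
    case True
    then show ?thesis using y lne assms(5) by (auto intro: order_trans add_nonneg_nonneg mult_nonneg_nonneg)
  next
    case False
    then have p: "real p \<ge> 1" by simp
    define z where "z = (y - ln 4) / real p"
    have yz: "y = ln 4 + real p * z" and z0: "z > 0" using p False by (auto simp: z_def)
    have ln4: "ln 4 \<le> (7/5::real)"
    proof -
      have "ln (4::real) = 2 * ln 2" using ln_realpow[of 2 2] by simp
      then show ?thesis using ln2_le_25_over_36 by simp
    qed
    have "real m / real p \<le> (2 * (ln 4 + real p * z) / \<epsilon> + 2) / real p"
      using assms(2) p yz by (intro divide_right_mono) auto
    also have "\<dots> = 2 * ln 4 / \<epsilon> / real p + 2 * z / \<epsilon> + 2 / real p"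
      using p by (simp add: add_divide_distrib distrib_left)
    also have "\<dots> \<le> 2 * ln 4 / \<epsilon> + 2 * z / \<epsilon> + 2"
    proof -
      have "2 * ln 4 / \<epsilon> / real p \<le> 2 * ln 4 / \<epsilon> / 1"
        using p assms(3) by (intro divide_left_mono) auto
      moreover have "2 / real p \<le> 2" using p by (simp add: field_simps)
      ultimately show ?thesis by simp
    qed
    finally have "1 + real m / real p \<le> 3 + (2 * ln 4 + 2 * z) / \<epsilon>" by (simp add: add_divide_distrib)
    also have "\<dots> \<le> 3 / \<epsilon> + (3 + 2 * z) / \<epsilon>"
      using ln4 assms(3,4) by (intro add_mono divide_right_mono) (auto simp: field_simps)
    finally have le: "1 + real m / real p \<le> (6 + 2 * z) / \<epsilon>" by (simp add: add_divide_distrib)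
    have "ln (1 + real m / real p) \<le> ln ((6 + 2 * z) / \<epsilon>)"
      using le by (intro ln_mono add_pos_nonneg) auto
    also have "\<dots> = ln (6 + 2 * z) + ln (1 / \<epsilon>)"
      using z0 assms(3) by (simp add: ln_div)
    \<comment> \<open>The factor 4 is split off before ln x \<le> x - 1 is applied, which brings the
      slope in z down to 1/2; ln 4 + 1/2 stays below 2.\<close>
    also have "ln (6 + 2 * z) = ln 4 + ln ((6 + 2 * z) / 4)"
      using z0 by (simp add: ln_div)
    also have "ln ((6 + 2 * z) / 4) \<le> (6 + 2 * z) / 4 - 1"
      using z0 by (intro ln_le_minus_one) auto
    finally have l: "ln (1 + real m / real p) \<le> 2 + z / 2 + ln (1 / \<epsilon>)"
      using ln4 by (simp add: add_divide_distrib)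
    have "real p * z \<le> real p * (b + ln (1 + real m / real p))" using y yz by simp
    then have "z \<le> b + ln (1 + real m / real p)" using p by (simp add: mult_le_cancel_left_pos)
    then have "z \<le> 2 * b + 4 + 2 * ln (1 / \<epsilon>)" using l by simp
    then show ?thesis using p yz by (simp add: mult_left_mono)
  qed
qed

context prob_space
begin

definition growth_le :: "'a set set \<Rightarrow> real \<Rightarrow> nat \<Rightarrow> bool" where
  "growth_le \<E> b p \<longleftrightarrow>
    (\<forall>F. finite F \<and> F \<subseteq> space M \<longrightarrow> real (card ((\<lambda>E. E \<inter> F) ` \<E>)) \<le> growth_bound b p (card F))"

lemma prob_sample_avoids:
  assumes A: "A \<in> events"
  shows "measure (\<Pi>\<^sub>M i\<in>{..<m}. M) {D \<in> space (\<Pi>\<^sub>M i\<in>{..<m}. M). \<forall>i<m. D i \<notin> A} = (1 - prob A) ^ m"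
proof -
  interpret P: product_sigma_finite "\<lambda>_. M" ..
  have "{D \<in> space (\<Pi>\<^sub>M i\<in>{..<m}. M). \<forall>i<m. D i \<notin> A} = (\<Pi>\<^sub>E i\<in>{..<m::nat}. space M - A)"
    unfolding space_PiM PiE_def Pi_def by fast
  moreover have "emeasure (\<Pi>\<^sub>M i\<in>{..<m::nat}. M) (\<Pi>\<^sub>E i\<in>{..<m}. space M - A) = (\<Prod>i\<in>{..<m}. emeasure M (space M - A))"
    using A by (intro P.emeasure_PiM) auto
  ultimately have "emeasure (\<Pi>\<^sub>M i\<in>{..<m}. M) {D \<in> space (\<Pi>\<^sub>M i\<in>{..<m}. M). \<forall>i<m. D i \<notin> A}
      = (emeasure M (space M - A)) ^ m" by simp
  also have "emeasure M (space M - A) = ennreal (1 - prob A)"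
    using A by (simp add: emeasure_eq_measure prob_compl)
  also have "\<dots> ^ m = ennreal ((1 - prob A) ^ m)" by (simp add: ennreal_power)
  finally show ?thesis
    by (subst measure_def) (simp add: zero_le_power)
qed

(* The probabilistic method: a sample of size m separates all members of a separated family. *)
lemma separated_family_traces:
  assumes C: "finite \<C>" "\<C> \<subseteq> events" and sep: "\<And>A B. A \<in> \<C> \<Longrightarrow> B \<in> \<C> \<Longrightarrow> A \<noteq> B \<Longrightarrow> prob (sym_diff A B) > \<epsilon>"
    and eps: "0 \<le> \<epsilon>" and m: "(real (card \<C>))\<^sup>2 * exp (- \<epsilon> * real m) < 1"
  shows "\<exists>F. finite F \<and> F \<subseteq> space M \<and> card F \<le> m \<and> inj_on (\<lambda>E. E \<inter> F) \<C>"
proof -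
  let ?N = "\<Pi>\<^sub>M i\<in>{..<m}. M"
  interpret N: prob_space ?N by (rule prob_space_sample)
  let ?P = "{(A, B). A \<in> \<C> \<and> B \<in> \<C> \<and> A \<noteq> B}"
  let ?V = "\<lambda>(A, B). {D \<in> space ?N. \<forall>i<m. D i \<notin> sym_diff A B}"
  have sub: "?P \<subseteq> \<C> \<times> \<C>" by auto
  have finP: "finite ?P" by (rule finite_subset[OF sub finite_cartesian_product[OF C(1) C(1)]])
  have meas: "?V x \<in> N.events" if x_in: "x \<in> ?P" for x
  proof -
    obtain A B where x: "x = (A, B)" "A \<in> events" "B \<in> events" using x_in C(2) by (cases x) auto
    define S where "S = sym_diff A B"
    have [measurable]: "S \<in> events" using x by (auto simp: S_def)
    have "{D \<in> space ?N. \<forall>i<m. D i \<notin> S} = (\<Inter>i<m. {D \<in> space ?N. D i \<notin> S}) \<inter> space ?N"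
      by auto
    also have "\<dots> \<in> N.events" by (cases "m = 0") (auto intro!: sets.Int sets.finite_INT)
    finally show ?thesis by (simp only: x prod.case S_def)
  qed
  have "N.prob (\<Union>x\<in>?P. ?V x) \<le> (\<Sum>x\<in>?P. N.prob (?V x))"
    using finP meas by (intro N.finite_measure_subadditive_finite) auto
  also have "\<dots> \<le> (\<Sum>x\<in>?P. exp (- \<epsilon> * real m))"
  proof (intro sum_mono)
    fix x assume "x \<in> ?P"
    then obtain A B where x: "x = (A, B)" "A \<in> \<C>" "B \<in> \<C>" "A \<noteq> B" by auto
    then have ev: "sym_diff A B \<in> events" using C by auto
    have "N.prob (?V x) = (1 - prob (sym_diff A B)) ^ m"
      using prob_sample_avoids[OF ev] x by simp
    also have "\<dots> \<le> (1 - \<epsilon>) ^ m" using sep[OF x(2,3,4)] by (intro power_mono) auto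
    also have "\<dots> \<le> exp (- \<epsilon>) ^ m"
    proof (rule power_mono)
      show "1 - \<epsilon> \<le> exp (- \<epsilon>)" using exp_ge_add_one_self[of "- \<epsilon>"] by simp
      show "0 \<le> 1 - \<epsilon>" using sep[OF x(2,3,4)] prob_le_1[of "sym_diff A B"] by linarith
    qed
    also have "\<dots> = exp (- \<epsilon> * real m)" by (simp add: exp_of_nat_mult[symmetric] mult.commute)
    finally show "N.prob (?V x) \<le> exp (- \<epsilon> * real m)" .
  qed
  also have "\<dots> \<le> real (card (\<C> \<times> \<C>)) * exp (- \<epsilon> * real m)"
    using card_mono[OF finite_cartesian_product[OF C(1) C(1)] sub] by simp
  also have "\<dots> < 1" using m by (simp add: power2_eq_square card_cartesian_product)
  finally have lt: "N.prob (\<Union>x\<in>?P. ?V x) < 1" .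
  have "\<exists>D\<in>space ?N. D \<notin> (\<Union>x\<in>?P. ?V x)"
  proof (rule ccontr)
    assume "\<not> ?thesis"
    then have "(\<Union>x\<in>?P. ?V x) = space ?N" by auto
    then show False using lt N.prob_space by simp
  qed
  then obtain D where D: "D \<in> space ?N" "D \<notin> (\<Union>x\<in>?P. ?V x)" by blast
  let ?F = "D ` {..<m}"
  have "inj_on (\<lambda>E. E \<inter> ?F) \<C>"
  proof (rule inj_onI, rule ccontr)
    fix A B assume AB: "A \<in> \<C>" "B \<in> \<C>" "A \<inter> ?F = B \<inter> ?F" "A \<noteq> B"
    then have "D \<notin> ?V (A, B)" using D by blast
    then obtain i where "i < m" "D i \<in> sym_diff A B" using D by auto
    then show False using AB(3) by auto
  qed
  moreover have "?F \<subseteq> space M" using D by (auto simp: space_PiM)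
  moreover have "card ?F \<le> m" using card_image_le[of "{..<m}" D] by simp
  ultimately show ?thesis by blast
qed

lemma growth_bound_mono: "k \<le> m \<Longrightarrow> growth_bound b p k \<le> growth_bound b p m"
proof -
  assume "k \<le> m"
  then have "ln (1 + real k / real p) \<le> ln (1 + real m / real p)"
    by (intro ln_mono add_left_mono divide_right_mono add_pos_nonneg) auto
  then show ?thesis unfolding growth_bound_def
    by (intro mult_left_mono) (auto intro!: mult_left_mono)
qed

lemma separated_family_card:
  assumes C: "finite \<C>" "\<C> \<subseteq> events" and sep: "\<And>A B. A \<in> \<C> \<Longrightarrow> B \<in> \<C> \<Longrightarrow> A \<noteq> B \<Longrightarrow> prob (sym_diff A B) > \<epsilon>"
    and eps: "0 < \<epsilon>" "\<epsilon> \<le> 1" and gr: "growth_le \<C> b p" and b: "b \<ge> 1"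
  shows "real (card \<C>) \<le> 4 * exp (real p * (2 * b + 4 + 2 * ln (1 / \<epsilon>)))"
proof (cases "\<C> = {}")
  case False
  then have c: "real (card \<C>) \<ge> 1" using C(1) by (simp add: Suc_le_eq card_gt_0_iff)
  define y where "y = ln (real (card \<C>))"
  have y0: "y \<ge> 0" using c by (simp add: y_def)
  have ey: "exp y = real (card \<C>)" using c by (simp add: y_def)
  \<comment> \<open>The union bound over pairs asks for exp (2 y - \<epsilon> m) < 1. Rounding up,
    and one more for strictness, costs the summand 2 in \<open>entropy_fixpoint\<close>.\<close>
  define m where "m = nat \<lceil>2 * y / \<epsilon>\<rceil> + 1"
  have "0 \<le> 2 * y / \<epsilon>" using y0 eps by simp
  then have m: "2 * y / \<epsilon> < real m" "real m \<le> 2 * y / \<epsilon> + 2"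
    unfolding m_def by linarith+
  have "(real (card \<C>))\<^sup>2 * exp (- \<epsilon> * real m) = exp (2 * y - \<epsilon> * real m)"
    unfolding ey[symmetric] by (simp add: exp_diff exp_minus field_simps power2_eq_square exp_add[symmetric])
  also have "\<dots> < 1" using m(1) eps by (simp add: field_simps)
  finally obtain F where F: "finite F" "F \<subseteq> space M" "card F \<le> m" "inj_on (\<lambda>E. E \<inter> F) \<C>"
    using separated_family_traces[OF C, of \<epsilon> m] sep eps by auto
  have "exp y = real (card ((\<lambda>E. E \<inter> F) ` \<C>))" using F(4) by (simp add: ey card_image)
  also have "\<dots> \<le> growth_bound b p (card F)" using gr F by (auto simp: growth_le_def)
  also have "\<dots> \<le> growth_bound b p m" using F by (intro growth_bound_mono) auto
  finally have "y \<le> ln 4 + real p * (2 * b + 4 + 2 * ln (1 / \<epsilon>))"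
    using entropy_fixpoint m(2) eps b by blast
  then have "exp y \<le> exp (ln 4 + real p * (2 * b + 4 + 2 * ln (1 / \<epsilon>)))" by simp
  then show ?thesis by (simp add: ey exp_add)
qed simp

lemma growth_le_subset:
  assumes "growth_le \<E> b p" "\<C> \<subseteq> \<E>" "finite \<E>"
  shows "growth_le \<C> b p"
  unfolding growth_le_def
proof safe
  fix F assume F: "finite F" "F \<subseteq> space M"
  have "card ((\<lambda>E. E \<inter> F) ` \<C>) \<le> card ((\<lambda>E. E \<inter> F) ` \<E>)"
    using assms by (intro card_mono image_mono) auto
  then show "real (card ((\<lambda>E. E \<inter> F) ` \<C>)) \<le> growth_bound b p (card F)"
    using assms(1) F unfolding growth_le_def by (meson of_nat_le_iff order_trans)
qed

text \<open>A maximal separated subset is a net. The projection stays inside the class, so that net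
  elements inherit the margin bound and the minimality of the Bayes risk, and so that E and \<pi> E
  have traces counted by the same growth bound.\<close>

lemma covering_map:
  assumes E: "finite \<E>" "\<E> \<subseteq> events" and gr: "growth_le \<E> b p" and b: "b \<ge> 1" and eps: "0 < \<epsilon>" "\<epsilon> \<le> 1"
  obtains \<pi> where "\<And>E. E \<in> \<E> \<Longrightarrow> \<pi> E \<in> \<E>" "\<And>E. E \<in> \<E> \<Longrightarrow> prob (sym_diff E (\<pi> E)) \<le> \<epsilon>"
    "real (card (\<pi> ` \<E>)) \<le> 4 * exp (real p * (2 * b + 4 + 2 * ln (1 / \<epsilon>)))"
proof -
  obtain \<C> where C: "\<C> \<subseteq> \<E>" "\<forall>A\<in>\<C>. \<forall>B\<in>\<C>. A \<noteq> B \<longrightarrow> prob (sym_diff A B) > \<epsilon>"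
    "\<forall>A\<in>\<E>. \<exists>B\<in>\<C>. prob (sym_diff A B) \<le> \<epsilon>"
    using finite_separated_net[OF E(1), of "\<lambda>A B. prob (sym_diff A B)" \<epsilon>] eps by (auto simp: Un_commute)
  then obtain \<pi> where pi: "\<And>E. E \<in> \<E> \<Longrightarrow> \<pi> E \<in> \<C> \<and> prob (sym_diff E (\<pi> E)) \<le> \<epsilon>" by metis
  have finC: "finite \<C>" using C(1) E(1) finite_subset by blast
  have "card (\<pi> ` \<E>) \<le> card \<C>" using pi by (intro card_mono finC) auto
  moreover have "real (card \<C>) \<le> 4 * exp (real p * (2 * b + 4 + 2 * ln (1 / \<epsilon>)))"
    using C E by (intro separated_family_card finC eps b growth_le_subset[OF gr]) auto
  ultimately show ?thesis using pi C(1) by (intro that[of \<pi>]) force+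
qed

(* S is the set of indices at which the sample (a) is swapped with the ghost sample (b). *)
lemma signed_sum_tail:
  fixes a b :: "'i \<Rightarrow> real"
  assumes I: "finite I" and ab: "\<And>i. i \<in> I \<Longrightarrow> a i \<in> {0, 1} \<and> b i \<in> {0, 1}" and T: "T \<ge> 0"
  shows "real (card {S \<in> Pow I. (\<Sum>i\<in>I. if i \<in> S then b i else a i) \<ge> T \<and>
      (\<Sum>i\<in>I. if i \<in> S then a i else b i) \<le> T / 4}) \<le> 2 ^ card I * exp (- T / 12)"
proof -
  let ?u = "\<lambda>S. \<Sum>i\<in>I. if i \<in> S then b i else a i"
  let ?v = "\<lambda>S. \<Sum>i\<in>I. if i \<in> S then a i else b i"
  let ?bad = "\<lambda>S. ?u S \<ge> T \<and> ?v S \<le> T / 4"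
  define B where "B = (\<Sum>i\<in>I. a i + b i)"
  have uv: "?u S + ?v S = B" for S
    unfolding B_def sum.distrib[symmetric] by (intro sum.cong) auto
  have v0: "?v S \<ge> 0" for S using ab by (intro sum_nonneg) (smt (verit) insertE singletonD)
  \<comment> \<open>On the bad event ?v \<le> ?u/4, hence ?u - ?v \<ge> 6/10 B. The value 3/10
    maximises 6/10 s - s^2, and the maximum 9/100 exceeds 1/12.\<close>
  define s :: real where "s = 3/10"
  show ?thesis
  proof (cases "B \<ge> T")
    case False
    have none: "\<not> ?bad S" for S using uv[of S] v0[of S] False by linarith
    have "{S \<in> Pow I. ?bad S} = {}" using none by blast
    then show ?thesis by (metis (no_types, lifting) card.empty exp_ge_zero mult_nonneg_nonneg of_nat_0 zero_le_numeral zero_le_power)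
  next
    case True
    have fin: "finite (Pow I)" using I by simp
    have "real (card {S \<in> Pow I. ?bad S}) = (\<Sum>S\<in>Pow I. if ?bad S then 1 else 0)"
      using fin by (simp add: sum.If_cases Int_def)
    also have "\<dots> \<le> (\<Sum>S\<in>Pow I. exp (- (6/10 * s * B)) * exp (s * (?u S - ?v S)))"
    proof (intro sum_mono)
      fix S
      have "6/10 * B \<le> ?u S - ?v S" if "?bad S" using that uv[of S] by linarith
      then have "0 \<le> - (6/10 * s * B) + s * (?u S - ?v S)" if "?bad S"
        using that by (simp add: s_def)
      then show "(if ?bad S then 1 else 0) \<le> exp (- (6/10 * s * B)) * exp (s * (?u S - ?v S))"
        by (simp only: exp_add[symmetric]) (auto simp del: exp_add)
    qed
    also have "\<dots> = exp (- (6/10 * s * B)) * (\<Sum>S\<in>Pow I. exp (s * (?u S - ?v S)))"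
      by (simp add: sum_distrib_left)
    \<comment> \<open>Every index is swapped or not regardless of the others, so the sum over all
      swap sets factors into two-term sums.\<close>
    also have "(\<Sum>S\<in>Pow I. exp (s * (?u S - ?v S)))
        = (\<Prod>i\<in>I. exp (s * (b i - a i)) + exp (s * (a i - b i)))"
    proof -
      have "exp (s * (?u S - ?v S)) = (\<Prod>i\<in>S. exp (s * (b i - a i))) * (\<Prod>i\<in>I - S. exp (s * (a i - b i)))"
        if "S \<in> Pow I" for S
      proof -
        have "exp (s * (?u S - ?v S)) = (\<Prod>i\<in>I. exp (s * (if i \<in> S then b i - a i else a i - b i)))"
          using I by (simp add: exp_sum[symmetric] sum_subtractf[symmetric] sum_distrib_left[symmetric])
            (intro disjI2 sum.cong, auto)
        also have "\<dots> = (\<Prod>i\<in>I - S. exp (s * (a i - b i))) * (\<Prod>i\<in>S. exp (s * (b i - a i)))"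
          using that I by (subst prod.subset_diff[of S I]) (auto intro!: arg_cong2[where f = times] prod.cong)
        finally show ?thesis by simp
      qed
      then show ?thesis by (subst prod_add[OF I]) (rule sum.cong[OF refl])
    qed
    also have "\<dots> \<le> (\<Prod>i\<in>I. 2 * exp (s\<^sup>2 * (a i + b i)))"
    proof (intro prod_mono conjI add_nonneg_nonneg exp_ge_zero)
      fix i assume i: "i \<in> I"
      define z where "z = s * (a i - b i)"
      have z: "\<bar>z\<bar> \<le> 1" "z\<^sup>2 \<le> s\<^sup>2 * (a i + b i)"
        using ab[OF i] by (auto simp: z_def s_def power2_eq_square)
      have "exp z + exp (- z) \<le> 2 * (1 + z\<^sup>2)"
        using exp_le_quadratic[of z] exp_le_quadratic[of "- z"] z(1) by (simp add: abs_le_iff)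
      also have "\<dots> \<le> 2 * (1 + s\<^sup>2 * (a i + b i))" using z(2) by simp
      also have "\<dots> \<le> 2 * exp (s\<^sup>2 * (a i + b i))" by (intro mult_left_mono exp_ge_add_one_self) auto
      finally show "exp (s * (b i - a i)) + exp (s * (a i - b i)) \<le> 2 * exp (s\<^sup>2 * (a i + b i))"
        by (simp add: z_def algebra_simps)
    qed
    also have "\<dots> = 2 ^ card I * exp (s\<^sup>2 * B)"
      using I by (simp add: prod.distrib exp_sum[symmetric] B_def sum_distrib_left)
    finally have "real (card {S \<in> Pow I. ?bad S}) \<le> exp (- (6/10 * s * B)) * (2 ^ card I * exp (s\<^sup>2 * B))"
      by simp
    also have "\<dots> = 2 ^ card I * exp (- (9/100) * B)"
      by (simp add: s_def power2_eq_square mult_exp_exp)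
    also have "\<dots> \<le> 2 ^ card I * exp (- T / 12)"
      using True T by (intro mult_left_mono) auto
    finally show ?thesis .
  qed
qed

text \<open>Markov's inequality: the expected count is at most n t/8, half of the level n t/4. The
  index set is free because the ghost sample occupies the indices from n to 2 n - 1.\<close>

lemma ghost_sample_half:
  assumes A: "A \<in> events" and J: "finite J" "card J = n" "n > 0" and t: "8 * prob A \<le> t" "t > 0"
  shows "measure (\<Pi>\<^sub>M i\<in>J. M) {D \<in> space (\<Pi>\<^sub>M i\<in>J. M). (\<Sum>i\<in>J. indicator A (D i)) \<le> real n * t / 4} \<ge> 1/2"
proof -
  let ?N = "\<Pi>\<^sub>M i\<in>J. M" and ?c = "\<lambda>D. \<Sum>i\<in>J. indicator A (D i) :: real"
  interpret N: prob_space ?N by (rule prob_space_sample)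
  note [measurable] = A
  have coord: "N.expectation (\<lambda>D. indicator A (D i)) = prob A" if "i \<in> J" for i
  proof -
    have "N.expectation (\<lambda>D. indicator A (D i) :: real) = integral\<^sup>L (distr ?N M (\<lambda>D. D i)) (indicator A)"
      using that by (subst integral_distr) auto
    also have "distr ?N M (\<lambda>D. D i) = M"
      using distr_PiM_component[of J "\<lambda>_. M" i] that prob_space_axioms by simp
    finally show ?thesis using A by simp
  qed
  have int: "integrable ?N (\<lambda>D. indicator A (D i) :: real)" if "i \<in> J" for i
    using that by (intro N.integrable_const_bound[of _ 1]) (auto simp: indicator_def)
  have "N.expectation ?c = real n * prob A" using coord int J by simp
  then have "measure ?N {D \<in> space ?N. ?c D \<ge> real n * t / 4} \<le> real n * prob A / (real n * t / 4)"
    using integral_Markov_inequality_measure[of ?N ?c "{}" "real n * t / 4"] int J t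
    by (auto intro!: sum_nonneg)
  also have "\<dots> \<le> 1/2" using t J by (simp add: field_simps)
  finally have *: "measure ?N {D \<in> space ?N. ?c D \<ge> real n * t / 4} \<le> 1/2" .
  have "1 = measure ?N (space ?N)" by (simp add: N.prob_space)
  also have "\<dots> \<le> measure ?N ({D \<in> space ?N. ?c D \<le> real n * t / 4} \<union> {D \<in> space ?N. ?c D \<ge> real n * t / 4})"
    by (intro N.finite_measure_mono) auto
  also have "\<dots> \<le> measure ?N {D \<in> space ?N. ?c D \<le> real n * t / 4} + measure ?N {D \<in> space ?N. ?c D \<ge> real n * t / 4}"
    by (intro measure_Un_le) auto
  finally show ?thesis using * by linarith
qed

text \<open>Transposes i and i + n for each i in S, exchanging sample and ghost points. It is an
  involution, which yields injectivity and hence invariance of the product measure.\<close>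

definition swap_index :: "nat \<Rightarrow> nat set \<Rightarrow> nat \<Rightarrow> nat" where
  "swap_index n S i = (if i < n then (if i \<in> S then i + n else i)
     else (if i - n \<in> S then i - n else i))"

lemma swap_index_inj: "S \<subseteq> {..<n} \<Longrightarrow> inj_on (swap_index n S) {..<2 * n}"
  by (intro inj_on_inverseI[of _ "swap_index n S"]) (auto simp: swap_index_def)

lemma swap_index_range: "S \<subseteq> {..<n} \<Longrightarrow> swap_index n S \<in> {..<2 * n} \<rightarrow> {..<2 * n}"
  by (auto simp: swap_index_def)

text \<open>Symmetrization in one-sided form. Once the 2 n points are fixed, the random swaps decide
  the event and only traces on these points matter, so the class enters through G alone. Comparing
  the frequencies t and t/4, instead of a frequency with its mean up to a small error, makes the
  exponent linear in t. The factor 2 undoes the 1/2 of \<open>ghost_sample_half\<close>.\<close>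

lemma uniform_small_sets:
  assumes fin: "finite \<A>" "\<A> \<subseteq> events" and n: "n > 0" and t: "t > 0" "\<And>A. A \<in> \<A> \<Longrightarrow> 8 * prob A \<le> t"
    and traces: "\<And>F. finite F \<Longrightarrow> F \<subseteq> space M \<Longrightarrow> card F \<le> 2 * n \<Longrightarrow> real (card ((\<lambda>A. A \<inter> F) ` \<A>)) \<le> G"
  shows "measure (\<Pi>\<^sub>M i\<in>{..<n}. M) {D \<in> space (\<Pi>\<^sub>M i\<in>{..<n}. M). \<exists>A\<in>\<A>. emp_mean n (indicator A) D \<ge> t}
    \<le> 2 * G * exp (- (real n * t / 12))"
proof -
  let ?I = "{..<n}" and ?J = "{n..<2*n}" and ?K = "{..<2*n}"
  let ?M = "\<lambda>_::nat. M"
  let ?T = "real n * t"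
  let ?c = "\<lambda>A D I. \<Sum>i\<in>I. indicator A (D i) :: real"
  let ?E = "{D \<in> space (PiM ?I ?M). \<exists>A\<in>\<A>. emp_mean n (indicator A) D \<ge> t}"
  let ?bad = "\<lambda>A D. ?c A D ?I \<ge> ?T \<and> ?c A D ?J \<le> ?T / 4"
  let ?B = "{D \<in> space (PiM ?K ?M). \<exists>A\<in>\<A>. ?bad A D}"
  interpret P: product_sigma_finite ?M ..
  interpret NI: prob_space "PiM ?I ?M" by (rule prob_space_sample)
  interpret NJ: prob_space "PiM ?J ?M" by (rule prob_space_sample)
  interpret NK: prob_space "PiM ?K ?M" by (rule prob_space_sample)
  have meas [measurable]: "A \<in> events" if "A \<in> \<A>" for A using that fin by auto
  have IJ: "?I \<inter> ?J = {}" "?I \<union> ?J = ?K" by auto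
  have cm: "(\<lambda>D. ?c A D I') \<in> borel_measurable (PiM L ?M)" if "A \<in> \<A>" "I' \<subseteq> L" for A I' L
    using that by (intro borel_measurable_sum measurable_compose[OF measurable_component_singleton]) auto
  have Bset: "?B \<in> sets (PiM ?K ?M)"
  proof -
    have "?B = (\<Union>A\<in>\<A>. {D \<in> space (PiM ?K ?M). ?bad A D})" by auto
    also have "\<dots> \<in> sets (PiM ?K ?M)"
    proof (intro sets.finite_UN fin)
      fix A assume "A \<in> \<A>"
      then have [measurable]: "(\<lambda>D. ?c A D ?I) \<in> borel_measurable (PiM ?K ?M)"
        "(\<lambda>D. ?c A D ?J) \<in> borel_measurable (PiM ?K ?M)" by (intro cm; auto)+
      show "{D \<in> space (PiM ?K ?M). ?bad A D} \<in> sets (PiM ?K ?M)" by measurable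
    qed
    finally show ?thesis .
  qed
  have Eset: "?E \<in> sets (PiM ?I ?M)"
  proof -
    have "?E = (\<Union>A\<in>\<A>. {D \<in> space (PiM ?I ?M). emp_mean n (indicator A) D \<ge> t})" by auto
    also have "\<dots> \<in> sets (PiM ?I ?M)"
      by (intro sets.finite_UN fin) measurable
    finally show ?thesis .
  qed
  have emp: "emp_mean n (indicator A) D \<ge> t \<longleftrightarrow> ?c A D ?I \<ge> ?T" for A D
    using n by (simp add: emp_mean_def field_simps)
  \<comment> \<open>If some A is overrepresented in the first half, the independent ghost half keeps
    the same A below n t/4 with probability at least 1/2.\<close>
  have half: "ennreal (1/2) * emeasure (PiM ?I ?M) ?E \<le> emeasure (PiM ?K ?M) ?B"
  proof -
    have "emeasure (PiM ?K ?M) ?B = (\<integral>\<^sup>+x. emeasure (PiM ?J ?M)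
        ((\<lambda>y. merge ?I ?J (x, y)) -` ?B \<inter> space (PiM ?J ?M)) \<partial>PiM ?I ?M)"
      using P.emeasure_fold_integral[of ?I ?J ?B] Bset IJ by simp
    also have "\<dots> \<ge> (\<integral>\<^sup>+x. ennreal (1/2) * indicator ?E x \<partial>PiM ?I ?M)"
    proof (intro nn_integral_mono)
      fix x assume x: "x \<in> space (PiM ?I ?M)"
      show "ennreal (1/2) * indicator ?E x \<le> emeasure (PiM ?J ?M)
        ((\<lambda>y. merge ?I ?J (x, y)) -` ?B \<inter> space (PiM ?J ?M))"
      proof (cases "x \<in> ?E")
        case True
        then obtain A where A: "A \<in> \<A>" "?c A x ?I \<ge> ?T" using emp by auto
        let ?C = "{y \<in> space (PiM ?J ?M). ?c A y ?J \<le> ?T / 4}"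
        let ?R = "(\<lambda>y. merge ?I ?J (x, y)) -` ?B \<inter> space (PiM ?J ?M)"
        have "?C \<subseteq> ?R"
        proof
          fix y assume "y \<in> ?C"
          then have y: "y \<in> space (PiM ?J ?M)" "?c A y ?J \<le> ?T / 4" by auto
          have "merge ?I ?J (x, y) \<in> space (PiM ?K ?M)"
            using x y IJ by (auto simp: space_PiM PiE_iff merge_def extensional_def)
          moreover have "?c A (merge ?I ?J (x, y)) ?I = ?c A x ?I"
            by (intro sum.cong) (auto simp: merge_def)
          moreover have "?c A (merge ?I ?J (x, y)) ?J = ?c A y ?J"
            by (intro sum.cong) (auto simp: merge_def)
          ultimately have "?bad A (merge ?I ?J (x, y))" using A y by simp
          then have "merge ?I ?J (x, y) \<in> ?B"
            using A \<open>merge ?I ?J (x, y) \<in> space (PiM ?K ?M)\<close> by blast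
          then show "y \<in> ?R" using y by simp
        qed
        moreover have "?R \<in> sets (PiM ?J ?M)"
        proof -
          have "(\<lambda>y. merge ?I ?J (x, y)) \<in> PiM ?J ?M \<rightarrow>\<^sub>M PiM ?K ?M"
            using x IJ measurable_compose[OF measurable_Pair1' measurable_merge[of ?I ?J ?M]] by auto
          then show ?thesis using Bset by (rule measurable_sets)
        qed
        ultimately have CR: "emeasure (PiM ?J ?M) ?C \<le> emeasure (PiM ?J ?M) ?R" by (rule emeasure_mono)
        have "measure (PiM ?J ?M) ?C \<ge> 1/2"
          using A t n by (intro ghost_sample_half) (auto intro: meas)
        then have "ennreal (1/2) \<le> emeasure (PiM ?J ?M) ?C"
          unfolding NJ.emeasure_eq_measure by (rule ennreal_leI)
        also note CR
        finally show ?thesis unfolding indicator_simps(1)[OF True] mult_1_right .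
      qed simp
    qed
    also have "(\<integral>\<^sup>+x. ennreal (1/2) * indicator ?E x \<partial>PiM ?I ?M) = ennreal (1/2) * emeasure (PiM ?I ?M) ?E"
      using Eset by (simp add: nn_integral_cmult_indicator)
    finally show ?thesis .
  qed
  define sw where "sw = (\<lambda>S (D :: nat \<Rightarrow> 'a). \<lambda>i\<in>?K. D (swap_index n S i))"
  have swm: "sw S \<in> PiM ?K ?M \<rightarrow>\<^sub>M PiM ?K ?M" if "S \<subseteq> ?I" for S
    unfolding sw_def using swap_index_range[OF that]
    by (intro measurable_restrict measurable_component_singleton) auto
  have swd: "distr (PiM ?K ?M) (PiM ?K ?M) (sw S) = PiM ?K ?M" if "S \<subseteq> ?I" for S
    unfolding sw_def
    using distr_PiM_reindex[of ?K ?M "swap_index n S" ?K] swap_index_range[OF that] swap_index_inj[OF that]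
    by (simp add: prob_space_axioms)
  have inv: "NK.prob ?B = NK.expectation (\<lambda>D. indicator ?B (sw S D))" if "S \<subseteq> ?I" for S
  proof -
    have "NK.prob ?B = integral\<^sup>L (distr (PiM ?K ?M) (PiM ?K ?M) (sw S)) (indicator ?B)"
      using Bset by (simp add: swd[OF that])
    also have "\<dots> = NK.expectation (\<lambda>D. indicator ?B (sw S D))"
      using Bset by (intro integral_distr swm[OF that]) auto
    finally show ?thesis .
  qed
  have point: "(\<Sum>S\<in>Pow ?I. indicator ?B (sw S D)) \<le> 2 ^ n * (G * exp (- ?T / 12))"
    if D: "D \<in> space (PiM ?K ?M)" for D
  proof -
    define F where "F = D ` ?K"
    have F: "finite F" "F \<subseteq> space M" "card F \<le> 2 * n"
      using D card_image_le[of ?K D] by (auto simp: F_def space_PiM)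
    \<comment> \<open>One representative per trace. Swapped samples stay inside F, so a set and its
      representative have equal counts on both halves for every S.\<close>
    obtain R where R: "R \<subseteq> \<A>" "inj_on (\<lambda>A. A \<inter> F) R" "(\<lambda>A. A \<inter> F) ` \<A> = (\<lambda>A. A \<inter> F) ` R"
      using subset_image_inj[of "(\<lambda>A. A \<inter> F) ` \<A>" "\<lambda>A. A \<inter> F" \<A>] by auto
    have finR: "finite R" by (rule finite_subset[OF R(1) fin(1)])
    have cR: "real (card R) \<le> G"
      using traces[OF F] R by (simp add: card_image)
    have swval: "sw S D i = (if i < n then (if i \<in> S then D (i + n) else D i)
        else (if i - n \<in> S then D (i - n) else D i))" if "i < 2 * n" for S i
      using that by (auto simp: sw_def swap_index_def)
    have inF: "sw S D i \<in> F" if "i < 2 * n" "S \<subseteq> ?I" for S i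
      using swval[OF that(1), of S] that by (auto simp: F_def)
    have cI: "?c A (sw S D) ?I = (\<Sum>i\<in>?I. if i \<in> S then indicator A (D (i + n)) else indicator A (D i))" for A S
      by (intro sum.cong) (auto simp: swval)
    have cJ: "?c A (sw S D) ?J = (\<Sum>i\<in>?I. if i \<in> S then indicator A (D i) else indicator A (D (i + n)))" for A S
    proof -
      have "?c A (sw S D) ?J = (\<Sum>i\<in>?I. indicator A (sw S D (i + n)))"
        by (rule sum.reindex_bij_witness[of _ "\<lambda>i. i + n" "\<lambda>i. i - n"]) auto
      also have "\<dots> = (\<Sum>i\<in>?I. if i \<in> S then indicator A (D i) else indicator A (D (i + n)))"
        by (intro sum.cong) (auto simp: swval)
      finally show ?thesis .
    qed
    have le: "indicator ?B (sw S D) \<le> (\<Sum>A\<in>R. if ?bad A (sw S D) then 1 else 0 :: real)" if S: "S \<subseteq> ?I" for S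
    proof (cases "sw S D \<in> ?B")
      case True
      then obtain A where A: "A \<in> \<A>" "?bad A (sw S D)" by auto
      then obtain A' where A': "A' \<in> R" "A' \<inter> F = A \<inter> F" using R(3) by (metis (no_types, lifting) imageE image_eqI)
      have ind: "indicator A (sw S D i) = (indicator A' (sw S D i) :: real)" if "i < 2 * n" for i
        using inF[OF that S] A'(2) by (auto simp: indicator_def)
      have "?c A (sw S D) ?I = ?c A' (sw S D) ?I" "?c A (sw S D) ?J = ?c A' (sw S D) ?J"
        by (auto intro!: sum.cong simp: ind)
      then have "?bad A' (sw S D)" using A by simp
      then have "1 \<le> (\<Sum>A\<in>R. if ?bad A (sw S D) then 1 else 0 :: real)"
        using member_le_sum[of A' R "\<lambda>A. if ?bad A (sw S D) then 1 else 0 :: real"] A'(1) finR by auto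
      then show ?thesis using True by simp
    qed (auto intro: sum_nonneg)
    have "(\<Sum>S\<in>Pow ?I. indicator ?B (sw S D)) \<le> (\<Sum>S\<in>Pow ?I. \<Sum>A\<in>R. if ?bad A (sw S D) then 1 else 0 :: real)"
      by (intro sum_mono le) auto
    also have "\<dots> = (\<Sum>A\<in>R. \<Sum>S\<in>Pow ?I. if ?bad A (sw S D) then 1 else 0)" by (rule sum.swap)
    also have "\<dots> \<le> (\<Sum>A\<in>R. 2 ^ n * exp (- ?T / 12))"
    proof (intro sum_mono)
      fix A
      have "(\<Sum>S\<in>Pow ?I. if ?bad A (sw S D) then 1 else 0) = real (card {S \<in> Pow ?I. ?bad A (sw S D)})"
        by (simp add: sum.If_cases Int_def)
      also have "\<dots> \<le> 2 ^ card ?I * exp (- ?T / 12)"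
        unfolding cI cJ using t n by (intro signed_sum_tail) (auto simp: indicator_def)
      finally show "(\<Sum>S\<in>Pow ?I. if ?bad A (sw S D) then 1 else 0) \<le> 2 ^ n * exp (- ?T / 12)" by simp
    qed
    also have "\<dots> = real (card R) * (2 ^ n * exp (- ?T / 12))" by simp
    also have "\<dots> \<le> G * (2 ^ n * exp (- ?T / 12))" using cR by (intro mult_right_mono) auto
    finally show ?thesis by (simp add: algebra_simps)
  qed
  have intS: "integrable (PiM ?K ?M) (\<lambda>D. indicator ?B (sw S D) :: real)" if "S \<subseteq> ?I" for S
    using measurable_compose[OF swm[OF that] borel_measurable_indicator[OF Bset]]
    by (intro NK.integrable_const_bound[of _ 1]) (auto simp: indicator_def)
  have "2 ^ n * NK.prob ?B = (\<Sum>S\<in>Pow ?I. NK.prob ?B)" by (simp add: card_Pow)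
  also have "\<dots> = (\<Sum>S\<in>Pow ?I. NK.expectation (\<lambda>D. indicator ?B (sw S D)))"
    by (intro sum.cong inv) auto
  also have "\<dots> = NK.expectation (\<lambda>D. \<Sum>S\<in>Pow ?I. indicator ?B (sw S D))"
    by (intro Bochner_Integration.integral_sum[symmetric] intS) auto
  also have "\<dots> \<le> NK.expectation (\<lambda>D. 2 ^ n * (G * exp (- ?T / 12)))"
    by (intro integral_mono Bochner_Integration.integrable_sum intS point) auto
  also have "\<dots> = 2 ^ n * (G * exp (- ?T / 12))" by (simp add: NK.prob_space)
  finally have "NK.prob ?B \<le> G * exp (- ?T / 12)" by simp
  moreover have "1/2 * NI.prob ?E \<le> NK.prob ?B"
    using half by (simp add: NI.emeasure_eq_measure NK.emeasure_eq_measure ennreal_mult[symmetric] del: ennreal_half)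
  ultimately show ?thesis by simp
qed

end

section \<open>Uniform deviations\<close>

context prob_space
begin

text \<open>Phrased through an exceptional set, so that measurability is asked of that set and not
  of the predicate; conjunctions and union bounds then amount to unions of exceptional sets.\<close>

definition holds_upto :: "nat \<Rightarrow> real \<Rightarrow> ((nat \<Rightarrow> 'a) \<Rightarrow> bool) \<Rightarrow> bool" where
  "holds_upto n x P \<longleftrightarrow> (\<exists>Bad\<in>sets (\<Pi>\<^sub>M i\<in>{..<n}. M). measure (\<Pi>\<^sub>M i\<in>{..<n}. M) Bad \<le> x \<and>
     (\<forall>D\<in>space (\<Pi>\<^sub>M i\<in>{..<n}. M) - Bad. P D))"

lemma holds_upto_mono:
  assumes "holds_upto n x P" "x \<le> y" "\<And>D. P D \<Longrightarrow> Q D"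
  shows "holds_upto n y Q"
  using assms unfolding holds_upto_def by (meson order_trans)

lemma holds_upto_conj:
  assumes "holds_upto n x P" "holds_upto n y Q"
  shows "holds_upto n (x + y) (\<lambda>D. P D \<and> Q D)"
proof -
  let ?N = "\<Pi>\<^sub>M i\<in>{..<n}. M"
  obtain A B where "A \<in> sets ?N" "measure ?N A \<le> x" "\<forall>D\<in>space ?N - A. P D"
    "B \<in> sets ?N" "measure ?N B \<le> y" "\<forall>D\<in>space ?N - B. Q D"
    using assms unfolding holds_upto_def by blast
  moreover from this have "measure ?N (A \<union> B) \<le> x + y"
    using measure_Un_le[of A ?N B] by linarith
  ultimately show ?thesis unfolding holds_upto_def by (intro bexI[of _ "A \<union> B"]) auto
qed

lemma holds_upto_ball:
  assumes "finite I" "\<And>i. i \<in> I \<Longrightarrow> holds_upto n (x i) (P i)"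
  shows "holds_upto n (\<Sum>i\<in>I. x i) (\<lambda>D. \<forall>i\<in>I. P i D)"
  using assms
proof (induction rule: finite_induct)
  case empty
  show ?case by (auto simp: holds_upto_def intro!: bexI[of _ "{}"])
next
  case (insert i I)
  then have "holds_upto n (x i + (\<Sum>i\<in>I. x i)) (\<lambda>D. P i D \<and> (\<forall>i\<in>I. P i D))"
    by (intro holds_upto_conj) auto
  then show ?case using insert by (auto intro: holds_upto_mono)
qed

definition dev :: "nat \<Rightarrow> 'a set \<Rightarrow> (nat \<Rightarrow> 'a) \<Rightarrow> real" where
  "dev n A D = emp_mean n (indicator A) D - prob A"

lemma emp_mean_indicator_bounds: "0 \<le> emp_mean n (indicator A) D" "emp_mean n (indicator A) D \<le> 1"
proof -
  show "0 \<le> emp_mean n (indicator A) D" by (auto simp: emp_mean_def intro!: divide_nonneg_nonneg sum_nonneg)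
  have "(\<Sum>i<n. indicator A (D i)) \<le> (\<Sum>i<n. 1 :: real)" by (intro sum_mono) (auto simp: indicator_def)
  then show "emp_mean n (indicator A) D \<le> 1" by (cases "n = 0") (auto simp: emp_mean_def)
qed

lemma dev_diff_le_2: "\<bar>dev n A D - dev n B D\<bar> \<le> 2"
  using emp_mean_indicator_bounds[of n A D] emp_mean_indicator_bounds[of n B D] prob_le_1[of A] prob_le_1[of B]
    measure_nonneg[of M A] measure_nonneg[of M B]
  unfolding dev_def by linarith

lemma prob_diff_le_sym_diff:
  assumes "A \<in> events" "B \<in> events"
  shows "\<bar>prob A - prob B\<bar> \<le> prob (sym_diff A B)"
proof -
  have "prob A \<le> prob (B \<union> sym_diff A B)" "prob B \<le> prob (A \<union> sym_diff A B)"
    using assms by (auto intro!: finite_measure_mono)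
  moreover have "prob (B \<union> sym_diff A B) \<le> prob B + prob (sym_diff A B)"
    "prob (A \<union> sym_diff A B) \<le> prob A + prob (sym_diff A B)"
    using assms by (auto intro!: measure_Un_le)
  ultimately show ?thesis by linarith
qed

lemma dev_diff_le_sym_diff:
  assumes "A \<in> events" "B \<in> events"
  shows "\<bar>dev n A D - dev n B D\<bar> \<le> emp_mean n (indicator (sym_diff A B)) D + prob (sym_diff A B)"
proof -
  have "\<bar>emp_mean n (indicator A) D - emp_mean n (indicator B) D\<bar>
      = \<bar>\<Sum>i<n. indicator A (D i) - indicator B (D i)\<bar> / real n"
    by (simp add: emp_mean_def sum_subtractf diff_divide_distrib[symmetric])
  also have "\<dots> \<le> (\<Sum>i<n. \<bar>indicator A (D i) - indicator B (D i)\<bar>) / real n"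
    by (intro divide_right_mono sum_abs) auto
  also have "\<dots> = emp_mean n (indicator (sym_diff A B)) D"
    unfolding emp_mean_def by (intro arg_cong2[where f = "(/)"] sum.cong) (auto simp: indicator_def)
  finally show ?thesis using prob_diff_le_sym_diff[OF assms] unfolding dev_def by linarith
qed

text \<open>The increment over a pair is the centred mean of a difference of two indicators, whose
  square is the indicator of the symmetric difference. The bound v may vary with the pair; this is
  how a variance controlled by the excess risk is fed in.\<close>

lemma bernstein_pairs:
  assumes Q: "finite Q" "\<And>A B. (A, B) \<in> Q \<Longrightarrow> A \<in> events \<and> B \<in> events \<and> prob (sym_diff A B) \<le> v A B"
    and s: "0 < s" "s \<le> 1/2" and n: "n > 0"
  shows "holds_upto n (real (card Q) * (2 * exp (- L)))
    (\<lambda>D. \<forall>(A, B)\<in>Q. \<bar>dev n A D - dev n B D\<bar> \<le> s * v A B + L / (real n * s))"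
proof -
  let ?N = "\<Pi>\<^sub>M i\<in>{..<n}. M"
  have one: "holds_upto n (2 * exp (- L)) (\<lambda>D. \<bar>dev n A D - dev n B D\<bar> \<le> s * v A B + L / (real n * s))"
    if AB: "(A, B) \<in> Q" for A B
  proof -
    have ev [measurable]: "A \<in> events" "B \<in> events" and v: "prob (sym_diff A B) \<le> v A B" using Q(2)[OF AB] by auto
    define f :: "'a \<Rightarrow> real" where "f = (\<lambda>x. indicator A x - indicator B x)"
    have [measurable]: "f \<in> borel_measurable M" unfolding f_def by measurable
    have "expectation (\<lambda>x. (f x)\<^sup>2) = expectation (indicator (sym_diff A B))"
      by (intro Bochner_Integration.integral_cong) (auto simp: f_def indicator_def)
    then have v': "expectation (\<lambda>x. (f x)\<^sup>2) \<le> v A B" using v by simp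
    have "integrable M (indicator A :: 'a \<Rightarrow> real)" "integrable M (indicator B :: 'a \<Rightarrow> real)"
      by (auto simp: integrable_indicator_iff emeasure_eq_measure)
    then have "expectation f = expectation (indicator A) - expectation (indicator B)"
      unfolding f_def by (rule Bochner_Integration.integral_diff)
    then have Ef: "expectation f = prob A - prob B" by simp
    have dev: "dev n A D - dev n B D = emp_mean n f D - expectation f" for D
    proof -
      have "emp_mean n f D = emp_mean n (indicator A) D - emp_mean n (indicator B) D"
        by (simp add: emp_mean_def f_def sum_subtractf diff_divide_distrib)
      then show ?thesis by (simp add: Ef dev_def)
    qed
    let ?Bad = "{D \<in> space ?N. \<bar>emp_mean n f D - expectation f\<bar> \<ge> s * v A B + L / (real n * s)}"
    have "measure ?N ?Bad \<le> 2 * exp (- L)"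
      by (rule bernstein[OF _ _ v' s n]) (auto simp: f_def indicator_def)
    moreover have "?Bad \<in> sets ?N" by measurable
    ultimately show ?thesis unfolding holds_upto_def dev by (intro bexI[of _ ?Bad]) auto
  qed
  have "holds_upto n (\<Sum>AB\<in>Q. 2 * exp (- L))
     (\<lambda>D. \<forall>AB\<in>Q. case AB of (A, B) \<Rightarrow> \<bar>dev n A D - dev n B D\<bar> \<le> s * v A B + L / (real n * s))"
    by (rule holds_upto_ball) (use Q(1) one in auto)
  then show ?thesis by (rule holds_upto_mono) auto
qed

(* Below the finest net no union bound over the class is available: only its traces are counted. *)
lemma finest_scale:
  assumes E: "finite \<E>" "\<E> \<subseteq> events" and gr: "growth_le \<E> b p" and n: "n > 0"
    and pi: "\<And>E. E \<in> \<E> \<Longrightarrow> \<pi> E \<in> \<E>" "\<And>E. E \<in> \<E> \<Longrightarrow> prob (sym_diff E (\<pi> E)) \<le> \<epsilon>"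
    and t: "t > 0" "8 * \<epsilon> \<le> t"
  shows "holds_upto n (2 * (growth_bound b p (2 * n))\<^sup>2 * exp (- (real n * t / 12)))
    (\<lambda>D. \<forall>E\<in>\<E>. \<bar>dev n E D - dev n (\<pi> E) D\<bar> \<le> t + \<epsilon>)"
proof -
  let ?N = "\<Pi>\<^sub>M i\<in>{..<n}. M"
  let ?A = "(\<lambda>E. sym_diff E (\<pi> E)) ` \<E>"
  let ?Bad = "{D \<in> space ?N. \<exists>A\<in>?A. emp_mean n (indicator A) D \<ge> t}"
  have ev: "?A \<subseteq> events" using E pi by auto
  have traces: "real (card ((\<lambda>A. A \<inter> F) ` ?A)) \<le> (growth_bound b p (2 * n))\<^sup>2"
    if F: "finite F" "F \<subseteq> space M" "card F \<le> 2 * n" for F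
  proof -
    let ?T = "(\<lambda>E. E \<inter> F) ` \<E>"
    \<comment> \<open>Symmetric difference commutes with intersection by F, so each trace comes from
      a pair of traces of the class; hence the square.\<close>
    have "(\<lambda>A. A \<inter> F) ` ?A \<subseteq> (\<lambda>(A, B). sym_diff A B) ` (?T \<times> ?T)"
    proof safe
      fix E assume "E \<in> \<E>"
      then have "sym_diff E (\<pi> E) \<inter> F = (\<lambda>(A, B). sym_diff A B) (E \<inter> F, \<pi> E \<inter> F)"
        "(E \<inter> F, \<pi> E \<inter> F) \<in> ?T \<times> ?T" using pi by auto
      then show "sym_diff E (\<pi> E) \<inter> F \<in> (\<lambda>(A, B). sym_diff A B) ` (?T \<times> ?T)" by (rule image_eqI)
    qed
    then have "card ((\<lambda>A. A \<inter> F) ` ?A) \<le> card ((\<lambda>(A, B). sym_diff A B) ` (?T \<times> ?T))"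
      using E by (intro card_mono) auto
    also have "\<dots> \<le> card (?T \<times> ?T)" using E by (intro card_image_le) auto
    finally have "real (card ((\<lambda>A. A \<inter> F) ` ?A)) \<le> (real (card ?T))\<^sup>2"
      by (simp add: card_cartesian_product power2_eq_square flip: of_nat_mult)
    also have "real (card ?T) \<le> growth_bound b p (card F)" using gr F by (auto simp: growth_le_def)
    then have "(real (card ?T))\<^sup>2 \<le> (growth_bound b p (2 * n))\<^sup>2"
      using growth_bound_mono[OF F(3), of b p] by (intro power_mono) auto
    finally show ?thesis .
  qed
  have "measure ?N ?Bad \<le> 2 * (growth_bound b p (2 * n))\<^sup>2 * exp (- (real n * t / 12))"
    by (rule uniform_small_sets) (use E ev n t pi traces in \<open>force+\<close>)
  moreover have "?Bad \<in> sets ?N"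
  proof -
    have "?Bad = (\<Union>A\<in>?A. {D \<in> space ?N. emp_mean n (indicator A) D \<ge> t})" by auto
    also have "\<dots> \<in> sets ?N"
    proof (intro sets.finite_UN)
      fix A assume "A \<in> ?A"
      then have [measurable]: "A \<in> events" using ev by blast
      show "{D \<in> space ?N. emp_mean n (indicator A) D \<ge> t} \<in> sets ?N" by measurable
    qed (use E in simp)
    finally show ?thesis .
  qed
  moreover have "\<bar>dev n E D - dev n (\<pi> E) D\<bar> \<le> t + \<epsilon>" if "D \<in> space ?N - ?Bad" "E \<in> \<E>" for D E
  proof -
    have "emp_mean n (indicator (sym_diff E (\<pi> E))) D < t"
    proof (rule ccontr)
      assume "\<not> ?thesis"
      then have "D \<in> ?Bad" using that by (auto simp: not_less)
      then show False using that by blast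
    qed
    moreover have "\<bar>dev n E D - dev n (\<pi> E) D\<bar>
        \<le> emp_mean n (indicator (sym_diff E (\<pi> E))) D + prob (sym_diff E (\<pi> E))"
      using that E pi by (intro dev_diff_le_sym_diff) auto
    ultimately show ?thesis using pi(2)[OF that(2)] by linarith
  qed
  ultimately show ?thesis unfolding holds_upto_def by (intro bexI[of _ ?Bad]) auto
qed

lemma exp_numeral_ge: "exp (real k) \<ge> (2::real) ^ k"
proof -
  have "(2::real) \<le> exp 1" using exp_ge_add_one_self[of 1] by simp
  then have "(2::real) ^ k \<le> exp 1 ^ k" by (rule power_mono) simp
  then show ?thesis by (simp add: exp_of_nat_mult[symmetric])
qed

(* Bernstein's inequality in the form s * v + L / (n * s) is applied with s = h / 4, so that the margin
   bound on v turns it into a quarter of the excess risk plus h * q + w / h. *)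
lemma localized_deviation:
  fixes n p :: nat and \<tau> b B \<kappa> :: real
  defines "W \<equiv> real p * (2 * b + 4 + 2 * ln (1 + 2 * real n / real p))"
  defines "u \<equiv> 8 * (W + \<tau>) / real n"
  assumes E: "finite \<E>" "\<E> \<subseteq> events" and gr: "growth_le \<E> b p" and b: "b \<ge> 1" and n: "n > 0"
    and E0: "E0 \<in> events" and \<tau>: "1 \<le> \<tau>" "\<tau> \<le> real n" and p: "p \<le> n"
    and exc: "\<And>E. E \<in> \<E> \<Longrightarrow> prob E0 \<le> prob E"
    and \<kappa>: "0 \<le> \<kappa>" "\<kappa> \<le> 1" and B: "B \<ge> 0"
    and margin: "\<And>w. 0 < w \<Longrightarrow> w \<le> 1 \<Longrightarrow> \<exists>h q. 0 < h \<and> h \<le> 1 \<and> 0 \<le> q \<and> h * q + w / h \<le> B * w powr \<kappa> \<and>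
      (\<forall>E\<in>\<E>. prob (sym_diff E E0) \<le> q + (prob E - prob E0) / h)"
  shows "holds_upto n (exp (- (real p + \<tau>)))
    (\<lambda>D. \<forall>E\<in>\<E>. \<bar>dev n E D - dev n E0 D\<bar> \<le> (prob E - prob E0) / 2 + (4 * B + 13) * u powr \<kappa>)"
proof -
  have lnn: "ln (1 + 2 * real n / real p) \<ge> 0" by simp
  have W: "6 * real p \<le> W"
  proof -
    have "6 \<le> 2 * b + 4 + 2 * ln (1 + 2 * real n / real p)" using b lnn by linarith
    then show ?thesis unfolding W_def by (subst mult.commute, intro mult_left_mono) auto
  qed
  have W0: "W \<ge> 0" using W by (meson of_nat_0_le_iff mult_nonneg_nonneg order_trans zero_le_numeral)
  have u0: "u > 0" unfolding u_def using W0 \<tau> n by simp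
  show ?thesis
  proof (cases "u \<le> 1")
    \<comment> \<open>Two deviations never differ by more than 2, which the last term exceeds as
      soon as u > 1.\<close>
    case False
    then have "1 \<le> u powr \<kappa>" using \<kappa> by (simp add: ge_one_powr_ge_zero)
    then have big: "2 \<le> (4 * B + 13) * u powr \<kappa>"
      using B mult_mono[of 2 "4 * B + 13" 1 "u powr \<kappa>"] by simp
    have "\<bar>dev n E D - dev n E0 D\<bar> \<le> (prob E - prob E0) / 2 + (4 * B + 13) * u powr \<kappa>" if "E \<in> \<E>" for E D
    proof -
      have "0 \<le> (prob E - prob E0) / 2" using exc[OF that] by simp
      then show ?thesis using dev_diff_le_2[of n E D E0] big by linarith
    qed
    then show ?thesis unfolding holds_upto_def by (intro bexI[of _ "{}"]) auto
  next
    case True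
    \<comment> \<open>Coarse enough that p ln (1/\<epsilon>) is covered by the entropy W, fine
      enough that \<epsilon> is at most of the order of u.\<close>
    define \<epsilon> where "\<epsilon> = (real p + \<tau>) / (2 * real n)"
    have eps: "0 < \<epsilon>" "\<epsilon> \<le> 1" using \<tau> n p by (auto simp: \<epsilon>_def)
    obtain \<pi> where pi: "\<And>E. E \<in> \<E> \<Longrightarrow> \<pi> E \<in> \<E>" "\<And>E. E \<in> \<E> \<Longrightarrow> prob (sym_diff E (\<pi> E)) \<le> \<epsilon>"
      "real (card (\<pi> ` \<E>)) \<le> 4 * exp (real p * (2 * b + 4 + 2 * ln (1 / \<epsilon>)))"
      using covering_map[OF E gr b eps] by blast
    have "real p * ln (1 / \<epsilon>) \<le> real p * ln (1 + 2 * real n / real p)"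
    proof (cases "p = 0")
      case False
      have "1 / \<epsilon> = 2 * real n / (real p + \<tau>)" by (simp add: \<epsilon>_def)
      also have "\<dots> \<le> 2 * real n / real p" using False \<tau> by (intro divide_left_mono) auto
      finally have "1 / \<epsilon> \<le> 1 + 2 * real n / real p" by simp
      then show ?thesis using eps by (intro mult_left_mono ln_mono) auto
    qed simp
    then have "real p * (2 * b + 4 + 2 * ln (1 / \<epsilon>)) \<le> W" unfolding W_def by (simp add: algebra_simps)
    then have card: "real (card (\<pi> ` \<E>)) \<le> 4 * exp W" using pi(3) by (meson exp_le_cancel_iff mult_left_mono order_trans zero_le_numeral)
    obtain h q where h: "0 < h" "h \<le> 1" "0 \<le> q" "h * q + u / h \<le> B * u powr \<kappa>"
      and mar: "\<And>E. E \<in> \<E> \<Longrightarrow> prob (sym_diff E E0) \<le> q + (prob E - prob E0) / h"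
      using margin[OF u0 True] by blast
    let ?Q = "(\<lambda>E. (\<pi> E, E0)) ` \<E>"
    \<comment> \<open>L = 8 (W + \<tau>): one W pays for the net, and the rest exceeds p + \<tau> +
      7 because 6 p \<le> W and \<tau> \<ge> 1. The 100 in t does the same after division by 12. The
      prefactors 8 and 32 add up to 40, less than 128 \<le> exp 7.\<close>
    define L where "L = real n * u"
    have L: "L = 8 * (W + \<tau>)" using n by (simp add: L_def u_def)
    let ?v = "\<lambda>A B. q + (prob A - prob E0) / h"
    have net: "holds_upto n (real (card ?Q) * (2 * exp (- L)))
      (\<lambda>D. \<forall>(A, B)\<in>?Q. \<bar>dev n A D - dev n B D\<bar> \<le> h / 4 * ?v A B + L / (real n * (h / 4)))"
      using E E0 pi mar h n by (intro bernstein_pairs) auto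
    have cQ: "real (card ?Q) \<le> 4 * exp W"
    proof -
      have "?Q = (\<lambda>A. (A, E0)) ` (\<pi> ` \<E>)" by auto
      then have "card ?Q \<le> card (\<pi> ` \<E>)" using E by (metis card_image_le finite_imageI)
      then show ?thesis using card by linarith
    qed
    define t where "t = 100 * (W + \<tau>) / real n"
    have "8 * \<epsilon> = 4 * (real p + \<tau>) / real n" using n by (simp add: \<epsilon>_def field_simps)
    also have "\<dots> \<le> t" unfolding t_def using W \<tau> by (intro divide_right_mono) auto
    finally have t8: "8 * \<epsilon> \<le> t" .
    have t0: "t > 0" unfolding t_def using W0 \<tau> n by simp
    have fine: "holds_upto n (2 * (growth_bound b p (2 * n))\<^sup>2 * exp (- (real n * t / 12)))
      (\<lambda>D. \<forall>E\<in>\<E>. \<bar>dev n E D - dev n (\<pi> E) D\<bar> \<le> t + \<epsilon>)"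
      by (rule finest_scale[OF E gr n pi(1,2) t0 t8])
    have e7: "exp (7::real) \<ge> 128" using exp_numeral_ge[of 7] by simp
    have fail1: "real (card ?Q) * (2 * exp (- L)) \<le> 8 * exp (- 7 - (real p + \<tau>))"
    proof -
      have "real (card ?Q) * (2 * exp (- L)) \<le> (4 * exp W) * (2 * exp (- L))"
        by (intro mult_right_mono cQ) auto
      also have "\<dots> = 8 * exp (W - L)" by (simp add: mult_exp_exp)
      also have "\<dots> \<le> 8 * exp (- 7 - (real p + \<tau>))"
      proof -
        have "real p \<ge> 0" by simp
        then have "W - L \<le> - 7 - (real p + \<tau>)" using L W \<tau>(1) W0 by argo
        then show ?thesis by simp
      qed
      finally show ?thesis .
    qed
    have fail2: "2 * (growth_bound b p (2 * n))\<^sup>2 * exp (- (real n * t / 12)) \<le> 32 * exp (- 7 - (real p + \<tau>))"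
    proof -
      have "2 * (real p * (b + ln (1 + real (2 * n) / real p))) \<le> W"
        unfolding W_def by (simp add: algebra_simps)
      then have g2: "(growth_bound b p (2 * n))\<^sup>2 \<le> 16 * exp W"
        by (simp add: growth_bound_def power_mult_distrib exp_double[symmetric])
      have nt: "real n * t / 12 = 100 / 12 * (W + \<tau>)" using n by (simp add: t_def)
      have "2 * (growth_bound b p (2 * n))\<^sup>2 * exp (- (real n * t / 12))
          \<le> 2 * (16 * exp W) * exp (- (real n * t / 12))"
        by (intro mult_right_mono mult_left_mono g2) auto
      also have "\<dots> = 32 * exp (W - real n * t / 12)" by (simp add: mult_exp_exp)
      also have "\<dots> \<le> 32 * exp (- 7 - (real p + \<tau>))"
      proof -
        have "real p \<ge> 0" by simp
        then have "W - real n * t / 12 \<le> - 7 - (real p + \<tau>)" unfolding nt using W \<tau>(1) W0 by argo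
        then show ?thesis by simp
      qed
      finally show ?thesis .
    qed
    have fail: "real (card ?Q) * (2 * exp (- L)) + 2 * (growth_bound b p (2 * n))\<^sup>2 * exp (- (real n * t / 12))
      \<le> exp (- (real p + \<tau>))"
    proof -
      have "40 * exp (- 7 - (real p + \<tau>)) = (40 / exp 7) * exp (- (real p + \<tau>))"
        by (simp add: exp_diff exp_minus exp_add field_simps)
      also have "\<dots> \<le> 1 * exp (- (real p + \<tau>))" using e7 by (intro mult_right_mono) (auto simp: field_simps)
      finally show ?thesis using fail1 fail2 by linarith
    qed
    show ?thesis
    proof (rule holds_upto_mono[OF holds_upto_conj[OF net fine] fail], intro ballI)
      fix D E
      assume *: "(\<forall>(A, B)\<in>?Q. \<bar>dev n A D - dev n B D\<bar> \<le> h / 4 * ?v A B + L / (real n * (h / 4))) \<and>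
        (\<forall>E\<in>\<E>. \<bar>dev n E D - dev n (\<pi> E) D\<bar> \<le> t + \<epsilon>)" and EE: "E \<in> \<E>"
      have d1: "\<bar>dev n (\<pi> E) D - dev n E0 D\<bar> \<le> h / 4 * ?v (\<pi> E) E0 + L / (real n * (h / 4))"
        using * EE by blast
      have d2: "\<bar>dev n E D - dev n (\<pi> E) D\<bar> \<le> t + \<epsilon>" using * EE by blast
      have eq: "h / 4 * ?v (\<pi> E) E0 + L / (real n * (h / 4)) = h * q / 4 + (prob (\<pi> E) - prob E0) / 4 + 4 * (u / h)"
        using h n by (simp add: L_def field_simps)
      have hq: "h * q / 4 + 4 * (u / h) \<le> 4 * (B * u powr \<kappa>)"
      proof -
        have "0 \<le> h * q" "0 \<le> u / h" using h u0 by auto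
        then show ?thesis using h(4) by linarith
      qed
      have pe: "prob (\<pi> E) \<le> prob E + \<epsilon>"
        using prob_diff_le_sym_diff[of E "\<pi> E"] pi(1,2)[OF EE] E EE by force
      have "u \<le> u powr \<kappa>"
        using powr_mono'[of \<kappa> 1 u] u0 True \<kappa> by simp
      \<comment> \<open>In units of (W + \<tau>)/n, t is 100 and u is 8, so 13 u leaves 4 units for
        5/4 \<epsilon>; the additional quarter of \<epsilon> stems from replacing the excess risk of
        \<pi> E by that of E.\<close>
      moreover have "t + 5/4 * \<epsilon> \<le> 13 * u"
      proof -
        have "\<epsilon> \<le> (W + \<tau>) / real n"
        proof -
          have "\<epsilon> = ((real p + \<tau>) / 2) / real n" by (simp add: \<epsilon>_def)
          also have "\<dots> \<le> (W + \<tau>) / real n" using W \<tau> by (intro divide_right_mono) auto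
          finally show ?thesis .
        qed
        moreover have "13 * u = 104 * ((W + \<tau>) / real n)" "t = 100 * ((W + \<tau>) / real n)"
          by (auto simp: u_def t_def)
        ultimately show ?thesis using eps by linarith
      qed
      ultimately have "t + 5/4 * \<epsilon> \<le> 13 * u powr \<kappa>" by linarith
      moreover have "(4 * B + 13) * u powr \<kappa> = 4 * (B * u powr \<kappa>) + 13 * u powr \<kappa>"
        by (simp add: algebra_simps)
      ultimately show "\<bar>dev n E D - dev n E0 D\<bar> \<le> (prob E - prob E0) / 2 + (4 * B + 13) * u powr \<kappa>"
        using d1[unfolded eq] d2 hq pe exc[OF EE] by argo
    qed
  qed
qed

end

section \<open>Chaining over dyadic nets\<close>

lemma ln_one_plus_le_sqrt:
  fixes y :: real
  assumes "y \<ge> 0"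
  shows "ln (1 + y) \<le> 2 * sqrt y"
proof -
  have "ln (1 + y) = 2 * ln (sqrt (1 + y))" using assms by (simp add: ln_sqrt)
  also have "\<dots> \<le> 2 * (sqrt (1 + y) - 1)" using assms by (intro mult_left_mono ln_le_minus_one) auto
  also have "\<dots> \<le> 2 * sqrt y" using sqrt_add_le_add_sqrt[of 1 y] assms by simp
  finally show ?thesis .
qed

text \<open>16 = 1/(1 - 3/4)^2 is the value of the infinite series.\<close>

lemma sum_arith_geometric_le: "(\<Sum>j<J. real (j + 1) * (3/4) ^ j) \<le> 16"
proof -
  have "(\<Sum>j<J. real (j + 1) * (3/4) ^ j) = 16 - (4 * real J + 16) * (3/4) ^ J"
  proof (induction J)
    case (Suc J)
    have "real (J + 1) * (3/4) ^ J - (4 * real J + 16) * (3/4) ^ J = - ((4 * real (Suc J) + 16) * (3/4) ^ Suc J)"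
      by (simp add: field_simps)
    then show ?case using Suc by simp
  qed simp
  then show ?thesis by simp
qed

lemma sum_half_powers_le: "(\<Sum>j<J. (1/2) ^ j) \<le> (2::real)"
proof -
  have "(\<Sum>j<J. (1/2) ^ j) = (2::real) - 2 * (1/2) ^ J"
    by (induction J) (auto simp: algebra_simps)
  then show ?thesis by simp
qed

context prob_space
begin

text \<open>At scale 2^(-j) the entropy is p (K + 2 j), only linear in j, while the standard
  deviation of a link decays like 2^(-j/2). Up to a constant a link costs r (j + 1) 2^(-j/2), and
  the total is of order r without a logarithm of n/p.\<close>

lemma chaining_deviation:
  fixes n p :: nat and \<tau> b :: real
  defines "R \<equiv> real p * (2 * b + 4) + \<tau>"
  defines "r \<equiv> sqrt (R / real n)"
  assumes E: "finite \<E>" "\<E> \<subseteq> events" and gr: "growth_le \<E> b p" and b: "b \<ge> 1" and n: "n > 0"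
    and E0: "E0 \<in> events" and \<tau>: "1 \<le> \<tau>"
  shows "holds_upto n (exp (- (real p + \<tau>)))
    (\<lambda>D. \<forall>E\<in>\<E>. \<bar>dev n E D - dev n E0 D\<bar> \<le> 700 * r)"
proof -
  define K where "K = 2 * b + 4"
  have K: "K \<ge> 6" using b by (simp add: K_def)
  have pK: "6 * real p \<le> real p * K" using K by (subst mult.commute, intro mult_left_mono) auto
  have R: "R = real p * K + \<tau>" by (simp add: R_def K_def)
  have Rge: "1 \<le> R" "real p + \<tau> \<le> R" "real p * K \<le> R" using R pK \<tau> by linarith+
  have r0: "r > 0" using Rge n by (simp add: r_def)
  have r2: "r\<^sup>2 = R / real n" using Rge n by (simp add: r_def)
  have Rn: "R = real n * r\<^sup>2" using r2 n by simp
  show ?thesis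
  proof (cases "r < 1")
    case False
    have "\<bar>dev n E D - dev n E0 D\<bar> \<le> 700 * r" for E D
      using dev_diff_le_2[of n E D E0] False by linarith
    then show ?thesis unfolding holds_upto_def by (intro bexI[of _ "{}"]) auto
  next
    case True
    have r21: "r\<^sup>2 < 1" "r\<^sup>2 \<le> r" using True r0 power_decreasing[of 1 2 r] by (auto simp: power_less_one_iff)
    \<comment> \<open>J is the last level with 2^(-J) \<ge> r^2. Up to there r \<le> \<rho>^j, which
      keeps the Bernstein parameter r/(2 \<rho>^j) within its range s \<le> 1/2.\<close>
    obtain J where J: "(1/2) ^ J \<ge> r\<^sup>2" "(1/2) ^ J < 2 * r\<^sup>2"
    proof -
      define k where "k = (LEAST j. (1/2) ^ j < r\<^sup>2)"
      have ex: "\<exists>j. (1/2) ^ j < r\<^sup>2" using r0 by (intro real_arch_pow_inv) auto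
      have k: "(1/2) ^ k < r\<^sup>2" unfolding k_def using ex by (rule LeastI_ex)
      have "k \<noteq> 0" using k r21 by (cases k) auto
      then obtain J where J: "k = Suc J" by (cases k) auto
      have "\<not> (1/2) ^ J < r\<^sup>2" using J not_less_Least[of J "\<lambda>j. (1/2) ^ j < r\<^sup>2"] by (simp add: k_def)
      then show thesis using k J by (intro that[of J]) auto
    qed
    have exp_pi: "\<exists>\<pi>. (\<forall>E\<in>\<E>. \<pi> E \<in> \<E> \<and> prob (sym_diff E (\<pi> E)) \<le> (1/2) ^ j) \<and>
        real (card (\<pi> ` \<E>)) \<le> 4 * exp (real p * (K + 2 * real j))" for j
    proof -
      have eps: "0 < (1/2 :: real) ^ j" "(1/2 :: real) ^ j \<le> 1" by (auto intro: power_le_one)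
      obtain \<pi> where pi: "\<And>E. E \<in> \<E> \<Longrightarrow> \<pi> E \<in> \<E>" "\<And>E. E \<in> \<E> \<Longrightarrow> prob (sym_diff E (\<pi> E)) \<le> (1/2) ^ j"
        "real (card (\<pi> ` \<E>)) \<le> 4 * exp (real p * (2 * b + 4 + 2 * ln (1 / (1/2) ^ j)))"
        using covering_map[OF E gr b eps] by blast
      have "ln (1 / (1/2 :: real) ^ j) = real j * ln 2" by (simp add: power_one_over ln_realpow)
      also have "\<dots> \<le> real j * 1" using ln_2_less_1 by (intro mult_left_mono) auto
      finally have "real p * (2 * b + 4 + 2 * ln (1 / (1/2) ^ j)) \<le> real p * (K + 2 * real j)"
        unfolding K_def by (intro mult_left_mono) auto
      then have "4 * exp (real p * (2 * b + 4 + 2 * ln (1 / (1/2) ^ j))) \<le> 4 * exp (real p * (K + 2 * real j))"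
        by (simp only: mult_le_cancel_left_pos exp_le_cancel_iff zero_less_numeral)
      with pi(3) have "real (card (\<pi> ` \<E>)) \<le> 4 * exp (real p * (K + 2 * real j))"
        by (rule order_trans)
      then show ?thesis using pi(1,2) by (intro exI[of _ \<pi>]) blast
    qed
    obtain \<pi> where pi: "\<And>j E. E \<in> \<E> \<Longrightarrow> \<pi> j E \<in> \<E>"
        "\<And>j E. E \<in> \<E> \<Longrightarrow> prob (sym_diff E (\<pi> j E)) \<le> (1/2) ^ j"
        "\<And>j. real (card (\<pi> j ` \<E>)) \<le> 4 * exp (real p * (K + 2 * real j))"
    proof -
      obtain \<pi> where "\<forall>j. (\<forall>E\<in>\<E>. \<pi> j E \<in> \<E> \<and> prob (sym_diff E (\<pi> j E)) \<le> (1/2) ^ j) \<and>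
          real (card (\<pi> j ` \<E>)) \<le> 4 * exp (real p * (K + 2 * real j))"
        using choice[of "\<lambda>j \<pi>. (\<forall>E\<in>\<E>. \<pi> E \<in> \<E> \<and> prob (sym_diff E (\<pi> E)) \<le> (1/2) ^ j) \<and>
          real (card (\<pi> ` \<E>)) \<le> 4 * exp (real p * (K + 2 * real j))"] exp_pi by blast
      then show thesis by (intro that[of \<pi>]) blast+
    qed

    define \<rho> where "\<rho> = sqrt (1/2 :: real)"
    have rho: "\<rho> > 0" "\<rho>\<^sup>2 = 1/2" "\<rho> \<le> 3/4"
    proof -
      show "\<rho> > 0" "\<rho>\<^sup>2 = 1/2" by (auto simp: \<rho>_def)
      show "\<rho> \<le> 3/4" unfolding \<rho>_def by (rule real_le_lsqrt) (auto simp: power2_eq_square)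
    qed
    have rhoj: "(\<rho> ^ j)\<^sup>2 = (1/2) ^ j" for j using rho(2) by (metis power_commutes power_mult mult.commute)
    let ?Q = "\<lambda>j. (\<lambda>E. (\<pi> (Suc j) E, \<pi> j E)) ` \<E>"
    \<comment> \<open>The exponent for two consecutive nets is at most 3 (j + 1) R; the remaining 13
      (j + 1) R covers p + \<tau> and still leaves exp (-12 (j + 1)), summable in j. In
      \<open>thr\<close>, 33 = 1 + 32 joins the variance term r \<rho>^j with L/(n s), and \<rho> is
      rounded up to 3/4.\<close>
    define L where "L = (\<lambda>j. 16 * real (j + 1) * R)"
    define thr where "thr = (\<lambda>j. 33 * r * (real (j + 1) * (3/4) ^ j))"
    define e where "e = exp (- (real p + \<tau>))"
    have link: "holds_upto n (e * (1/128 * (1/2) ^ j))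
      (\<lambda>D. \<forall>E\<in>\<E>. \<bar>dev n (\<pi> (Suc j) E) D - dev n (\<pi> j E) D\<bar> \<le> thr j)" if j: "j < J" for j
    proof -
      define s where "s = r / (2 * \<rho> ^ j)"
      have rj: "r \<le> \<rho> ^ j"
      proof -
        have "r\<^sup>2 \<le> (1/2) ^ J" by (rule J(1))
        also have "(1/2::real) ^ J \<le> (1/2) ^ j" using j by (intro power_decreasing) auto
        finally have "r\<^sup>2 \<le> (\<rho> ^ j)\<^sup>2" by (simp only: rhoj)
        then show ?thesis by (rule power2_le_imp_le) (use rho(1) in simp)
      qed
      have rhoj0: "\<rho> ^ j > 0" using rho(1) by simp
      have s: "0 < s" "s \<le> 1/2"
        using r0 rj divide_right_mono[OF rj, of "2 * \<rho> ^ j"] rhoj0 unfolding s_def by auto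
      have net: "holds_upto n (real (card (?Q j)) * (2 * exp (- L j)))
        (\<lambda>D. \<forall>(A, B)\<in>?Q j. \<bar>dev n A D - dev n B D\<bar> \<le> s * (2 * (1/2) ^ j) + L j / (real n * s))"
      proof (rule bernstein_pairs[where v = "\<lambda>_ _. 2 * (1/2) ^ j"])
        fix A B assume "(A, B) \<in> ?Q j"
        then obtain E' where E': "E' \<in> \<E>" "A = \<pi> (Suc j) E'" "B = \<pi> j E'" by auto
        then have ev: "E' \<in> events" "A \<in> events" "B \<in> events" using E pi(1) by auto
        have "prob (sym_diff A B) \<le> prob (sym_diff E' A \<union> sym_diff E' B)"
          using ev by (intro finite_measure_mono) auto
        also have "\<dots> \<le> prob (sym_diff E' A) + prob (sym_diff E' B)"
          using ev by (intro measure_Un_le) auto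
        also have "\<dots> \<le> (1/2) ^ Suc j + (1/2) ^ j"
          unfolding E'(2,3) by (intro add_mono pi(2) E'(1))
        also have "\<dots> \<le> 2 * (1/2) ^ j" by simp
        finally show "A \<in> events \<and> B \<in> events \<and> prob (sym_diff A B) \<le> 2 * (1/2) ^ j" using ev by simp
      qed (use E s n in auto)
      have thr: "s * (2 * (1/2) ^ j) + L j / (real n * s) \<le> thr j"
      proof -
        have "s * (2 * (1/2) ^ j) = r * \<rho> ^ j"
          unfolding rhoj[symmetric] using rho(1) by (simp add: s_def power2_eq_square)
        moreover have "L j / (real n * s) = 32 * real (j + 1) * r * \<rho> ^ j"
          using rho(1) n r0 by (simp add: L_def s_def Rn power2_eq_square)
        ultimately have "s * (2 * (1/2) ^ j) + L j / (real n * s) = r * (1 + 32 * real (j + 1)) * \<rho> ^ j"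
          by (simp add: algebra_simps)
        also have "\<dots> \<le> r * (33 * real (j + 1)) * (3/4) ^ j"
          using rho r0 by (intro mult_mono power_mono mult_nonneg_nonneg) auto
        also have "\<dots> = thr j" by (simp add: thr_def)
        finally show ?thesis .
      qed
      have fail: "real (card (?Q j)) * (2 * exp (- L j)) \<le> e * (1/128 * (1/2) ^ j)"
      proof -
        have "?Q j \<subseteq> (\<pi> (Suc j) ` \<E>) \<times> (\<pi> j ` \<E>)" by auto
        then have "card (?Q j) \<le> card (\<pi> (Suc j) ` \<E>) * card (\<pi> j ` \<E>)"
          using E by (subst card_cartesian_product[symmetric], intro card_mono) auto
        then have "real (card (?Q j)) \<le> real (card (\<pi> (Suc j) ` \<E>)) * real (card (\<pi> j ` \<E>))"
          by (metis of_nat_le_iff of_nat_mult)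
        also have "\<dots> \<le> (4 * exp (real p * (K + 2 * real (Suc j)))) * (4 * exp (real p * (K + 2 * real j)))"
          by (intro mult_mono pi(3)) auto
        also have "\<dots> = 16 * exp (real p * (2 * K + 4 * real j + 2))"
          by (simp add: mult_exp_exp algebra_simps)
        finally have "real (card (?Q j)) * (2 * exp (- L j))
            \<le> (16 * exp (real p * (2 * K + 4 * real j + 2))) * (2 * exp (- L j))"
          by (intro mult_right_mono) auto
        also have "\<dots> = 32 * exp (real p * (2 * K + 4 * real j + 2) - L j)"
          by (simp add: mult_exp_exp)
        also have "\<dots> \<le> 32 * exp (- (real p + \<tau>) - real (12 * (j + 1)))"
        proof -
          have "6 * real j \<le> K * real j" using K by (intro mult_right_mono) auto
          then have "2 * K + 4 * real j + 2 \<le> 3 * real (j + 1) * K" using K by (simp add: algebra_simps)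
          then have "real p * (2 * K + 4 * real j + 2) \<le> real p * (3 * real (j + 1) * K)"
            by (intro mult_left_mono) auto
          also have "\<dots> = 3 * real (j + 1) * (real p * K)" by simp
          also have "\<dots> \<le> 3 * real (j + 1) * R" using Rge by (intro mult_left_mono) auto
          finally have 1: "real p * (2 * K + 4 * real j + 2) - L j \<le> - (13 * (real (j + 1) * R))"
            by (simp add: L_def algebra_simps)
          have "1 * R \<le> real (j + 1) * R" "real (j + 1) * 1 \<le> real (j + 1) * R"
            using Rge by (intro mult_right_mono mult_left_mono; simp)+
          moreover have "real (12 * (j + 1)) = 12 * real (j + 1)" by simp
          ultimately have "- (13 * (real (j + 1) * R)) \<le> - (real p + \<tau>) - real (12 * (j + 1))"
            using Rge by linarith
          with 1 have "real p * (2 * K + 4 * real j + 2) - L j \<le> - (real p + \<tau>) - real (12 * (j + 1))"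
            by linarith
          then show ?thesis by simp
        qed
        also have "\<dots> = e * (32 / exp (real (12 * (j + 1))))" by (simp add: e_def exp_diff)
        also have "\<dots> \<le> e * (32 / 2 ^ (12 * (j + 1)))"
          by (intro mult_left_mono divide_left_mono exp_numeral_ge) (auto simp: e_def)
        also have "32 / 2 ^ (12 * (j + 1)) = 1/128 * (1/4096 :: real) ^ j"
          by (simp add: power_add power_mult power_one_over)
        also have "e * (1/128 * (1/4096 :: real) ^ j) \<le> e * (1/128 * (1/2) ^ j)"
          by (intro mult_left_mono power_mono) (auto simp: e_def)
        finally show ?thesis .
      qed
      show ?thesis
        by (rule holds_upto_mono[OF net fail]) (use thr in fastforce)
    qed
    have links: "holds_upto n (\<Sum>j<J. e * (1/128 * (1/2) ^ j))
      (\<lambda>D. \<forall>j\<in>{..<J}. \<forall>E\<in>\<E>. \<bar>dev n (\<pi> (Suc j) E) D - dev n (\<pi> j E) D\<bar> \<le> thr j)"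
      by (rule holds_upto_ball) (use link in auto)
    have "(\<Sum>j<J. e * (1/128 * (1/2) ^ j)) = e / 128 * (\<Sum>j<J. (1/2) ^ j)"
      by (simp add: sum_distrib_left)
    also have "\<dots> \<le> e / 128 * 2" by (intro mult_left_mono sum_half_powers_le) (auto simp: e_def)
    finally have links_fail: "(\<Sum>j<J. e * (1/128 * (1/2) ^ j)) \<le> e / 64" by simp
    have e6: "exp (6::real) \<ge> 64" using exp_numeral_ge[of 6] by simp

    \<comment> \<open>The chain starts from E0, which need not belong to the class, with the trivial
      variance bound 1.\<close>
    let ?Q0 = "(\<lambda>E. (\<pi> 0 E, E0)) ` \<E>"
    have start: "holds_upto n (real (card ?Q0) * (2 * exp (- (8 * R))))
      (\<lambda>D. \<forall>(A, B)\<in>?Q0. \<bar>dev n A D - dev n B D\<bar> \<le> r / 2 * 1 + 8 * R / (real n * (r / 2)))"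
      using E E0 pi r0 True n by (intro bernstein_pairs[where v = "\<lambda>_ _. 1"]) auto
    have start_thr: "r / 2 * 1 + 8 * R / (real n * (r / 2)) \<le> 17 * r"
      using n r0 by (simp add: Rn power2_eq_square)
    have start_fail: "real (card ?Q0) * (2 * exp (- (8 * R))) \<le> e / 8"
    proof -
      have "?Q0 = (\<lambda>A. (A, E0)) ` (\<pi> 0 ` \<E>)" by auto
      then have "card ?Q0 \<le> card (\<pi> 0 ` \<E>)" using E by (metis card_image_le finite_imageI)
      then have "real (card ?Q0) \<le> 4 * exp (real p * K)" using pi(3)[of 0] by simp
      then have "real (card ?Q0) * (2 * exp (- (8 * R))) \<le> (4 * exp (real p * K)) * (2 * exp (- (8 * R)))"
        by (intro mult_right_mono) auto
      also have "\<dots> = 8 * exp (real p * K - 8 * R)" by (simp add: mult_exp_exp)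
      also have "\<dots> \<le> 8 * exp (- (real p + \<tau>) - 6)"
      proof -
        have "real p * K - 8 * R \<le> - (real p + \<tau>) - 6" using Rge by linarith
        then show ?thesis by simp
      qed
      also have "\<dots> = e * (8 / exp 6)" by (simp add: e_def exp_diff)
      also have "\<dots> \<le> e * (1 / 8)" using e6 by (intro mult_left_mono) (auto simp: e_def field_simps)
      finally show ?thesis by simp
    qed

    \<comment> \<open>A threshold of order r, although the residual sets have probability of order
      r^2: the final bound is of order r anyway, and p ln (1 + 2 n/p) \<le> 2 n r then fits below n
      t/12 = 12 n r. This disposes of the logarithm.\<close>
    define t where "t = 144 * r"
    have t0: "t > 0" using r0 by (simp add: t_def)
    have JJ: "(1/2) ^ J < 2 * r" using J(2) r21 by linarith
    have t8: "8 * (1/2) ^ J \<le> t" using JJ r0 by (simp add: t_def)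
    have fine: "holds_upto n (2 * (growth_bound b p (2 * n))\<^sup>2 * exp (- (real n * t / 12)))
      (\<lambda>D. \<forall>E\<in>\<E>. \<bar>dev n E D - dev n (\<pi> J E) D\<bar> \<le> t + (1/2) ^ J)"
      by (rule finest_scale[OF E gr n pi(1,2) t0 t8])
    have fine_fail: "2 * (growth_bound b p (2 * n))\<^sup>2 * exp (- (real n * t / 12)) \<le> e / 2"
    proof -
      have Rnr: "R \<le> real n * r" unfolding Rn using r21 by (intro mult_left_mono) auto
      have "real p * ln (1 + 2 * real n / real p) \<le> 2 * (real n * r)"
      proof (cases "p = 0")
        case False
        have "real p * ln (1 + 2 * real n / real p) \<le> real p * (2 * sqrt (2 * real n / real p))"
          by (intro mult_left_mono ln_one_plus_le_sqrt) auto
        also have "\<dots> = 2 * sqrt (real n * (2 * real p))"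
        proof -
          have "real p * sqrt (2 * real n / real p) = sqrt ((real p)\<^sup>2 * (2 * real n / real p))"
            by (subst real_sqrt_mult) simp
          also have "(real p)\<^sup>2 * (2 * real n / real p) = real n * (2 * real p)"
            using False by (simp add: power2_eq_square)
          finally show ?thesis by simp
        qed
        also have "\<dots> \<le> 2 * sqrt (real n * (real n * r\<^sup>2))"
          using Rge pK unfolding Rn[symmetric] by (intro mult_left_mono real_sqrt_le_mono) auto
        also have "sqrt (real n * (real n * r\<^sup>2)) = sqrt ((real n * r)\<^sup>2)"
          by (simp add: power2_eq_square mult_ac)
        also have "\<dots> = real n * r" using r0 by simp
        finally show ?thesis .
      qed (use r0 in simp)
      moreover have "2 * (real p * b) \<le> real p * K" by (simp add: K_def algebra_simps)
      ultimately have "2 * (real p * (b + ln (1 + real (2 * n) / real p))) \<le> 5 * (real n * r)"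
        using Rge Rnr by (simp add: distrib_left)
      then have g2: "(growth_bound b p (2 * n))\<^sup>2 \<le> 16 * exp (5 * (real n * r))"
        by (simp add: growth_bound_def power_mult_distrib exp_double[symmetric])
      have "2 * (growth_bound b p (2 * n))\<^sup>2 * exp (- (real n * t / 12))
          \<le> 2 * (16 * exp (5 * (real n * r))) * exp (- (real n * t / 12))"
        by (intro mult_right_mono mult_left_mono g2) auto
      also have "\<dots> = 32 * exp (5 * (real n * r) - real n * t / 12)" by (simp add: mult_exp_exp)
      also have "\<dots> \<le> 32 * exp (- (real p + \<tau>) - 6)"
      proof -
        have "real n * t / 12 = 12 * (real n * r)" by (simp add: t_def)
        then have "5 * (real n * r) - real n * t / 12 \<le> - (real p + \<tau>) - 6"
          using Rge Rnr by linarith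
        then show ?thesis by simp
      qed
      also have "\<dots> = e * (32 / exp 6)" by (simp add: e_def exp_diff)
      also have "\<dots> \<le> e * (1 / 2)" using e6 by (intro mult_left_mono) (auto simp: e_def field_simps)
      finally show ?thesis by simp
    qed
    have e0: "e > 0" by (simp add: e_def)
    show ?thesis
    proof (rule holds_upto_mono[OF holds_upto_conj[OF start holds_upto_conj[OF links fine]]], goal_cases)
      case 1
      show ?case using start_fail links_fail fine_fail e0 unfolding e_def[symmetric] by linarith
    next
      case (2 D)
      show ?case
      proof
        fix E assume EE: "E \<in> \<E>"
        have d0: "\<bar>dev n (\<pi> 0 E) D - dev n E0 D\<bar> \<le> 17 * r"
          using 2 EE start_thr by (smt (verit, best) case_prodD image_eqI)
        have dJ: "\<bar>dev n E D - dev n (\<pi> J E) D\<bar> \<le> t + (1/2) ^ J" using 2 EE by blast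
        have "\<bar>dev n (\<pi> J E) D - dev n (\<pi> 0 E) D\<bar> = \<bar>\<Sum>j<J. dev n (\<pi> (Suc j) E) D - dev n (\<pi> j E) D\<bar>"
          by (simp add: sum_lessThan_telescope[of "\<lambda>j. dev n (\<pi> j E) D"])
        also have "\<dots> \<le> (\<Sum>j<J. \<bar>dev n (\<pi> (Suc j) E) D - dev n (\<pi> j E) D\<bar>)" by (rule sum_abs)
        also have "\<dots> \<le> (\<Sum>j<J. thr j)" using 2 EE by (intro sum_mono) blast
        also have "\<dots> = 33 * r * (\<Sum>j<J. real (j + 1) * (3/4) ^ j)"
          by (simp only: thr_def sum_distrib_left)
        also have "\<dots> \<le> 33 * r * 16" using r0 by (intro mult_left_mono sum_arith_geometric_le) auto
        \<comment> \<open>Start, links, finest threshold and finest scale add up to 17 + 528 + 144 +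
          2 = 691.\<close>
        finally show "\<bar>dev n E D - dev n E0 D\<bar> \<le> 700 * r"
          using d0 dJ JJ r0 unfolding t_def by linarith
      qed
    qed
  qed
qed

end

section \<open>Bayes classifier and margin\<close>

locale classification = prob_space P
  for P :: "((nat \<Rightarrow> real) \<times> int) measure" +
  fixes d :: nat and \<eta> :: "(nat \<Rightarrow> real) \<Rightarrow> real"
  assumes sets_P [measurable_cong]: "sets P = sets (cube d \<Otimes>\<^sub>M labels)"
    and posterior: "is_posterior d P \<eta>"
begin

definition err :: "((nat \<Rightarrow> real) \<Rightarrow> int) \<Rightarrow> ((nat \<Rightarrow> real) \<times> int) set" where
  "err g = {z \<in> space P. g (fst z) \<noteq> snd z}"

definition bayes :: "(nat \<Rightarrow> real) \<Rightarrow> int" where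
  "bayes x = (if 1 \<le> 2 * \<eta> x then 1 else - 1)"

abbreviation PX :: "(nat \<Rightarrow> real) measure" where
  "PX \<equiv> marginal d P"

lemma space_P: "space P = space (cube d) \<times> {-1, 1}"
  using sets_eq_imp_space_eq[OF sets_P] by (simp add: space_pair_measure labels_def)

lemma risk_err: "risk P g = prob (err g)"
  by (simp add: risk_def err_def)

lemma eta_measurable [measurable]: "\<eta> \<in> borel_measurable (cube d)"
  and eta_bounds: "x \<in> space (cube d) \<Longrightarrow> 0 \<le> \<eta> x \<and> \<eta> x \<le> 1"
  and eta_integral: "A \<in> sets (cube d) \<Longrightarrow> prob (A \<times> {1}) = (LINT x:A|PX. \<eta> x)"
  using posterior by (auto simp: is_posterior_def)

lemma fst_measurable_P [measurable]: "fst \<in> P \<rightarrow>\<^sub>M cube d"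
  by measurable

lemma sets_PX [measurable_cong, simp]: "sets PX = sets (cube d)"
  by (simp add: marginal_def)

lemma space_PX [simp]: "space PX = space (cube d)"
  by (simp add: marginal_def)

sublocale X: prob_space PX
  unfolding marginal_def by (rule prob_space_distr) measurable

lemma measure_PX: "A \<in> sets (cube d) \<Longrightarrow> measure PX A = prob {z \<in> space P. fst z \<in> A}"
  unfolding marginal_def by (subst measure_distr) (auto intro!: arg_cong[where f = prob])

lemma bayes_measurable [measurable]: "bayes \<in> cube d \<rightarrow>\<^sub>M labels"
  unfolding bayes_def[abs_def] labels_def by measurable

lemma labels_values: "g \<in> cube d \<rightarrow>\<^sub>M labels \<Longrightarrow> x \<in> space (cube d) \<Longrightarrow> g x = 1 \<or> g x = -1"
  by (auto dest: measurable_space simp: labels_def)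

lemma labels_level_sets:
  assumes "g \<in> cube d \<rightarrow>\<^sub>M labels"
  shows "{x \<in> space (cube d). g x = 1} \<in> sets (cube d)"
proof -
  have "g -` {1} \<inter> space (cube d) \<in> sets (cube d)"
    using assms by (rule measurable_sets) (simp add: labels_def)
  also have "g -` {1} \<inter> space (cube d) = {x \<in> space (cube d). g x = 1}" by auto
  finally show ?thesis .
qed

lemma rectangle_sets: "A \<in> sets (cube d) \<Longrightarrow> B \<subseteq> {-1, 1} \<Longrightarrow> A \<times> B \<in> events"
  unfolding sets_P by (intro pair_measureI) (auto simp: labels_def)

lemma err_decomp:
  assumes g: "g \<in> cube d \<rightarrow>\<^sub>M labels"
  shows "err g = {x \<in> space (cube d). g x = 1} \<times> {-1} \<union> (space (cube d) - {x \<in> space (cube d). g x = 1}) \<times> {1}"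
proof (intro set_eqI)
  fix z :: "(nat \<Rightarrow> real) \<times> int"
  obtain x y where z: "z = (x, y)" by (cases z)
  show "z \<in> err g \<longleftrightarrow> z \<in> {x \<in> space (cube d). g x = 1} \<times> {-1} \<union>
      (space (cube d) - {x \<in> space (cube d). g x = 1}) \<times> {1}"
  proof (cases "x \<in> space (cube d)")
    case True
    then show ?thesis using labels_values[OF g True] by (auto simp: z err_def space_P)
  qed (simp add: z err_def space_P)
qed

lemma err_sets: "g \<in> cube d \<rightarrow>\<^sub>M labels \<Longrightarrow> err g \<in> events"
  unfolding err_decomp using labels_level_sets[of g] by (auto intro!: sets.Un rectangle_sets)

section \<open>Risk and excess risk through the posterior\<close>

definition cond_loss :: "((nat \<Rightarrow> real) \<Rightarrow> int) \<Rightarrow> (nat \<Rightarrow> real) \<Rightarrow> real" where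
  "cond_loss g x = (if g x = 1 then 1 - \<eta> x else \<eta> x)"

lemma eta_integrable: "integrable PX \<eta>"
  by (rule X.integrable_const_bound[of _ 1]) (auto intro!: AE_I2 simp: eta_bounds)

lemma cond_loss_integrable:
  assumes g: "g \<in> cube d \<rightarrow>\<^sub>M labels"
  shows "integrable PX (cond_loss g)"
proof (rule X.integrable_const_bound[of _ 1])
  have [measurable]: "Measurable.pred (cube d) (\<lambda>x. g x = 1)"
    using labels_level_sets[OF g] by (simp add: pred_def)
  show "cond_loss g \<in> borel_measurable PX" unfolding cond_loss_def[abs_def] by measurable
  show "AE x in PX. norm (cond_loss g x) \<le> 1"
  proof (intro AE_I2)
    fix x assume "x \<in> space PX"
    then show "norm (cond_loss g x) \<le> 1" using eta_bounds[of x] by (simp add: cond_loss_def)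
  qed
qed

text \<open>The posterior speaks of the label 1, so the mass of A under the label -1 is obtained by
  subtraction from the marginal mass of A.\<close>

lemma risk_eq:
  assumes g: "g \<in> cube d \<rightarrow>\<^sub>M labels"
  shows "risk P g = (\<integral>x. cond_loss g x \<partial>PX)"
proof -
  define A where "A = {x \<in> space (cube d). g x = 1}"
  define B where "B = space (cube d) - A"
  have [measurable]: "A \<in> sets (cube d)" "B \<in> sets (cube d)"
    using labels_level_sets[OF g] by (auto simp: A_def B_def)
  have "err g = A \<times> {-1} \<union> B \<times> {1}" using err_decomp[OF g] by (simp add: A_def B_def)
  then have "risk P g = prob (A \<times> {-1}) + prob (B \<times> {1})"
    unfolding risk_err by (simp add: finite_measure_Union rectangle_sets disjoint_iff)
  moreover have "prob (A \<times> {-1}) + prob (A \<times> {1}) = measure PX A"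
  proof -
    have "prob (A \<times> {-1}) + prob (A \<times> {1}) = prob (A \<times> {-1} \<union> A \<times> {1})"
      by (intro finite_measure_Union[symmetric] rectangle_sets) auto
    also have "A \<times> {-1} \<union> A \<times> {1} = {z \<in> space P. fst z \<in> A}"
      using sets.sets_into_space[of A "cube d"] by (auto simp: space_P)
    finally show ?thesis by (simp add: measure_PX)
  qed
  ultimately have "risk P g = measure PX A - (LINT x:A|PX. \<eta> x) + (LINT x:B|PX. \<eta> x)"
    using eta_integral[of A] eta_integral[of B] by simp
  also have "\<dots> = (\<integral>x. indicator A x - indicator A x * \<eta> x + indicator B x * \<eta> x \<partial>PX)"
  proof -
    have iA: "integrable PX (\<lambda>x. indicator A x * \<eta> x)" "integrable PX (\<lambda>x. indicator B x * \<eta> x)"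
      using eta_integrable by (auto intro: integrable_real_mult_indicator simp: mult.commute)
    have i1: "integrable PX (indicator A :: _ \<Rightarrow> real)"
      by (auto simp: integrable_indicator_iff X.emeasure_eq_measure)
    show ?thesis
      using iA i1 by (simp add: set_lebesgue_integral_def)
  qed
  also have "\<dots> = (\<integral>x. cond_loss g x \<partial>PX)"
    by (intro Bochner_Integration.integral_cong) (auto simp: cond_loss_def A_def B_def indicator_def)
  finally show ?thesis .
qed

text \<open>The excess risk is the integral of |2 \<eta> - 1| over the set A where g and the Bayes
  rule disagree. Off the strip S this integrand exceeds h, so h (PX A - PX S) is at most the excess
  risk. With two labels exactly one of two disagreeing rules errs, which turns A into the symmetric
  difference of the error sets.\<close>

lemma bayes_margin:
  assumes g: "g \<in> cube d \<rightarrow>\<^sub>M labels" and h: "h > 0"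
  shows "prob (sym_diff (err g) (err bayes)) \<le>
    measure PX {x \<in> space (cube d). \<bar>2 * \<eta> x - 1\<bar> \<le> h} + (risk P g - risk P bayes) / h"
    and "risk P bayes \<le> risk P g"
proof -
  define A where "A = {x \<in> space (cube d). g x \<noteq> bayes x}"
  define S where "S = {x \<in> space (cube d). \<bar>2 * \<eta> x - 1\<bar> \<le> h}"
  have A: "A = sym_diff {x \<in> space (cube d). g x = 1} {x \<in> space (cube d). bayes x = 1}"
    using labels_values[OF g] labels_values[OF bayes_measurable] unfolding A_def by fastforce
  have [measurable]: "A \<in> sets (cube d)"
    unfolding A by (intro sets.Un sets.Diff labels_level_sets g bayes_measurable)
  have [measurable]: "S \<in> sets (cube d)" unfolding S_def by measurable
  have "sym_diff (err g) (err bayes) = {z \<in> space P. fst z \<in> A}"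
    using labels_values[OF g] labels_values[OF bayes_measurable]
    by (fastforce simp: err_def space_P A_def)
  then have sd: "prob (sym_diff (err g) (err bayes)) = measure PX A" by (simp add: measure_PX)
  have point: "h * (indicator A x - indicator S x) \<le> cond_loss g x - cond_loss bayes x"
    "0 \<le> cond_loss g x - cond_loss bayes x" if x: "x \<in> space (cube d)" for x
  proof -
    have "cond_loss g x - cond_loss bayes x = indicator A x * \<bar>2 * \<eta> x - 1\<bar>"
      using labels_values[OF g x] x by (auto simp: cond_loss_def A_def bayes_def indicator_def)
    then show "h * (indicator A x - indicator S x) \<le> cond_loss g x - cond_loss bayes x"
      "0 \<le> cond_loss g x - cond_loss bayes x"
      using h x by (auto simp: indicator_def S_def)
  qed
  have diff: "risk P g - risk P bayes = (\<integral>x. cond_loss g x - cond_loss bayes x \<partial>PX)"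
    using cond_loss_integrable[OF g] cond_loss_integrable[OF bayes_measurable]
    by (simp add: risk_eq g)
  have i1: "integrable PX (indicator A :: _ \<Rightarrow> real)" "integrable PX (indicator S :: _ \<Rightarrow> real)"
    by (auto simp: integrable_indicator_iff X.emeasure_eq_measure)
  have "h * (measure PX A - measure PX S) = (\<integral>x. h * (indicator A x - indicator S x) \<partial>PX)"
    using i1 by simp
  also have "\<dots> \<le> risk P g - risk P bayes"
    unfolding diff using i1 point cond_loss_integrable[OF g] cond_loss_integrable[OF bayes_measurable]
    by (intro integral_mono) auto
  finally have "measure PX A - measure PX S \<le> (risk P g - risk P bayes) / h"
    using h by (simp add: field_simps)
  then show "prob (sym_diff (err g) (err bayes)) \<le>
    measure PX {x \<in> space (cube d). \<bar>2 * \<eta> x - 1\<bar> \<le> h} + (risk P g - risk P bayes) / h"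
    unfolding sd S_def by simp
  have "0 \<le> risk P g - risk P bayes"
    unfolding diff using point(2) by (intro Bochner_Integration.integral_nonneg) simp
  then show "risk P bayes \<le> risk P g" by simp
qed

lemma bayes_risk_eq: "bayes_risk d P = risk P bayes"
  unfolding bayes_risk_def
  by (rule cInf_eq_minimum) (use bayes_measurable bayes_margin(2)[OF _ zero_less_one] in auto)

section \<open>Measurability, finiteness and growth of the tree classes\<close>

lemma tree_set_sets:
  "tree_set d p Y A \<Longrightarrow> Y \<in> sets (cube d) \<Longrightarrow> A \<in> sets (cube d)"
proof (induction rule: tree_set.induct)
  case (node j Y1 Y t p A q B)
  have j [measurable]: "(\<lambda>x. x j) \<in> borel_measurable (cube d)"
  proof -
    have "(\<lambda>x. x j) \<in> cube d \<rightarrow>\<^sub>M restrict_space borel {0..1}"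
      unfolding cube_def using node.hyps(1) by (intro measurable_component_singleton) auto
    then show ?thesis by (simp add: measurable_restrict_space2_iff)
  qed
  have "{x \<in> space (cube d). x j \<le> t} \<in> sets (cube d)" "{x \<in> space (cube d). x j < t} \<in> sets (cube d)"
    by measurable
  moreover have "{x \<in> Y. x j \<le> t} = Y \<inter> {x \<in> space (cube d). x j \<le> t}"
    "{x \<in> Y. x j < t} = Y \<inter> {x \<in> space (cube d). x j < t}"
    using sets.sets_into_space[OF node.prems] by auto
  ultimately have "{x \<in> Y. x j \<le> t} \<in> sets (cube d)" "{x \<in> Y. x j < t} \<in> sets (cube d)"
    using node.prems by simp_all
  then have "Y1 \<in> sets (cube d)" using node.hyps(2) by blast
  then show ?case using node by auto
qed auto

lemma trees_measurable:
  assumes Z: "Z \<in> policies d" and g: "g \<in> trees d Z p"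
  shows "g \<in> cube d \<rightarrow>\<^sub>M labels"
proof -
  let ?A = "{x \<in> space (cube d). g x = 1}"
  have val: "g x = 1 \<or> g x = -1" if "x \<in> space (cube d)" for x
    using trees_tree_set(2)[OF Z g that] by auto
  have A: "?A \<in> sets (cube d)" using tree_set_sets[OF trees_tree_set(1)[OF Z g]] by simp
  have "(\<lambda>x. if x \<in> ?A then 1 else - 1 :: int) \<in> cube d \<rightarrow>\<^sub>M labels"
    unfolding labels_def using A by (intro measurable_If_set) auto
  moreover have "(if x \<in> ?A then 1 else - 1) = g x" if "x \<in> space (cube d)" for x
    using val[OF that] that by auto
  ultimately show ?thesis by (simp cong: measurable_cong)
qed

lemma finite_trees:
  assumes Z: "Z \<in> policies d"
  shows "finite (trees d Z p)"
proof -
  have fin: "finite (cells d Z p)" by (rule partition_of_finite[OF cells_partition_of[OF Z]])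
  have "trees d Z p \<subseteq> (\<lambda>c x. \<Sum>A\<in>cells d Z p. c A * indicator A x) ` (cells d Z p \<rightarrow>\<^sub>E {-1, 1})"
  proof
    fix g assume "g \<in> trees d Z p"
    then obtain c where c: "\<forall>A\<in>cells d Z p. c A \<in> {-1, 1}"
      "g = (\<lambda>x. \<Sum>A\<in>cells d Z p. c A * indicator A x)" unfolding trees_def by auto
    then have "g = (\<lambda>x. \<Sum>A\<in>cells d Z p. restrict c (cells d Z p) A * indicator A x)"
      "restrict c (cells d Z p) \<in> cells d Z p \<rightarrow>\<^sub>E {-1, 1}" by auto
    then show "g \<in> (\<lambda>c x. \<Sum>A\<in>cells d Z p. c A * indicator A x) ` (cells d Z p \<rightarrow>\<^sub>E {-1, 1})" by blast
  qed
  then show ?thesis by (rule finite_subset) (intro finite_imageI finite_PiE fin, simp)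
qed

text \<open>On F the error set of g is determined by the trace of its positive region on the
  projected points, so there are no more error traces than region traces. G may mix arbitrary
  policies, since \<open>tree_set\<close> covers all of them within the same count; hence k does not
  appear.\<close>

lemma trees_growth:
  assumes d: "d \<ge> 1" and G: "\<And>g. g \<in> G \<Longrightarrow> \<exists>Z\<in>policies d. g \<in> trees d Z p"
  shows "growth_le (err ` G) (1 + ln (8 * real d)) p"
  unfolding growth_le_def
proof safe
  fix F assume F: "finite F" "F \<subseteq> space P"
  let ?X = "fst ` F"
  let ?lab = "\<lambda>A. {z \<in> F. (fst z \<in> A) \<noteq> (snd z = 1)}"
  have finX: "finite ?X" using F by simp
  have fin: "finite {A. tree_set d p ?X A}"
    by (rule finite_subset[of _ "Pow ?X"]) (use finX in \<open>auto dest: tree_set_subset\<close>)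
  have "(\<lambda>E. E \<inter> F) ` (err ` G) \<subseteq> ?lab ` {A. tree_set d p ?X A}"
  proof safe
    fix g assume "g \<in> G"
    then obtain Z where Z: "Z \<in> policies d" "g \<in> trees d Z p" using G by blast
    let ?A = "{x \<in> space (cube d). g x = 1}"
    have "space (cube d) \<inter> ?X = ?X" using F by (auto simp: space_P)
    then have "tree_set d p ?X (?A \<inter> ?X)"
      using tree_set_restrict[OF trees_tree_set(1)[OF Z], of ?X] by simp
    moreover have "err g \<inter> F = ?lab (?A \<inter> ?X)"
    proof -
      have "g (fst z) \<noteq> snd z \<longleftrightarrow> (fst z \<in> ?A \<inter> ?X) \<noteq> (snd z = 1)" if "z \<in> F" for z
      proof -
        have z: "fst z \<in> space (cube d)" "snd z = 1 \<or> snd z = -1" "fst z \<in> ?X"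
          using that F by (auto simp: space_P)
        then show ?thesis using trees_tree_set(2)[OF Z z(1)] by auto
      qed
      then show ?thesis using F by (auto simp: err_def)
    qed
    ultimately show "err g \<inter> F \<in> ?lab ` {A. tree_set d p ?X A}" by blast
  qed
  then have "card ((\<lambda>E. E \<inter> F) ` (err ` G)) \<le> card (?lab ` {A. tree_set d p ?X A})"
    by (intro card_mono finite_imageI fin)
  also have "\<dots> \<le> card {A. tree_set d p ?X A}" by (rule card_image_le[OF fin])
  finally have "real (card ((\<lambda>E. E \<inter> F) ` (err ` G))) \<le> real (card {A. tree_set d p ?X A})" by simp
  also have "\<dots> \<le> growth_bound (1 + ln (8 * real d)) p (card ?X)"
    by (rule card_tree_set_growth[OF finX d])
  also have "\<dots> \<le> growth_bound (1 + ln (8 * real d)) p (card F)"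
    using F card_image_le by (intro growth_bound_mono) auto
  finally show "real (card ((\<lambda>E. E \<inter> F) ` (err ` G))) \<le> growth_bound (1 + ln (8 * real d)) p (card F)" .
qed

text \<open>h = w^(1/(2 + a)) balances the strip term h^(1 + a) against w/h, and (1 + a)/(2 + a) =
  1/(2 - \<theta>) for \<theta> = a/(1 + a). For \<alpha> = \<infinity> every strip with h < 1 is
  null; h = 1/2 leaves w/h = 2 w, whence the 2 in c + 2.\<close>

lemma margin_scale:
  assumes noise: "noise_exponent d P \<eta> \<alpha> c" and c: "c > 0" and w: "0 < w" "w \<le> 1"
  shows "\<exists>h>0. h \<le> 1 \<and> h * measure PX {x \<in> space (cube d). \<bar>2 * \<eta> x - 1\<bar> \<le> h} + w / h
      \<le> (c + 2) * w powr (1 / (2 - vartheta \<alpha>))"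
proof -
  let ?m = "\<lambda>h. measure PX {x \<in> space (cube d). \<bar>2 * \<eta> x - 1\<bar> \<le> h}"
  have noise': "ennreal (?m h) \<le> ennreal c * epow h \<alpha>" if "h \<ge> 0" for h
    using noise that by (simp add: noise_exponent_def X.emeasure_eq_measure)
  show ?thesis
  proof (cases "\<alpha> = \<infinity>")
    case True
    have "ennreal (?m (1/2)) \<le> 0" using noise'[of "1/2"] True by (simp add: epow_def)
    then have "?m (1/2) \<le> 0" by (simp add: ennreal_eq_0_iff)
    then have "?m (1/2) = 0" using measure_nonneg by (intro antisym)
    then show ?thesis using True w c
      by (intro exI[of _ "1/2"]) (auto simp: vartheta_def)
  next
    case False
    define a where "a = enn2real \<alpha>"
    have a: "a \<ge> 0" by (simp add: a_def)
    define h where "h = w powr (1 / (2 + a))"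
    have h: "0 < h" "h \<le> 1" using w a by (auto simp: h_def powr_le1)
    have "epow h \<alpha> = ennreal (h powr a)" using False h by (auto simp: epow_def a_def)
    then have "ennreal (?m h) \<le> ennreal (c * h powr a)"
      using noise'[of h] h c by (simp add: ennreal_mult)
    then have m: "?m h \<le> c * h powr a" using c by (subst (asm) ennreal_le_iff) auto
    have \<kappa>: "1 / (2 - vartheta \<alpha>) = (1 + a) / (2 + a)"
      using False a by (simp add: vartheta_def a_def[symmetric] field_simps)
    have "h * ?m h \<le> h * (c * h powr a)" using m h by (intro mult_left_mono) auto
    also have "\<dots> = c * (h powr 1 * h powr a)" using h by simp
    also have "\<dots> = c * h powr (1 + a)" by (simp only: powr_add)
    also have "\<dots> = c * w powr ((1 + a) / (2 + a))" using a by (simp add: h_def powr_powr)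
    finally have 1: "h * ?m h \<le> c * w powr ((1 + a) / (2 + a))" .
    have "w / h = w powr (1 - 1 / (2 + a))" using w by (simp add: h_def powr_diff)
    also have "1 - 1 / (2 + a) = (1 + a) / (2 + a)" using a by (simp add: field_simps)
    finally have "h * ?m h + w / h \<le> (c + 1) * w powr ((1 + a) / (2 + a))" using 1 by (simp add: algebra_simps)
    also have "\<dots> \<le> (c + 2) * w powr ((1 + a) / (2 + a))" by (intro mult_right_mono) auto
    finally show ?thesis using h unfolding \<kappa> by blast
  qed
qed

end

section \<open>The oracle inequality\<close>

lemma powr_add_le_double:
  fixes x y \<kappa> :: real
  assumes "0 \<le> x" "0 \<le> y" "0 \<le> \<kappa>"
  shows "(x + y) powr \<kappa> \<le> (2 * x) powr \<kappa> + (2 * y) powr \<kappa>"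
proof (cases "x \<le> y")
  case True
  then have "(x + y) powr \<kappa> \<le> (2 * y) powr \<kappa>" using assms by (intro powr_mono2) auto
  then show ?thesis by (smt (verit) powr_ge_zero)
next
  case False
  then have "(x + y) powr \<kappa> \<le> (2 * x) powr \<kappa>" using assms by (intro powr_mono2) auto
  then show ?thesis by (smt (verit) powr_ge_zero)
qed

text \<open>The power y^(-\<beta>) swallows the logarithm at the price of 1/\<beta>, so the constant
  degenerates as \<beta> tends to 0.\<close>

lemma entropy_le_power:
  fixes y b \<beta> :: real
  assumes y: "0 < y" "y \<le> 1" and \<beta>: "0 < \<beta>" and b: "b \<ge> 0"
  shows "y * (2 * b + 4 + 2 * ln (1 + 2 / y)) \<le> (2 * b + 8 + 2 / \<beta>) * y powr (1 - \<beta>)"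
proof -
  have "ln (1 + 2 / y) \<le> ln (3 * (1 / y))"
    using y by (intro ln_mono) (auto simp: field_simps)
  also have "\<dots> = ln 3 + ln (1 / y)" using y by (subst ln_mult) auto
  also have "ln (3::real) \<le> 2" using ln_le_minus_one[of "3::real"] by simp
  also have "ln (1 / y) \<le> (1 / y) powr \<beta> / \<beta>" using y \<beta> by (intro ln_powr_bound) auto
  also have "(1 / y) powr \<beta> = y powr - \<beta>" using y by (simp add: powr_minus powr_divide inverse_eq_divide)
  finally have l: "ln (1 + 2 / y) \<le> 2 + y powr - \<beta> / \<beta>" by simp
  have "y * (2 * b + 4 + 2 * ln (1 + 2 / y)) \<le> y * (2 * b + 8 + 2 / \<beta> * y powr - \<beta>)"
    using l y by (intro mult_left_mono) auto
  also have "\<dots> = (2 * b + 8) * y + 2 / \<beta> * (y powr 1 * y powr - \<beta>)" using y by (simp add: algebra_simps)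
  also have "y powr 1 * y powr - \<beta> = y powr (1 - \<beta>)" by (simp only: powr_add[symmetric] diff_conv_add_uminus)
  also have "(2 * b + 8) * y \<le> (2 * b + 8) * y powr (1 - \<beta>)"
    using powr_mono'[of "1 - \<beta>" 1 y] y \<beta> b by (intro mult_left_mono) auto
  finally show ?thesis by (simp add: algebra_simps)
qed

text \<open>Coefficient of the entropy term in the two regimes, chaining for \<beta> = 0 and one
  localized net otherwise. It may depend on b, hence on d, because it ends up in C.\<close>

definition dev_const :: "real \<Rightarrow> real \<Rightarrow> real \<Rightarrow> real \<Rightarrow> real" where
  "dev_const \<beta> \<kappa> b B = (if \<beta> = 0 then 700 * sqrt (2 * b + 4)
     else (4 * B + 13) * (16 * (2 * b + 8 + 2 / \<beta>)) powr \<kappa>)"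

lemma dev_const_pos: "b \<ge> 1 \<Longrightarrow> B \<ge> 0 \<Longrightarrow> \<beta> \<ge> 0 \<Longrightarrow> dev_const \<beta> \<kappa> b B > 0"
proof -
  assume "b \<ge> 1" "B \<ge> 0" "\<beta> \<ge> 0"
  then have "16 * (2 * b + 8 + 2 / \<beta>) > 0" "4 * B + 13 > 0"
    by (auto intro!: add_pos_nonneg)
  then show ?thesis using \<open>b \<ge> 1\<close> by (auto simp: dev_const_def)
qed

text \<open>Both regimes in one shape, \<beta> being the exponent given away for the logarithm. The
  coefficient of (\<tau>/n)^\<kappa> contains neither b nor \<beta>: its first part comes from the
  localized bound, where 16^\<kappa> \<le> 16, and 700 from chaining. This keeps V independent of d
  and \<delta>.\<close>

lemma (in prob_space) excess_deviation:
  fixes n p :: nat and \<tau> b B \<kappa> \<beta> :: real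
  assumes E: "finite \<E>" "\<E> \<subseteq> events" and gr: "growth_le \<E> b p" and b: "b \<ge> 1" and n: "n > 0"
    and E0: "E0 \<in> events" and \<tau>: "1 \<le> \<tau>" "\<tau> \<le> real n" and p: "p \<le> n"
    and exc: "\<And>E. E \<in> \<E> \<Longrightarrow> prob E0 \<le> prob E"
    and \<kappa>: "1/2 \<le> \<kappa>" "\<kappa> \<le> 1" and \<beta>: "0 \<le> \<beta>" "\<beta> = 0 \<Longrightarrow> \<kappa> = 1/2" and B: "B \<ge> 0"
    and margin: "\<And>w. 0 < w \<Longrightarrow> w \<le> 1 \<Longrightarrow> \<exists>h q. 0 < h \<and> h \<le> 1 \<and> 0 \<le> q \<and> h * q + w / h \<le> B * w powr \<kappa> \<and>
      (\<forall>E\<in>\<E>. prob (sym_diff E E0) \<le> q + (prob E - prob E0) / h)"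
  shows "holds_upto n (exp (- (real p + \<tau>)))
    (\<lambda>D. \<forall>E\<in>\<E>. \<bar>dev n E D - dev n E0 D\<bar> \<le> (prob E - prob E0) / 2 +
      dev_const \<beta> \<kappa> b B * (real p / real n) powr ((1 - \<beta>) * \<kappa>) +
      (16 * (4 * B + 13) + 700) * (\<tau> / real n) powr \<kappa>)"
proof (cases "\<beta> = 0")
  case True
  then have k: "\<kappa> = 1/2" using \<beta> by simp
  have "sqrt ((real p * (2 * b + 4) + \<tau>) / real n) = sqrt ((2 * b + 4) * (real p / real n) + \<tau> / real n)"
    by (simp add: add_divide_distrib mult.commute)
  also have "\<dots> \<le> sqrt ((2 * b + 4) * (real p / real n)) + sqrt (\<tau> / real n)"
    using b \<tau> by (intro sqrt_add_le_add_sqrt) auto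
  also have "sqrt ((2 * b + 4) * (real p / real n)) = sqrt (2 * b + 4) * sqrt (real p / real n)"
    by (rule real_sqrt_mult)
  finally have 1: "700 * sqrt ((real p * (2 * b + 4) + \<tau>) / real n)
      \<le> dev_const \<beta> \<kappa> b B * (real p / real n) powr ((1 - \<beta>) * \<kappa>) + 700 * (\<tau> / real n) powr \<kappa>"
    unfolding k dev_const_def using True \<tau> by (simp add: powr_half_sqrt)
  have 2: "0 \<le> 16 * (4 * B + 13) * (\<tau> / real n) powr \<kappa>" using B by auto
  show ?thesis
  proof (rule holds_upto_mono[OF chaining_deviation[OF E gr b n E0 \<tau>(1)] order_refl], intro ballI)
    fix D E assume D: "\<forall>E\<in>\<E>. \<bar>dev n E D - dev n E0 D\<bar> \<le> 700 * sqrt ((real p * (2 * b + 4) + \<tau>) / real n)"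
      and EE: "E \<in> \<E>"
    have "0 \<le> (prob E - prob E0) / 2" using exc[OF EE] by simp
    moreover have "\<bar>dev n E D - dev n E0 D\<bar> \<le> 700 * sqrt ((real p * (2 * b + 4) + \<tau>) / real n)"
      using D EE by blast
    ultimately show "\<bar>dev n E D - dev n E0 D\<bar> \<le> (prob E - prob E0) / 2 +
      dev_const \<beta> \<kappa> b B * (real p / real n) powr ((1 - \<beta>) * \<kappa>) +
      (16 * (4 * B + 13) + 700) * (\<tau> / real n) powr \<kappa>"
      using 1 2 unfolding distrib_right[of _ 700] by linarith
  qed
next
  case False
  then have b0: "\<beta> > 0" using \<beta> by simp
  define W where "W = real p * (2 * b + 4 + 2 * ln (1 + 2 * real n / real p))"
  define A where "A = 2 * b + 8 + 2 / \<beta>"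
  define y where "y = real p / real n"
  have A0: "A > 0" using b b0 by (auto simp: A_def intro!: add_pos_nonneg)
  have W0: "W \<ge> 0" unfolding W_def using b by (intro mult_nonneg_nonneg add_nonneg_nonneg) auto
  have Wn: "W / real n \<le> A * y powr (1 - \<beta>)"
  proof (cases "p = 0")
    case False
    then have y: "0 < y" "y \<le> 1" using p n by (auto simp: y_def)
    have "W / real n = y * (2 * b + 4 + 2 * ln (1 + 2 / y))" by (simp add: W_def y_def)
    also have "\<dots> \<le> A * y powr (1 - \<beta>)" unfolding A_def using y b0 b by (intro entropy_le_power) auto
    finally show ?thesis .
  qed (simp add: W_def y_def)
  have eq: "8 * (W + \<tau>) / real n = 8 * (W / real n) + 8 * (\<tau> / real n)" by (simp add: add_divide_distrib)
  have "(8 * (W + \<tau>) / real n) powr \<kappa> \<le> (2 * (8 * (W / real n))) powr \<kappa> + (2 * (8 * (\<tau> / real n))) powr \<kappa>"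
    unfolding eq using W0 \<tau> \<kappa> by (intro powr_add_le_double) auto
  also have "(2 * (8 * (W / real n))) powr \<kappa> \<le> ((16 * A) * y powr (1 - \<beta>)) powr \<kappa>"
    using Wn W0 \<kappa> by (intro powr_mono2) auto
  also have "\<dots> = (16 * A) powr \<kappa> * y powr ((1 - \<beta>) * \<kappa>)"
    using A0 by (simp add: powr_mult powr_powr)
  also have "(2 * (8 * (\<tau> / real n))) powr \<kappa> = 16 powr \<kappa> * (\<tau> / real n) powr \<kappa>"
    using \<tau> by (subst powr_mult[symmetric]) auto
  also have "\<dots> \<le> 16 * (\<tau> / real n) powr \<kappa>"
    using powr_mono[of \<kappa> 1 16] \<kappa> by (intro mult_right_mono) auto
  finally have "(4 * B + 13) * (8 * (W + \<tau>) / real n) powr \<kappa> \<le>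
     (4 * B + 13) * ((16 * A) powr \<kappa> * y powr ((1 - \<beta>) * \<kappa>) + 16 * (\<tau> / real n) powr \<kappa>)"
    using B by (intro mult_left_mono) auto
  also have "\<dots> = dev_const \<beta> \<kappa> b B * y powr ((1 - \<beta>) * \<kappa>) + 16 * (4 * B + 13) * (\<tau> / real n) powr \<kappa>"
    using False by (simp add: dev_const_def A_def algebra_simps)
  finally have 1: "(4 * B + 13) * (8 * (W + \<tau>) / real n) powr \<kappa> \<le>
     dev_const \<beta> \<kappa> b B * y powr ((1 - \<beta>) * \<kappa>) + 16 * (4 * B + 13) * (\<tau> / real n) powr \<kappa>" .
  have 2: "0 \<le> 700 * (\<tau> / real n) powr \<kappa>" by simp
  have \<kappa>0: "0 \<le> \<kappa>" using \<kappa> by simp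
  show ?thesis
  proof (rule holds_upto_mono[OF localized_deviation[OF E gr b n E0 \<tau> p exc \<kappa>0 \<kappa>(2) B margin] order_refl],
      assumption, assumption, assumption, intro ballI)
    fix D E assume D: "\<forall>E\<in>\<E>. \<bar>dev n E D - dev n E0 D\<bar> \<le> (prob E - prob E0) / 2 + (4 * B + 13) *
       (8 * (real p * (2 * b + 4 + 2 * ln (1 + 2 * real n / real p)) + \<tau>) / real n) powr \<kappa>"
      and EE: "E \<in> \<E>"
    then have "\<bar>dev n E D - dev n E0 D\<bar> \<le> (prob E - prob E0) / 2 + (4 * B + 13) * (8 * (W + \<tau>) / real n) powr \<kappa>"
      unfolding W_def by blast
    then show "\<bar>dev n E D - dev n E0 D\<bar> \<le> (prob E - prob E0) / 2 +
      dev_const \<beta> \<kappa> b B * (real p / real n) powr ((1 - \<beta>) * \<kappa>) +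
      (16 * (4 * B + 13) + 700) * (\<tau> / real n) powr \<kappa>"
      using 1 2 unfolding distrib_right[of _ 700] y_def by linarith
  qed
qed

text \<open>With u = lam p^2 and x = 1/(lam n^2) one has (p/n)^2 = u x. Young's inequality with
  weights \<omega> and 1 - \<omega> separates the factors and leaves the exponent \<omega>/(1 -
  \<omega>) on x; as x \<le> 1, it may be lowered to \<gamma>.\<close>

lemma penalty_absorbs:
  fixes \<omega> \<gamma> G :: real
  assumes \<omega>: "0 < \<omega>" "\<omega> < 1" and \<gamma>: "\<gamma> \<le> \<omega> / (1 - \<omega>)" and G: "G > 0"
  shows "\<exists>D>0. \<forall>(p::nat) (n::nat) (lam::real). n > 0 \<longrightarrow> lam > 0 \<longrightarrow> 1 / (lam * (real n)\<^sup>2) \<le> 1 \<longrightarrow>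
     G * (real p / real n) powr (2 * \<omega>) \<le> lam * (real p)\<^sup>2 / 4 + D * (1 / (lam * (real n)\<^sup>2)) powr \<gamma>"
proof -
  \<comment> \<open>Chosen so that D^(1 - \<omega>) compensates G and the factor 1/4 placed on
    u.\<close>
  define D where "D = (G * 4 powr \<omega>) powr (1 / (1 - \<omega>))"
  have D0: "D > 0" using G by (simp add: D_def)
  have D1: "D powr (1 - \<omega>) = G * 4 powr \<omega>" using \<omega> G by (simp add: D_def powr_powr)
  have "G * (real p / real n) powr (2 * \<omega>) \<le> lam * (real p)\<^sup>2 / 4 + D * (1 / (lam * (real n)\<^sup>2)) powr \<gamma>"
    if n: "n > 0" and lam: "lam > 0" and x1: "1 / (lam * (real n)\<^sup>2) \<le> 1" for p n :: nat and lam :: real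
  proof (cases "p = 0")
    case True
    then show ?thesis using D0 by simp
  next
    case False
    define x where "x = 1 / (lam * (real n)\<^sup>2)"
    define u where "u = lam * (real p)\<^sup>2"
    have x0: "0 < x" "x \<le> 1" using n lam x1 by (auto simp: x_def)
    have u0: "0 < u" using False lam by (simp add: u_def)
    have "(real p / real n) powr (2 * \<omega>) = ((real p / real n) powr 2) powr \<omega>" by (simp only: powr_powr)
    also have "(real p / real n) powr 2 = u * x"
      using False n lam by (simp add: u_def x_def power_divide)
    finally have "G * (real p / real n) powr (2 * \<omega>) = G * (u powr \<omega> * x powr \<omega>)"
      using u0 x0 by (simp add: powr_mult)
    also have "\<dots> = (u / 4) powr \<omega> * (D * x powr (\<omega> / (1 - \<omega>))) powr (1 - \<omega>)"
      using u0 x0 D0 \<omega> by (simp add: powr_mult powr_divide powr_powr D1)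
    also have "\<dots> \<le> \<omega> * (u / 4) + (1 - \<omega>) * (D * x powr (\<omega> / (1 - \<omega>)))"
      using u0 x0 D0 \<omega> by (intro Youngs_inequality_0) auto
    also have "\<dots> \<le> 1 * (u / 4) + 1 * (D * x powr (\<omega> / (1 - \<omega>)))"
      using u0 x0 D0 \<omega> by (intro add_mono mult_right_mono) auto
    also have "x powr (\<omega> / (1 - \<omega>)) \<le> x powr \<gamma>" using x0 \<gamma> by (intro powr_mono') auto
    finally show ?thesis using D0 by (simp add: x_def u_def)
  qed
  then show ?thesis using D0 by blast
qed

text \<open>With \<beta> = \<delta> \<theta>/2 the fractions are 1/(3 - 2 \<theta> + 4 \<beta>) and
  (1 - \<beta>)/(3 - 2 \<theta> + \<beta>). After cross-multiplication they differ by 2 \<beta>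
  (\<theta> - 2 \<beta>), nonnegative because 2 \<beta> = \<delta> \<theta> \<le> \<theta>, and zero
  for \<theta> = 0.\<close>

lemma rate_exponent:
  fixes \<theta> \<delta> :: real
  assumes \<theta>: "0 \<le> \<theta>" "\<theta> \<le> 1" and \<delta>: "0 < \<delta>" "\<delta> < 1"
  defines "\<omega> \<equiv> (1 - \<delta> * \<theta> / 2) * (1 / (2 - \<theta>)) / 2"
  shows "0 < \<omega>" "\<omega> < 1" "1 / (3 - 2 * (1 - \<delta>) * \<theta>) \<le> \<omega> / (1 - \<omega>)"
proof -
  define \<beta> where "\<beta> = \<delta> * \<theta> / 2"
  have dt: "0 \<le> \<delta> * \<theta>" "\<delta> * \<theta> \<le> \<theta>" using \<theta> \<delta> by (auto simp: mult_left_le_one_le)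
  have \<beta>: "0 \<le> \<beta>" "\<beta> \<le> 1/2" using dt \<theta> by (auto simp: \<beta>_def)
  have w: "\<omega> = (1 - \<beta>) / (4 - 2 * \<theta>)" using \<theta> by (simp add: \<omega>_def \<beta>_def field_simps)
  show "0 < \<omega>" using \<theta> \<beta> by (simp add: w)
  have "1 - \<omega> = (3 - 2 * \<theta> + \<beta>) / (4 - 2 * \<theta>)" using \<theta> by (simp add: w field_simps)
  then have r: "\<omega> / (1 - \<omega>) = (1 - \<beta>) / (3 - 2 * \<theta> + \<beta>)" using \<theta> by (simp add: w)
  show "\<omega> < 1" using \<theta> \<beta> by (simp add: w field_simps)
  have g: "3 - 2 * (1 - \<delta>) * \<theta> = 3 - 2 * \<theta> + 4 * \<beta>" by (simp add: \<beta>_def algebra_simps)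
  have "3 - 2 * \<theta> + \<beta> \<le> (1 - \<beta>) * (3 - 2 * \<theta> + 4 * \<beta>)"
  proof -
    have "\<beta> * \<beta> * 4 \<le> \<beta> * \<theta> * 2"
      using mult_left_mono[of "\<beta> * 2" \<theta> "\<beta> * 2"] \<beta> dt by (simp add: \<beta>_def algebra_simps)
    then show ?thesis by (simp add: algebra_simps)
  qed
  then show "1 / (3 - 2 * (1 - \<delta>) * \<theta>) \<le> \<omega> / (1 - \<omega>)"
    unfolding r g using \<theta> \<beta> by (simp add: divide_le_eq pos_le_divide_eq add_pos_nonneg)
qed

lemma vartheta_bounds: "0 \<le> vartheta \<alpha>" "vartheta \<alpha> \<le> 1"
  by (auto simp: vartheta_def divide_le_eq add_pos_nonneg)

context classification
begin

text \<open>The union over p is paid for by the factor exp (-p) in each failure probability; for a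
  given p the policies are united inside the class, at no charge. \<open>Dc\<close> passes in the
  trade of entropy for penalty, with S its remainder.\<close>

lemma uniform_excess_deviation:
  fixes \<alpha> :: ennreal and c \<delta> \<tau> lam Dc :: real and n k :: nat
  defines "\<theta> \<equiv> vartheta \<alpha>"
  defines "\<kappa> \<equiv> 1 / (2 - \<theta>)"
  assumes noise: "noise_exponent d P \<eta> \<alpha> c" and c: "c > 0" and d: "d \<ge> 1" and \<delta>: "0 < \<delta>" "\<delta> < 1"
    and n: "n \<ge> 1" and \<tau>: "1 \<le> \<tau>" "\<tau> \<le> real n" and Z: "\<forall>l\<in>{1..k}. Z l \<in> policies d"
    and Dc: "\<And>p. dev_const (\<delta> * \<theta> / 2) \<kappa> (1 + ln (8 * real d)) (c + 2) *
        (real p / real n) powr ((1 - \<delta> * \<theta> / 2) * \<kappa>) \<le> lam * (real p)\<^sup>2 / 4 + S"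
  shows "holds_upto n (2 * exp (- \<tau>)) (\<lambda>D. \<forall>p\<in>{..n}. \<forall>l\<in>{1..k}. \<forall>g\<in>trees d (Z l) p.
    \<bar>dev n (err g) D - dev n (err bayes) D\<bar> \<le> (risk P g - risk P bayes) / 2 +
      (lam * (real p)\<^sup>2 / 4 + S) + (16 * (4 * (c + 2) + 13) + 700) * (\<tau> / real n) powr \<kappa>)"
proof -
  let ?b = "1 + ln (8 * real d)"
  let ?G = "\<lambda>p. \<Union>l\<in>{1..k}. trees d (Z l) p"
  let ?M = "16 * (4 * (c + 2) + 13) + 700"
  have \<theta>: "0 \<le> \<theta>" "\<theta> \<le> 1" using vartheta_bounds by (auto simp: \<theta>_def)
  have b: "?b \<ge> 1" using d by simp
  have \<kappa>: "1/2 \<le> \<kappa>" "\<kappa> \<le> 1" using \<theta> by (auto simp: \<kappa>_def field_simps)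
  have \<beta>: "0 \<le> \<delta> * \<theta> / 2" "\<delta> * \<theta> / 2 = 0 \<Longrightarrow> \<kappa> = 1/2" using \<theta> \<delta> by (auto simp: \<kappa>_def)
  have meas: "g \<in> cube d \<rightarrow>\<^sub>M labels" if "g \<in> ?G p" for g p
    using that Z trees_measurable by blast
  have margin: "\<exists>h q. 0 < h \<and> h \<le> 1 \<and> 0 \<le> q \<and> h * q + w / h \<le> (c + 2) * w powr \<kappa> \<and>
      (\<forall>E\<in>err ` ?G p. prob (sym_diff E (err bayes)) \<le> q + (prob E - prob (err bayes)) / h)"
    if w: "0 < w" "w \<le> 1" for w p
  proof -
    obtain h where h: "h > 0" "h \<le> 1" "h * measure PX {x \<in> space (cube d). \<bar>2 * \<eta> x - 1\<bar> \<le> h} + w / h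
      \<le> (c + 2) * w powr \<kappa>"
      using margin_scale[OF noise c w] by (auto simp: \<kappa>_def \<theta>_def)
    show ?thesis
      using h bayes_margin(1)[OF meas h(1)]
      by (intro exI[of _ h] exI[of _ "measure PX {x \<in> space (cube d). \<bar>2 * \<eta> x - 1\<bar> \<le> h}"])
        (auto simp: risk_err)
  qed
  have one: "holds_upto n (exp (- (real p + \<tau>)))
    (\<lambda>D. \<forall>E\<in>err ` ?G p. \<bar>dev n E D - dev n (err bayes) D\<bar> \<le> (prob E - prob (err bayes)) / 2 +
      dev_const (\<delta> * \<theta> / 2) \<kappa> ?b (c + 2) * (real p / real n) powr ((1 - \<delta> * \<theta> / 2) * \<kappa>) +
      ?M * (\<tau> / real n) powr \<kappa>)" if p: "p \<in> {..n}" for p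
  proof (rule excess_deviation)
    show "finite (err ` ?G p)" using Z finite_trees by auto
    show "err ` ?G p \<subseteq> events" using meas err_sets by blast
    show "growth_le (err ` ?G p) ?b p" by (rule trees_growth[OF d]) (use Z in blast)
    show "err bayes \<in> events" by (intro err_sets bayes_measurable)
    show "prob (err bayes) \<le> prob E" if "E \<in> err ` ?G p" for E
      using that bayes_margin(2)[OF meas zero_less_one] by (auto simp: risk_err)
  qed (use b n \<tau> p \<kappa> \<beta> c margin in auto)
  have "holds_upto n (\<Sum>p\<in>{..n}. exp (- (real p + \<tau>))) (\<lambda>D. \<forall>p\<in>{..n}. \<forall>E\<in>err ` ?G p.
      \<bar>dev n E D - dev n (err bayes) D\<bar> \<le> (prob E - prob (err bayes)) / 2 +
      dev_const (\<delta> * \<theta> / 2) \<kappa> ?b (c + 2) * (real p / real n) powr ((1 - \<delta> * \<theta> / 2) * \<kappa>) +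
      ?M * (\<tau> / real n) powr \<kappa>)"
    by (intro holds_upto_ball one) auto
  then show ?thesis
  proof (rule holds_upto_mono)
    have "(\<Sum>p\<in>{..n}. exp (- (real p + \<tau>))) = exp (- \<tau>) * (\<Sum>p\<in>{..n}. exp (- real p))"
      by (simp add: sum_distrib_left exp_diff exp_minus field_simps exp_add)
    also have "(\<Sum>p\<in>{..n}. exp (- real p)) \<le> (\<Sum>p\<in>{..n}. (1/2) ^ p)"
    proof (intro sum_mono)
      fix p
      show "exp (- real p) \<le> (1/2) ^ p"
        using exp_numeral_ge[of p] by (simp add: exp_minus power_one_over inverse_eq_divide frac_le)
    qed
    also have "\<dots> \<le> 2" using sum_half_powers_le[of "Suc n"] by (simp only: lessThan_Suc_atMost)
    finally show "(\<Sum>p\<in>{..n}. exp (- (real p + \<tau>))) \<le> 2 * exp (- \<tau>)" by simp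
  next
    fix D assume *: "\<forall>p\<in>{..n}. \<forall>E\<in>err ` ?G p.
      \<bar>dev n E D - dev n (err bayes) D\<bar> \<le> (prob E - prob (err bayes)) / 2 +
      dev_const (\<delta> * \<theta> / 2) \<kappa> ?b (c + 2) * (real p / real n) powr ((1 - \<delta> * \<theta> / 2) * \<kappa>) +
      ?M * (\<tau> / real n) powr \<kappa>"
    show "\<forall>p\<in>{..n}. \<forall>l\<in>{1..k}. \<forall>g\<in>trees d (Z l) p.
      \<bar>dev n (err g) D - dev n (err bayes) D\<bar> \<le> (risk P g - risk P bayes) / 2 +
      (lam * (real p)\<^sup>2 / 4 + S) + ?M * (\<tau> / real n) powr \<kappa>"
    proof (intro ballI)
      fix p l g assume "p \<in> {..n}" "l \<in> {1..k}" "g \<in> trees d (Z l) p"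
      then have "\<bar>dev n (err g) D - dev n (err bayes) D\<bar> \<le> (prob (err g) - prob (err bayes)) / 2 +
        dev_const (\<delta> * \<theta> / 2) \<kappa> ?b (c + 2) * (real p / real n) powr ((1 - \<delta> * \<theta> / 2) * \<kappa>) +
        ?M * (\<tau> / real n) powr \<kappa>" using * by blast
      then show "\<bar>dev n (err g) D - dev n (err bayes) D\<bar> \<le> (risk P g - risk P bayes) / 2 +
        (lam * (real p)\<^sup>2 / 4 + S) + ?M * (\<tau> / real n) powr \<kappa>"
        using Dc[of p] unfolding risk_err by linarith
    qed
  qed
qed

lemma emp_risk_eq_dev:
  assumes D: "D \<in> space (\<Pi>\<^sub>M i\<in>{..<n}. P)"
  shows "emp_risk n D g = dev n (err g) D + risk P g"
proof -
  have "of_bool (g (fst (D i)) \<noteq> snd (D i)) = (indicator (err g) (D i) :: real)" if "i < n" for i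
  proof -
    have "D i \<in> space P" using D that by (auto simp: space_PiM)
    then show ?thesis by (simp add: err_def indicator_def)
  qed
  then show ?thesis by (simp add: emp_risk_def dev_def emp_mean_def risk_err)
qed

text \<open>The deviation of the Bayes rule cancels between the two trees. The empirical comparison
  leaves 1/2 of the excess risk and 3/4 of the penalty on the left against 3/2 and 5/4 on the right;
  doubling gives the factors 3 and 5/2, both below 9, and the remainder 4 S + 4 T.\<close>

lemma oracle_inequality:
  assumes D: "D \<in> space (\<Pi>\<^sub>M i\<in>{..<n}. P)"
    and dev: "\<And>p l g. p \<le> n \<Longrightarrow> l \<in> {1..k} \<Longrightarrow> g \<in> trees d (Z l) p \<Longrightarrow>
      \<bar>dev n (err g) D - dev n (err bayes) D\<bar> \<le> (risk P g - risk P bayes) / 2 +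
      (lam * (real p)\<^sup>2 / 4 + S) + T"
    and p_le: "\<And>p. real p \<le> lam powr (-1/2) \<Longrightarrow> p \<le> n" and lam: "lam > 0"
    and Z: "\<forall>l\<in>{1..k}. Z l \<in> policies d"
    and sel: "best_scored d k Z lam (emp_risk n D) gp"
    and star: "best_scored d k Z lam (risk P) (gstar, pstar)"
  shows "lam * (real (snd gp))\<^sup>2 + risk P (fst gp) - bayes_risk d P
     \<le> 9 * (lam * (real pstar)\<^sup>2 + risk P gstar - bayes_risk d P) + 4 * S + 4 * T"
proof -
  obtain g p where gp: "gp = (g, p)" by (cases gp)
  have cand: "(g, p) \<in> candidates d k Z lam" "(gstar, pstar) \<in> candidates d k Z lam"
    using sel star by (auto simp: best_scored_def is_arg_min_def gp)
  then obtain l l' where l: "l \<in> {1..k}" "g \<in> trees d (Z l) p" "p \<le> n"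
    and l': "l' \<in> {1..k}" "gstar \<in> trees d (Z l') pstar" "pstar \<le> n"
    using p_le by (auto simp: candidates_def)
  have min: "lam * (real p)\<^sup>2 + emp_risk n D g \<le> lam * (real pstar)\<^sup>2 + emp_risk n D gstar"
    using sel cand(2) by (fastforce simp: best_scored_def is_arg_min_def gp not_less)
  have nn: "0 \<le> risk P gstar - risk P bayes" "0 \<le> lam * (real pstar)\<^sup>2" "0 \<le> lam * (real p)\<^sup>2"
    using bayes_margin(2)[OF trees_measurable zero_less_one, of "Z l'" gstar pstar] l' Z lam by auto
  show ?thesis
    using dev[OF l(3,1,2)] dev[OF l'(3,1,2)] min nn
    unfolding gp fst_conv snd_conv bayes_risk_eq emp_risk_eq_dev[OF D] by argo
qed

text \<open>The restriction p \<le> lam^(-1/2) bounds the penalty by 1. This settles the parameter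
  ranges in which the right-hand side of the theorem is at least 2.\<close>

lemma objective_le_2:
  assumes cand: "(g, p) \<in> candidates d k Z lam" and lam: "lam > 0" and Z: "\<forall>l\<in>{1..k}. Z l \<in> policies d"
  shows "lam * (real p)\<^sup>2 + risk P g - bayes_risk d P \<le> 2"
    "0 \<le> lam * (real p)\<^sup>2 + risk P g - bayes_risk d P"
proof -
  obtain l where l: "l \<in> {1..k}" "g \<in> trees d (Z l) p" and p: "real p \<le> lam powr (-1/2)"
    using cand by (auto simp: candidates_def)
  have "(real p)\<^sup>2 \<le> (lam powr (-1/2))\<^sup>2" using p by (intro power_mono) auto
  also have "\<dots> = lam powr (-1)" by (simp add: power2_eq_square powr_add[symmetric])
  finally have "lam * (real p)\<^sup>2 \<le> lam * lam powr (-1)" using lam by (intro mult_left_mono) auto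
  also have "\<dots> = 1" using lam by (simp add: powr_minus)
  finally have "lam * (real p)\<^sup>2 \<le> 1" .
  moreover have "risk P g \<le> 1" "0 \<le> bayes_risk d P"
    unfolding bayes_risk_eq risk_err by simp_all
  ultimately show "lam * (real p)\<^sup>2 + risk P g - bayes_risk d P \<le> 2" by linarith
  have "0 \<le> lam * (real p)\<^sup>2" using lam by simp
  then show "0 \<le> lam * (real p)\<^sup>2 + risk P g - bayes_risk d P"
    using bayes_margin(2)[OF trees_measurable zero_less_one, of "Z l" g p] l Z
    unfolding bayes_risk_eq by fastforce
qed

end

theorem theorem3p1:
  fixes \<alpha> :: ennreal and c :: real
  assumes "c > 0"
  shows "\<exists>V::real. V > 0 \<and> (\<forall>(d::nat) (\<delta>::real). d \<ge> 1 \<and> 0 < \<delta> \<and> \<delta> < 1 \<longrightarrow>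
    (\<exists>C::real. C > 0 \<and>
      (\<forall>(P :: ((nat \<Rightarrow> real) \<times> int) measure) (\<eta> :: (nat \<Rightarrow> real) \<Rightarrow> real)
         (n::nat) (k::nat) (\<tau>::real) (lam::real) (Z :: nat \<Rightarrow> nat \<Rightarrow> split_rule)
         (sel :: (nat \<Rightarrow> (nat \<Rightarrow> real) \<times> int) \<Rightarrow> ((nat \<Rightarrow> real) \<Rightarrow> int) \<times> nat)
         (gstar :: (nat \<Rightarrow> real) \<Rightarrow> int) (pstar :: nat).
         prob_space P \<longrightarrow>
         sets P = sets (cube d \<Otimes>\<^sub>M labels) \<longrightarrow>
         is_posterior d P \<eta> \<longrightarrow>
         noise_exponent d P \<eta> \<alpha> c \<longrightarrow>
         n \<ge> 1 \<longrightarrow> k \<ge> 1 \<longrightarrow> \<tau> > 0 \<longrightarrow> lam > 0 \<longrightarrow>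
         (\<forall>l\<in>{1..k}. Z l \<in> policies d) \<longrightarrow>
         best_scored_selection d P n k Z lam sel \<longrightarrow>
         best_scored d k Z lam (risk P) (gstar, pstar) \<longrightarrow>
         measure (\<Pi>\<^sub>M i\<in>{..<n}. P)
           {D \<in> space (\<Pi>\<^sub>M i\<in>{..<n}. P).
              lam * (real (snd (sel D)))\<^sup>2 + risk P (fst (sel D)) - bayes_risk d P
              \<le> 9 * (lam * (real pstar)\<^sup>2 + risk P gstar - bayes_risk d P)
                + C * (1 / (lam * (real n)\<^sup>2)) powr (1 / (3 - 2 * (1 - \<delta>) * vartheta \<alpha>))
                + 3 * (72 * V * \<tau> / real n) powr (1 / (2 - vartheta \<alpha>))
                + 15 * \<tau> / real n}
         \<ge> 1 - 3 * exp (- \<tau>))))"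
proof -
  define \<theta> where "\<theta> = vartheta \<alpha>"
  define \<kappa> where "\<kappa> = 1 / (2 - \<theta>)"
  define M0 where "M0 = 16 * (4 * (c + 2) + 13) + 700"
  \<comment> \<open>Chosen before d and \<delta>. Since \<kappa> \<ge> 1/2 and V \<ge> 1, (72
    V)^\<kappa> is at least sqrt V = 2 M0, and three times that dominates the 4 M0 of the oracle
    inequality.\<close>
  define V where "V = (2 * M0)\<^sup>2"
  have \<theta>: "0 \<le> \<theta>" "\<theta> \<le> 1" using vartheta_bounds by (auto simp: \<theta>_def)
  have \<kappa>: "1/2 \<le> \<kappa>" "\<kappa> \<le> 1" using \<theta> by (auto simp: \<kappa>_def field_simps)
  have M0: "M0 \<ge> 700" using assms by (simp add: M0_def)
  have V0: "V > 0" using M0 by (simp add: V_def)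
  have V\<kappa>: "2 * M0 \<le> (72 * V) powr \<kappa>"
  proof -
    have V1: "1 \<le> V" unfolding V_def using M0 by (intro one_le_power) simp
    have "2 * M0 = sqrt ((2 * M0)\<^sup>2)" using M0 by (simp only: real_sqrt_abs)
    also have "\<dots> = V powr (1/2)" using V0 by (simp only: V_def powr_half_sqrt less_imp_le)
    also have "\<dots> \<le> (72 * V) powr (1/2)" using V0 by (intro powr_mono2) auto
    also have "\<dots> \<le> (72 * V) powr \<kappa>" using V1 \<kappa> by (intro powr_mono) auto
    finally show ?thesis .
  qed
  show ?thesis
  proof (rule exI[of _ V], intro conjI V0 allI impI)
    fix d :: nat and \<delta> :: real
    assume d\<delta>: "1 \<le> d \<and> 0 < \<delta> \<and> \<delta> < 1"
    define b where "b = 1 + ln (8 * real d)"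
    define \<beta> where "\<beta> = \<delta> * \<theta> / 2"
    define \<gamma> where "\<gamma> = 1 / (3 - 2 * (1 - \<delta>) * \<theta>)"
    define \<omega> where "\<omega> = (1 - \<beta>) * \<kappa> / 2"
    have b: "b \<ge> 1" using d\<delta> by (simp add: b_def)
    have \<omega>: "0 < \<omega>" "\<omega> < 1" "\<gamma> \<le> \<omega> / (1 - \<omega>)"
      using rate_exponent[OF \<theta>, of \<delta>] d\<delta> by (auto simp: \<omega>_def \<beta>_def \<gamma>_def \<kappa>_def)
    have \<gamma>0: "\<gamma> \<ge> 0"
    proof -
      have "(1 - \<delta>) * \<theta> \<le> 1" using \<theta> d\<delta> by (intro mult_le_one) auto
      then have "0 \<le> 3 - 2 * (1 - \<delta>) * \<theta>" by argo
      then show ?thesis unfolding \<gamma>_def by (rule divide_nonneg_nonneg[OF zero_le_one])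
    qed
    have "dev_const \<beta> \<kappa> b (c + 2) > 0"
      using b assms \<theta> d\<delta> by (intro dev_const_pos) (auto simp: \<beta>_def)
    from penalty_absorbs[OF \<omega> this] obtain K where K: "K > 0"
      "\<And>p n lam. n > 0 \<Longrightarrow> lam > 0 \<Longrightarrow> 1 / (lam * (real n)\<^sup>2) \<le> 1 \<Longrightarrow>
        dev_const \<beta> \<kappa> b (c + 2) * (real p / real n) powr (2 * \<omega>)
          \<le> lam * (real p)\<^sup>2 / 4 + K * (1 / (lam * (real n)\<^sup>2)) powr \<gamma>"
      by blast
    \<comment> \<open>4 K is the 4 S of the oracle inequality; the summand 2 makes the claim trivial
      for lam n^2 < 1, where x^\<gamma> \<ge> 1.\<close>
    define C where "C = 4 * K + 2"
    have C0: "C > 0" using K by (simp add: C_def)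
    show "\<exists>C::real. C > 0 \<and>
      (\<forall>(P :: ((nat \<Rightarrow> real) \<times> int) measure) (\<eta> :: (nat \<Rightarrow> real) \<Rightarrow> real)
         (n::nat) (k::nat) (\<tau>::real) (lam::real) (Z :: nat \<Rightarrow> nat \<Rightarrow> split_rule)
         (sel :: (nat \<Rightarrow> (nat \<Rightarrow> real) \<times> int) \<Rightarrow> ((nat \<Rightarrow> real) \<Rightarrow> int) \<times> nat)
         (gstar :: (nat \<Rightarrow> real) \<Rightarrow> int) (pstar :: nat).
         prob_space P \<longrightarrow>
         sets P = sets (cube d \<Otimes>\<^sub>M labels) \<longrightarrow>
         is_posterior d P \<eta> \<longrightarrow>
         noise_exponent d P \<eta> \<alpha> c \<longrightarrow>
         n \<ge> 1 \<longrightarrow> k \<ge> 1 \<longrightarrow> \<tau> > 0 \<longrightarrow> lam > 0 \<longrightarrow>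
         (\<forall>l\<in>{1..k}. Z l \<in> policies d) \<longrightarrow>
         best_scored_selection d P n k Z lam sel \<longrightarrow>
         best_scored d k Z lam (risk P) (gstar, pstar) \<longrightarrow>
         measure (\<Pi>\<^sub>M i\<in>{..<n}. P)
           {D \<in> space (\<Pi>\<^sub>M i\<in>{..<n}. P).
              lam * (real (snd (sel D)))\<^sup>2 + risk P (fst (sel D)) - bayes_risk d P
              \<le> 9 * (lam * (real pstar)\<^sup>2 + risk P gstar - bayes_risk d P)
                + C * (1 / (lam * (real n)\<^sup>2)) powr (1 / (3 - 2 * (1 - \<delta>) * vartheta \<alpha>))
                + 3 * (72 * V * \<tau> / real n) powr (1 / (2 - vartheta \<alpha>))
                + 15 * \<tau> / real n}
         \<ge> 1 - 3 * exp (- \<tau>))"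
      unfolding \<theta>_def[symmetric] \<kappa>_def[symmetric] \<gamma>_def[symmetric]
    proof (intro exI[of _ C] conjI C0 allI impI)
      fix P :: "((nat \<Rightarrow> real) \<times> int) measure" and \<eta> :: "(nat \<Rightarrow> real) \<Rightarrow> real"
        and n k :: nat and \<tau> lam :: real and Z :: "nat \<Rightarrow> nat \<Rightarrow> split_rule"
        and sel :: "(nat \<Rightarrow> (nat \<Rightarrow> real) \<times> int) \<Rightarrow> ((nat \<Rightarrow> real) \<Rightarrow> int) \<times> nat"
        and gstar :: "(nat \<Rightarrow> real) \<Rightarrow> int" and pstar :: nat
      assume P: "prob_space P" "sets P = sets (cube d \<Otimes>\<^sub>M labels)" "is_posterior d P \<eta>"
        and noise: "noise_exponent d P \<eta> \<alpha> c" and n: "n \<ge> 1" and k: "k \<ge> 1" and \<tau>: "\<tau> > 0"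
        and lam: "lam > 0" and Z: "\<forall>l\<in>{1..k}. Z l \<in> policies d"
        and sel: "best_scored_selection d P n k Z lam sel"
        and star: "best_scored d k Z lam (risk P) (gstar, pstar)"
      interpret prob_space P by (rule P(1))
      interpret classification P d \<eta> by unfold_locales (use P in auto)
      let ?N = "\<Pi>\<^sub>M i\<in>{..<n}. P"
      interpret N: prob_space ?N by (rule prob_space_sample)
      define x where "x = 1 / (lam * (real n)\<^sup>2)"
      define rhs where "rhs = 9 * (lam * (real pstar)\<^sup>2 + risk P gstar - bayes_risk d P)
                + C * x powr \<gamma> + 3 * (72 * V * \<tau> / real n) powr \<kappa> + 15 * \<tau> / real n"
      define good where "good = (\<lambda>gp. lam * (real (snd gp))\<^sup>2 + risk P (fst gp) - bayes_risk d P \<le> rhs)"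
      have selm: "sel \<in> ?N \<rightarrow>\<^sub>M count_space (candidates d k Z lam)"
        and best: "\<And>D. D \<in> space ?N \<Longrightarrow> best_scored d k Z lam (emp_risk n D) (sel D)"
        using sel by (auto simp: best_scored_selection_def)
      have selc: "sel D \<in> candidates d k Z lam" if "D \<in> space ?N" for D
        using best[OF that] by (auto simp: best_scored_def is_arg_min_def)
      have starc: "(gstar, pstar) \<in> candidates d k Z lam"
        using star by (auto simp: best_scored_def is_arg_min_def)
      have star0: "0 \<le> lam * (real pstar)\<^sup>2 + risk P gstar - bayes_risk d P"
        by (rule objective_le_2(2)[OF starc lam Z])
      have le2: "lam * (real (snd (sel D)))\<^sup>2 + risk P (fst (sel D)) - bayes_risk d P \<le> 2" if "D \<in> space ?N" for D
        using objective_le_2(1)[of "fst (sel D)" "snd (sel D)"] selc[OF that] lam Z by simp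
      \<comment> \<open>The candidates carry the discrete sigma-algebra, so measurability of
        \<open>sel\<close> makes the event measurable for any criterion on the chosen pair.\<close>
      have "{D \<in> space ?N. good (sel D)} = sel -` {gp \<in> candidates d k Z lam. good gp} \<inter> space ?N"
        using selc by auto
      also have "\<dots> \<in> sets ?N" using selm by (rule measurable_sets) auto
      finally have event: "{D \<in> space ?N. good (sel D)} \<in> sets ?N" .
      have trivial_bound: "measure ?N {D \<in> space ?N. good (sel D)} \<ge> 1 - 3 * exp (- \<tau>)" if "2 \<le> rhs"
      proof -
        have "{D \<in> space ?N. good (sel D)} = space ?N" using le2 that by (auto simp: good_def intro: order_trans)
        then show ?thesis by (simp add: N.prob_space)
      qed
      have x0: "x > 0" using lam n by (simp add: x_def)
      have terms0: "0 \<le> C * x powr \<gamma>" "0 \<le> 3 * (72 * V * \<tau> / real n) powr \<kappa>" "0 \<le> 15 * \<tau> / real n"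
        using C0 \<tau> by auto
      \<comment> \<open>For \<tau> \<le> 1, 3 exp (-\<tau>) \<ge> 1; for \<tau> > n the last term
        and for x > 1 the C-term is at least 2. Elsewhere lam n^2 \<ge> 1, hence p \<le> lam^(-1/2)
        \<le> n.\<close>
      have "measure ?N {D \<in> space ?N. good (sel D)} \<ge> 1 - 3 * exp (- \<tau>)"
      proof (cases "\<tau> \<le> 1 \<or> \<tau> > real n \<or> x > 1")
        case True
        then consider "\<tau> \<le> 1" | "\<tau> > real n" | "x > 1" by blast
        then show ?thesis
        proof cases
          case 1
          have "1 / 3 \<le> exp (- 1 :: real)" using exp_le by (simp add: exp_minus field_simps)
          also have "\<dots> \<le> exp (- \<tau>)" using 1 by simp
          finally have "1 - 3 * exp (- \<tau>) \<le> 0" by simp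
          then show ?thesis using measure_nonneg order_trans by blast
        next
          case 2
          then have "15 \<le> 15 * \<tau> / real n" using n by (simp add: field_simps)
          then have "2 \<le> rhs" using terms0 star0 unfolding rhs_def by argo
          then show ?thesis by (rule trivial_bound)
        next
          case 3
          then have "1 \<le> x powr \<gamma>" using \<gamma>0 by (simp add: ge_one_powr_ge_zero)
          then have "2 * 1 \<le> C * x powr \<gamma>" using K(1) by (intro mult_mono) (auto simp: C_def)
          then have "2 \<le> rhs" using terms0 star0 unfolding rhs_def by argo
          then show ?thesis by (rule trivial_bound)
        qed
      next
        case False
        then have \<tau>1: "1 \<le> \<tau>" "\<tau> \<le> real n" and x1: "x \<le> 1" by auto
        have p_le: "p \<le> n" if "real p \<le> lam powr (-1/2)" for p
        proof -
          have "1 \<le> lam * (real n)\<^sup>2" using x1 lam n by (simp add: x_def divide_le_eq)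
          moreover have "lam powr (-1/2) = 1 / sqrt lam"
            using lam by (simp add: powr_minus powr_half_sqrt inverse_eq_divide)
          ultimately have "lam powr (-1/2) \<le> real n"
            using lam n real_sqrt_le_mono[of 1 "lam * (real n)\<^sup>2"]
            by (simp add: real_sqrt_mult divide_le_eq mult.commute)
          then show ?thesis using that by linarith
        qed
        let ?T = "M0 * (\<tau> / real n) powr \<kappa>"
        have "holds_upto n (2 * exp (- \<tau>)) (\<lambda>D. \<forall>p\<in>{..n}. \<forall>l\<in>{1..k}. \<forall>g\<in>trees d (Z l) p.
          \<bar>dev n (err g) D - dev n (err bayes) D\<bar> \<le> (risk P g - risk P bayes) / 2 +
          (lam * (real p)\<^sup>2 / 4 + K * x powr \<gamma>) + ?T)"
          unfolding M0_def \<kappa>_def \<theta>_def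
        proof (rule uniform_excess_deviation[OF noise assms _ _ _ n \<tau>1 Z])
          fix p
          have "(1 - \<delta> * \<theta> / 2) * \<kappa> = 2 * \<omega>" by (simp add: \<omega>_def \<beta>_def)
          then show "dev_const (\<delta> * vartheta \<alpha> / 2) (1 / (2 - vartheta \<alpha>)) (1 + ln (8 * real d)) (c + 2) *
            (real p / real n) powr ((1 - \<delta> * vartheta \<alpha> / 2) * (1 / (2 - vartheta \<alpha>)))
            \<le> lam * (real p)\<^sup>2 / 4 + K * x powr \<gamma>"
            unfolding \<theta>_def[symmetric] \<kappa>_def[symmetric] b_def[symmetric] \<beta>_def[symmetric]
            using K(2)[of n lam p] n lam x1 by (simp add: x_def \<beta>_def)
        qed (use d\<delta> in auto)
        then obtain Bad where Bad: "Bad \<in> sets ?N" "measure ?N Bad \<le> 2 * exp (- \<tau>)"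
          "\<And>D p l g. D \<in> space ?N - Bad \<Longrightarrow> p \<le> n \<Longrightarrow> l \<in> {1..k} \<Longrightarrow> g \<in> trees d (Z l) p \<Longrightarrow>
            \<bar>dev n (err g) D - dev n (err bayes) D\<bar> \<le> (risk P g - risk P bayes) / 2 +
            (lam * (real p)\<^sup>2 / 4 + K * x powr \<gamma>) + ?T"
          unfolding holds_upto_def by blast
        have T: "4 * ?T \<le> 3 * (72 * V * \<tau> / real n) powr \<kappa>"
        proof -
          have "4 * ?T \<le> 3 * (2 * M0 * (\<tau> / real n) powr \<kappa>)" using M0 by simp
          also have "\<dots> \<le> 3 * ((72 * V) powr \<kappa> * (\<tau> / real n) powr \<kappa>)"
            using V\<kappa> by (intro mult_left_mono mult_right_mono) auto
          also have "(72 * V) powr \<kappa> * (\<tau> / real n) powr \<kappa> = (72 * V * \<tau> / real n) powr \<kappa>"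
            using V0 \<tau> by (subst powr_mult[symmetric]) auto
          finally show ?thesis .
        qed
        have "space ?N - Bad \<subseteq> {D \<in> space ?N. good (sel D)}"
        proof
          fix D assume D: "D \<in> space ?N - Bad"
          then have DN: "D \<in> space ?N" by simp
          have "lam * (real (snd (sel D)))\<^sup>2 + risk P (fst (sel D)) - bayes_risk d P
            \<le> 9 * (lam * (real pstar)\<^sup>2 + risk P gstar - bayes_risk d P) + 4 * (K * x powr \<gamma>) + 4 * ?T"
            by (rule oracle_inequality[OF DN Bad(3)[OF D] p_le lam Z best[OF DN] star])
          moreover have "4 * (K * x powr \<gamma>) \<le> C * x powr \<gamma>" by (simp add: C_def algebra_simps)
          ultimately have "good (sel D)" using T terms0 unfolding good_def rhs_def by linarith
          then show "D \<in> {D \<in> space ?N. good (sel D)}" using DN by simp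
        qed
        then have "measure ?N (space ?N - Bad) \<le> measure ?N {D \<in> space ?N. good (sel D)}"
          using event by (rule N.finite_measure_mono)
        then show ?thesis using Bad(2) N.prob_compl[OF Bad(1)] exp_ge_zero[of "- \<tau>"] by linarith
      qed
      then show "1 - 3 * exp (- \<tau>) \<le> measure ?N {D \<in> space ?N.
          lam * (real (snd (sel D)))\<^sup>2 + risk P (fst (sel D)) - bayes_risk d P
              \<le> 9 * (lam * (real pstar)\<^sup>2 + risk P gstar - bayes_risk d P)
                + C * (1 / (lam * (real n)\<^sup>2)) powr \<gamma>
                + 3 * (72 * V * \<tau> / real n) powr \<kappa>
                + 15 * \<tau> / real n}"
        by (simp only: good_def rhs_def x_def)
    qed
  qed
qed

end
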